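(* For every real $c \geq 1$, the Veech group $\Gamma(S_c)\subset \mathrm{GL}(2,\mathbb{R})$ of the translation surface $S_c$ is generated by the involutions $-I$, $$A_c=\begin{pmatrix}-1 & 0\\ 0 & 1\end{pmatrix},\qquad B_c=\begin{pmatrix}-1 & 2\\ 0 & 1\end{pmatrix},\qquad C_c=\begin{pmatrix}-c & c-1\\ -c-1 & c\end{pmatrix}.$$
   Context: The surfaces $S_c$: for real $c\ge 1$ let $T_c:\mathbb{R}^2\to\mathbb{R}^2$, $T_c(x,y)=(cx+(c-1)y+1,\ (c+1)x+cy+1)$, and $P_c^k=T_c^k(0,0)$ for $k\in\mathbb{Z}$ (for $c=1$, $P_1^k=(k,k^2)$). Let $Q_c^+$ be the convex hull of $\{P_c^k\}_{k\in\mathbb{Z}}$ (an infinite polygon with edges $\overline{P_c^kP_c^{k+1}}$), and let $Q_c^-$ be the image of $Q_c^+$ under the rotation by $\pi$. $S_c$ is the translation surface obtained by gluing each edge of $Q_c^+$ by a translation to its image edge in $Q_c^-$. A translation surface is a surface built from polygons in $\mathbb{R}^2$ by identifying edges by translations (here from two infinite polygons); it carries an induced metric and a notion of direction. Two translation surfaces are the same if there is a direction-preserving isometry between them. For $A\in\mathrm{GL}(2,\mathbb{R})$ and $S$ glued from polygons $P_i$, $A(S)$ is the surface glued from the polygons $A(P_i)$ by the same edge identifications. The Veech group $\Gamma(S)$ is the group of all $A\in\mathrm{GL}(2,\mathbb{R})$ such that $A(S)$ and $S$ are the same. *)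

theory Defs
  imports "HOL-Analysis.Analysis" "HOL-Algebra.Generated_Groups"
begin

text \<open>
  Polygons in the plane together with edge identifications. An element (i, E, j, w) of
  \<open>gluings\<close> says that the edge E of piece i is glued to the edge E + w of piece j
  by the translation by w.
\<close>

record 'i gluing =
  indices :: "'i set"
  piece :: "'i \<Rightarrow> (real^2) set"
  gluings :: "('i \<times> (real^2) set \<times> 'i \<times> (real^2)) set"

definition glue_points :: "'i gluing \<Rightarrow> ('i \<times> (real^2)) set" where
  "glue_points S = Sigma (indices S) (piece S)"

definition glued :: "'i gluing \<Rightarrow> 'i \<times> (real^2) \<Rightarrow> 'i \<times> (real^2) \<Rightarrow> bool" where
  "glued S x y \<longleftrightarrow> (\<exists>i E j w p. (i, E, j, w) \<in> gluings S \<and> p \<in> E \<and> x = (i, p) \<and> y = (j, p + w))"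

definition glue_rel :: "'i gluing \<Rightarrow> (('i \<times> (real^2)) \<times> ('i \<times> (real^2))) set" where
  "glue_rel S = {(x, y). x \<in> glue_points S \<and> y \<in> glue_points S \<and> equivclp (glued S) x y}"

text \<open>The surface is the quotient of the disjoint union of the pieces; the classes of vertices
  belong to it (as cone points).\<close>

definition surface :: "'i gluing \<Rightarrow> ('i \<times> (real^2)) set set" where
  "surface S = glue_points S // glue_rel S"

definition pt :: "'i gluing \<Rightarrow> 'i \<Rightarrow> real^2 \<Rightarrow> ('i \<times> (real^2)) set" where
  "pt S i p = glue_rel S `` {(i, p)}"

text \<open>\<open>broken_line S X Y l\<close>: a broken line of length l, each of whose finitely many
  segments lies in a single piece, joins X to Y in the surface. The induced metric is the infimum
  of these lengths (meaningful for connected surfaces).\<close>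

inductive broken_line ::
  "'i gluing \<Rightarrow> ('i \<times> (real^2)) set \<Rightarrow> ('i \<times> (real^2)) set \<Rightarrow> real \<Rightarrow> bool"
  for S where
  start: "X \<in> surface S \<Longrightarrow> broken_line S X X 0"
| extend: "\<lbrakk> broken_line S X (pt S i p) l; i \<in> indices S; closed_segment p q \<subseteq> piece S i \<rbrakk>
    \<Longrightarrow> broken_line S X (pt S i q) (l + dist p q)"

definition surface_dist ::
  "'i gluing \<Rightarrow> ('i \<times> (real^2)) set \<Rightarrow> ('i \<times> (real^2)) set \<Rightarrow> real" where
  "surface_dist S X Y = Inf {l. broken_line S X Y l}"

text \<open>The curve \<open>\<gamma>\<close> starts out, for a short time, along a straight segment of some
  piece with velocity v. These germs of straight segments express the notion of direction, at
  interior points, at edge points and at vertices alike. Gluings are by translations, so the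
  velocity does not depend on the piece chosen.\<close>

definition initial_velocity ::
  "'i gluing \<Rightarrow> (real \<Rightarrow> ('i \<times> (real^2)) set) \<Rightarrow> real^2 \<Rightarrow> bool" where
  "initial_velocity S \<gamma> v \<longleftrightarrow>
     (\<exists>i\<in>indices S. \<exists>p. \<exists>\<epsilon>>0. \<forall>t\<in>{0..\<epsilon>}.
        p + t *\<^sub>R v \<in> piece S i \<and> \<gamma> t = pt S i (p + t *\<^sub>R v))"

definition surface_isometry ::
  "'i gluing \<Rightarrow> 'j gluing \<Rightarrow> (('i \<times> (real^2)) set \<Rightarrow> ('j \<times> (real^2)) set) \<Rightarrow> bool" where
  "surface_isometry S S' f \<longleftrightarrow> bij_betw f (surface S) (surface S') \<and>
     (\<forall>X\<in>surface S. \<forall>Y\<in>surface S. surface_dist S' (f X) (f Y) = surface_dist S X Y)"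

definition direction_preserving ::
  "'i gluing \<Rightarrow> 'j gluing \<Rightarrow> (('i \<times> (real^2)) set \<Rightarrow> ('j \<times> (real^2)) set) \<Rightarrow> bool" where
  "direction_preserving S S' f \<longleftrightarrow>
     (\<forall>\<gamma> v. range \<gamma> \<subseteq> surface S \<longrightarrow>
        (initial_velocity S \<gamma> v \<longleftrightarrow> initial_velocity S' (f \<circ> \<gamma>) v))"

definition same_surface :: "'i gluing \<Rightarrow> 'j gluing \<Rightarrow> bool" where
  "same_surface S S' \<longleftrightarrow> (\<exists>f. surface_isometry S S' f \<and> direction_preserving S S' f)"

definition linear_image :: "real^2^2 \<Rightarrow> 'i gluing \<Rightarrow> 'i gluing" where
  "linear_image A S =
     \<lparr> indices = indices S,
       piece = (\<lambda>i. (*v) A ` piece S i),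
       gluings = (\<lambda>(i, E, j, w). (i, (*v) A ` E, j, A *v w)) ` gluings S \<rparr>"

definition veech_group :: "'i gluing \<Rightarrow> (real^2^2) set" where
  "veech_group S = {A. invertible A \<and> same_surface (linear_image A S) S}"

definition GL2 :: "(real^2^2) monoid" where
  "GL2 = \<lparr> carrier = {A. invertible A}, mult = (**), one = mat 1 \<rparr>"

lemma group_GL2: "group GL2"
proof (rule groupI)
  fix A assume "A \<in> carrier GL2"
  then obtain B where "A ** B = mat 1" "B ** A = mat 1"
    by (auto simp: GL2_def invertible_def)
  then show "\<exists>B\<in>carrier GL2. B \<otimes>\<^bsub>GL2\<^esub> A = \<one>\<^bsub>GL2\<^esub>"
    by (auto simp: GL2_def invertible_def)
next
  show "\<one>\<^bsub>GL2\<^esub> \<in> carrier GL2"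
    by (auto simp: GL2_def invertible_def intro: exI[of _ "mat 1"])
qed (simp_all add: GL2_def invertible_mult matrix_mul_assoc)

definition T_map :: "real \<Rightarrow> real^2 \<Rightarrow> real^2" where
  "T_map c v = vector [c * v$1 + (c - 1) * v$2 + 1, (c + 1) * v$1 + c * v$2 + 1]"

definition vertex :: "real \<Rightarrow> int \<Rightarrow> real^2" where
  "vertex c k = (if k \<ge> 0 then (T_map c ^^ nat k) 0 else (inv_into UNIV (T_map c) ^^ nat (- k)) 0)"

lemma bij_T_map: "bij (T_map c)"
proof (rule bijI)
  let ?U = "\<lambda>w. vector [c * (w$1 - 1) - (c - 1) * (w$2 - 1),
                        c * (w$2 - 1) - (c + 1) * (w$1 - 1)] :: real^2"
  have "?U (T_map c v) = v" for v
    by (simp add: T_map_def vec_eq_iff forall_2 algebra_simps)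
  then show "inj (T_map c)" by (metis injI)
  have "T_map c (?U w) = w" for w
    by (simp add: T_map_def vec_eq_iff forall_2 algebra_simps)
  then show "surj (T_map c)" by (intro surjI)
qed

lemma vertex_0: "vertex c 0 = 0"
  by (simp add: vertex_def)

lemma vertex_step: "vertex c (k + 1) = T_map c (vertex c k)"
proof (cases "k \<ge> 0")
  case True
  then have "nat (k + 1) = Suc (nat k)" by simp
  with True show ?thesis by (simp add: vertex_def)
next
  case False
  then have "nat (- k) = Suc (nat (- (k + 1)))" by simp
  with False show ?thesis
    by (cases "k = -1") (simp_all add: vertex_def surj_f_inv_f bij_is_surj[OF bij_T_map])
qed

lemma vertex_1: "vertex 1 k = vector [of_int k, (of_int k)\<^sup>2]"
proof (induction k rule: int_induct[of _ 0])
  case base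
  show ?case by (simp add: vertex_0 vec_eq_iff forall_2)
next
  case (step1 i)
  then show ?case
    by (simp only: vertex_step) (simp add: T_map_def vec_eq_iff forall_2 power2_eq_square algebra_simps)
next
  case (step2 i)
  have "T_map 1 (vertex 1 (i - 1)) = vertex 1 i"
    using vertex_step[of 1 "i - 1"] by simp
  also have "\<dots> = T_map 1 (vector [of_int (i - 1), (of_int (i - 1))\<^sup>2])"
    unfolding step2(2)
    by (simp add: T_map_def vec_eq_iff forall_2 power2_eq_square algebra_simps)
  finally show ?case using bij_is_inj[OF bij_T_map] by (metis injD)
qed

definition Q_plus :: "real \<Rightarrow> (real^2) set" where
  "Q_plus c = convex hull (range (vertex c))"

definition Q_minus :: "real \<Rightarrow> (real^2) set" where
  "Q_minus c = uminus ` Q_plus c"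

definition edge :: "real \<Rightarrow> int \<Rightarrow> (real^2) set" where
  "edge c k = closed_segment (vertex c k) (vertex c (k + 1))"

text \<open>The index \<open>True\<close> stands for the upper polygon and \<open>False\<close> for its image under
  the rotation by \<open>\<pi>\<close>.\<close>

definition S_surf :: "real \<Rightarrow> bool gluing" where
  "S_surf c =
     \<lparr> indices = UNIV,
       piece = (\<lambda>i. if i then Q_plus c else Q_minus c),
       gluings = {(True, edge c k, False, - (vertex c k + vertex c (k + 1))) | k. True} \<rparr>"

text \<open>The rotation reverses the edge, so the translation onto its image takes each endpoint to the
  negative of the other one.\<close>

lemma edge_translate: "(\<lambda>p. p + - (vertex c k + vertex c (k + 1))) ` edge c k = uminus ` edge c k"
proof -
  have "(\<lambda>p. p + w) ` closed_segment a b = uminus ` closed_segment a b" if "w = - (a + b)"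
    for a b w :: "real^2"
  proof -
    have "(\<lambda>p. p + w) ` closed_segment a b = closed_segment (a + w) (b + w)"
      using closed_segment_translation[of w a b] by (simp add: add.commute)
    also have "\<dots> = closed_segment (- b) (- a)" using that by simp
    also have "\<dots> = uminus ` closed_segment a b"
      using closed_segment_linear_image[of uminus a b]
      by (simp add: closed_segment_commute linear_uminus)
    finally show ?thesis .
  qed
  then show ?thesis by (simp add: edge_def)
qed

definition mat_A :: "real^2^2" where
  "mat_A = vector [vector [-1, 0], vector [0, 1]]"

definition mat_B :: "real^2^2" where
  "mat_B = vector [vector [-1, 2], vector [0, 1]]"

definition mat_C :: "real \<Rightarrow> real^2^2" where
  "mat_C c = vector [vector [- c, c - 1], vector [- c - 1, c]]"

end

theory Submission
  imports Defs
begin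

text \<open>
  An element D of the Veech group is the linear part of an affine automorphism of the surface: a
  bijection that carries germs of straight segments with velocity v to germs with velocity D v
  (\<open>veech_group_iff\<close>). Such a map preserves the metric up to this change of lengths, for the image of a segment
  has straight germs in both directions at every time, so by compactness it is a broken line,
  whose length can be read off from the velocities (\<open>direction_preserving_imp_isometry\<close>).

  The generators come from symmetries. The rotation by \<open>\<pi>\<close> exchanges the two polygons. The
  polygon has an affine reflection that exchanges the vertices k and - k, with linear part A, and
  one that exchanges k and 1 - k, with linear part C. The horizontal chords joining the vertices - k and k cut the
  surface into horizontal cylinders whose circumference is always twice the height. Hence they admit a
  simultaneous reflection with linear part B, which agrees on their common boundaries with
  the reflection that belongs to A (\<open>mat_B_in_veech_group\<close>).

  Conversely, an affine automorphism permutes the two singular points, because these are the points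
  at which straight germs branch. So its linear part D maps the set of holonomies, i.e. of the
  displacement vectors of straight connections between singular points, to itself. Four facts about
  holonomies are used. The height of a non-horizontal one is up to sign a sum of heights of cylinders, so the
  possible heights are discrete and at least 1 (\<open>joined_rise\<close>). A horizontal one has length
  at least 2 (\<open>joined_horizontal\<close>). None points into the recession cone of the
  upper polygon (\<open>not_joined_recession\<close>). A connection of height 1 crosses the lowest
  cylinder only, so it joins two different singular points (\<open>joined_rise_1\<close>).

  The chord between the vertices - 1 and 1 is a loop with holonomy (2, 0). Its image D (2, 0) is moved
  by a continued fraction algorithm (\<open>reduce_holonomy\<close>). The involutions A and - 1 and the
  shears in the group generated by A and B bring a vector (x, y) into the sector \<open>0 \<le> x \<le> y\<close>
  without changing the size of y. If the vector is not diagonal, it lies outside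
  the recession cone, and C decreases the size of y. By discreteness the algorithm stops with a horizontal
  or a diagonal vector. Thus it may be assumed that D (2, 0) is of one of these two kinds. The
  diagonal kind would be a loop of height 1 and is impossible. In the horizontal case the bounds on
  lengths and heights, applied to D and to its inverse, show that D is a shear up to
  signs, and one more step with C shows that it is a power of the product of A and B.
\<close>

section \<open>Germs of straight segments on glued surfaces\<close>

lemma mem_glue_points [simp]: "(i, p) \<in> glue_points S \<longleftrightarrow> i \<in> indices S \<and> p \<in> piece S i"
  by (simp add: glue_points_def)

lemma pt_mem_iff: "x \<in> pt S i p \<longleftrightarrow>
    (i, p) \<in> glue_points S \<and> x \<in> glue_points S \<and> equivclp (glued S) (i, p) x"
  by (auto simp: pt_def glue_rel_def)

lemma self_mem_pt: "(i, p) \<in> glue_points S \<Longrightarrow> (i, p) \<in> pt S i p"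
  by (simp add: pt_mem_iff)

lemma pt_eq_iff:
  assumes "(i, p) \<in> glue_points S"
  shows "pt S i p = pt S j q \<longleftrightarrow> (j, q) \<in> glue_points S \<and> equivclp (glued S) (i, p) (j, q)"
proof
  assume "pt S i p = pt S j q"
  then have "(i, p) \<in> pt S j q" using self_mem_pt[OF assms] by simp
  then show "(j, q) \<in> glue_points S \<and> equivclp (glued S) (i, p) (j, q)"
    by (auto simp: pt_mem_iff intro: equivclp_sym)
next
  assume *: "(j, q) \<in> glue_points S \<and> equivclp (glued S) (i, p) (j, q)"
  have "equivclp (glued S) (i, p) x \<longleftrightarrow> equivclp (glued S) (j, q) x" for x
    using * equivclp_trans[of "glued S" "(i, p)" "(j, q)" x]
      equivclp_trans[of "glued S" "(j, q)" "(i, p)" x] equivclp_sym[of "glued S" "(i, p)" "(j, q)"]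
    by metis
  then show "pt S i p = pt S j q" using * assms by (simp add: set_eq_iff pt_mem_iff)
qed

lemma pt_eqI_glued:
  assumes "glued S (i, p) (j, q)" "(i, p) \<in> glue_points S" "(j, q) \<in> glue_points S"
  shows "pt S i p = pt S j q"
  using assms by (auto simp: pt_eq_iff[OF assms(2)])

lemma pt_in_surface: "(i, p) \<in> glue_points S \<Longrightarrow> pt S i p \<in> surface S"
  by (auto simp: surface_def pt_def quotient_def)

lemma surface_cases:
  assumes "X \<in> surface S"
  obtains i p where "(i, p) \<in> glue_points S" "X = pt S i p"
  using assms by (auto simp: surface_def pt_def quotient_def)

text \<open>A ray in a piece as a curve that is defined for all times: the parameter is clamped to
  [0, e], so that the curve does not leave the surface.\<close>

definition clamp_line :: "'i gluing \<Rightarrow> 'i \<Rightarrow> real^2 \<Rightarrow> real^2 \<Rightarrow> real \<Rightarrow> real \<Rightarrow> ('i \<times> (real^2)) set" where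
  "clamp_line S i p v e t = pt S i (p + max 0 (min e t) *\<^sub>R v)"

lemma clamp_line_eq: "0 \<le> t \<Longrightarrow> t \<le> e \<Longrightarrow> clamp_line S i p v e t = pt S i (p + t *\<^sub>R v)"
  by (simp add: clamp_line_def)

lemma clamp_line_in_surface:
  assumes "i \<in> indices S" "0 \<le> e" "\<And>t. 0 \<le> t \<Longrightarrow> t \<le> e \<Longrightarrow> p + t *\<^sub>R v \<in> piece S i"
  shows "clamp_line S i p v e t \<in> surface S"
  unfolding clamp_line_def using assms by (intro pt_in_surface) auto

lemma initial_velocity_line:
  assumes "i \<in> indices S" "0 < e" "\<And>t. 0 \<le> t \<Longrightarrow> t \<le> e \<Longrightarrow> p + t *\<^sub>R v \<in> piece S i"
    and "\<And>t. 0 \<le> t \<Longrightarrow> t \<le> e \<Longrightarrow> \<gamma> t = pt S i (p + t *\<^sub>R v)"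
  shows "initial_velocity S \<gamma> v"
  unfolding initial_velocity_def
proof (intro bexI[of _ i] exI[of _ p] exI[of _ e] conjI ballI)
  fix t assume "t \<in> {0..e}"
  then show "p + t *\<^sub>R v \<in> piece S i" "\<gamma> t = pt S i (p + t *\<^sub>R v)"
    using assms(3)[of t] assms(4)[of t] by simp_all
qed (use assms in simp_all)

lemma initial_velocityD:
  "initial_velocity S \<gamma> v \<Longrightarrow> \<exists>i p e. i \<in> indices S \<and> 0 < e \<and>
    (\<forall>t. 0 \<le> t \<longrightarrow> t \<le> e \<longrightarrow> p + t *\<^sub>R v \<in> piece S i \<and> \<gamma> t = pt S i (p + t *\<^sub>R v))"
  unfolding initial_velocity_def Ball_def Bex_def atLeastAtMost_iff by meson

section \<open>Preserving directions forces preserving distances\<close>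

lemma broken_line_extend_ray:
  assumes "broken_line S X (pt S i p) l" "i \<in> indices S" "0 \<le> e"
    and "\<And>t. 0 \<le> t \<Longrightarrow> t \<le> e \<Longrightarrow> p + t *\<^sub>R v \<in> piece S i"
  shows "broken_line S X (pt S i (p + e *\<^sub>R v)) (l + e * norm v)"
proof -
  have "closed_segment p (p + e *\<^sub>R v) \<subseteq> piece S i"
  proof
    fix x assume "x \<in> closed_segment p (p + e *\<^sub>R v)"
    then obtain u where u: "0 \<le> u" "u \<le> 1" "x = (1 - u) *\<^sub>R p + u *\<^sub>R (p + e *\<^sub>R v)"
      by (auto simp: closed_segment_def)
    then have "x = p + (u * e) *\<^sub>R v" by (simp add: algebra_simps)
    moreover have "0 \<le> u * e" "u * e \<le> e"
      using u assms(3) by (auto simp: mult_left_le_one_le)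
    ultimately show "x \<in> piece S i" using assms(4) by simp
  qed
  from broken_line.extend[OF assms(1,2) this] show ?thesis
    using assms(3) by (simp add: dist_norm)
qed

lemma broken_line_extend_ray_back:
  assumes "broken_line S X (pt S i (p + e *\<^sub>R v)) l" "i \<in> indices S" "0 \<le> e"
    and "\<And>t. 0 \<le> t \<Longrightarrow> t \<le> e \<Longrightarrow> p + t *\<^sub>R v \<in> piece S i"
  shows "broken_line S X (pt S i p) (l + e * norm v)"
proof -
  have "p + e *\<^sub>R v + t *\<^sub>R (- v) \<in> piece S i" if "0 \<le> t" "t \<le> e" for t
    using assms(4)[of "e - t"] that by (simp add: algebra_simps)
  from broken_line_extend_ray[OF assms(1-3) this] show ?thesis by simp
qed

text \<open>A segment in a piece is mapped to a curve with straight germs in both directions at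
  every time. By compactness of the parameter interval this curve is a broken line, with the same
  length as the segment.\<close>

lemma broken_line_image_segment:
  assumes "bij_betw f (surface S) (surface S')" and dp: "direction_preserving S S' f"
    and bl: "broken_line S' X (f (pt S i p)) l" and i: "i \<in> indices S"
    and seg: "closed_segment p q \<subseteq> piece S i"
  shows "broken_line S' X (f (pt S i q)) (l + dist p q)"
proof -
  define v where "v = q - p"
  define \<gamma> where "\<gamma> = clamp_line S i p v 1"
  have piece: "p + t *\<^sub>R v \<in> piece S i" if "0 \<le> t" "t \<le> 1" for t
  proof -
    have "p + t *\<^sub>R v = (1 - t) *\<^sub>R p + t *\<^sub>R q" by (simp add: v_def algebra_simps)
    then show ?thesis using seg that by (auto simp: closed_segment_def)
  qed
  have surf: "\<gamma> t \<in> surface S" for t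
    unfolding \<gamma>_def using piece i by (intro clamp_line_in_surface) auto
  have fwd: "initial_velocity S' (\<lambda>s. f (\<gamma> (x + s))) v" if "0 \<le> x" "x < 1" for x
  proof -
    have "initial_velocity S (\<lambda>s. \<gamma> (x + s)) v"
    proof (rule initial_velocity_line[of i S "1 - x" "p + x *\<^sub>R v"])
      fix t assume t: "0 \<le> t" "t \<le> 1 - x"
      have eq: "p + x *\<^sub>R v + t *\<^sub>R v = p + (x + t) *\<^sub>R v" by (simp add: algebra_simps)
      show "p + x *\<^sub>R v + t *\<^sub>R v \<in> piece S i" unfolding eq using t that by (intro piece) auto
      show "\<gamma> (x + t) = pt S i (p + x *\<^sub>R v + t *\<^sub>R v)"
        unfolding eq \<gamma>_def using t that by (intro clamp_line_eq) auto
    qed (use i that in auto)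
    moreover have "range (\<lambda>s. \<gamma> (x + s)) \<subseteq> surface S" using surf by auto
    ultimately show ?thesis
      using dp[unfolded direction_preserving_def, rule_format, of "\<lambda>s. \<gamma> (x + s)" v]
      by (simp add: comp_def)
  qed
  have bwd: "initial_velocity S' (\<lambda>s. f (\<gamma> (x - s))) (- v)" if "0 < x" "x \<le> 1" for x
  proof -
    have "initial_velocity S (\<lambda>s. \<gamma> (x - s)) (- v)"
    proof (rule initial_velocity_line[of i S "x" "p + x *\<^sub>R v"])
      fix t assume t: "0 \<le> t" "t \<le> x"
      have eq: "p + x *\<^sub>R v + t *\<^sub>R - v = p + (x - t) *\<^sub>R v" by (simp add: algebra_simps)
      show "p + x *\<^sub>R v + t *\<^sub>R - v \<in> piece S i" unfolding eq using t that by (intro piece) auto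
      show "\<gamma> (x - t) = pt S i (p + x *\<^sub>R v + t *\<^sub>R - v)"
        unfolding eq \<gamma>_def using t that by (intro clamp_line_eq) auto
    qed (use i that in auto)
    moreover have "range (\<lambda>s. \<gamma> (x - s)) \<subseteq> surface S" using surf by auto
    ultimately show ?thesis
      using dp[unfolded direction_preserving_def, rule_format, of "\<lambda>s. \<gamma> (x - s)" "- v"]
      by (simp add: comp_def)
  qed
  define P where "P a b \<longleftrightarrow> (0 \<le> a \<longrightarrow> b \<le> 1 \<longrightarrow> (\<forall>l. broken_line S' X (f (\<gamma> a)) l
      \<longrightarrow> broken_line S' X (f (\<gamma> b)) (l + (b - a) * norm v)))" for a b
  have forward: "\<exists>d>0. \<forall>b l. x \<le> b \<and> b - x < d \<and> 0 \<le> x \<and> b \<le> 1 \<longrightarrow> broken_line S' X (f (\<gamma> x)) l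
      \<longrightarrow> broken_line S' X (f (\<gamma> b)) (l + (b - x) * norm v)" for x
  proof (cases "0 \<le> x \<and> x < 1")
    case True
    then have "initial_velocity S' (\<lambda>s. f (\<gamma> (x + s))) v" using fwd by blast
    then obtain j r e where j: "j \<in> indices S'" "0 < e"
      "\<And>t. 0 \<le> t \<Longrightarrow> t \<le> e \<Longrightarrow> r + t *\<^sub>R v \<in> piece S' j"
      "\<And>t. 0 \<le> t \<Longrightarrow> t \<le> e \<Longrightarrow> f (\<gamma> (x + t)) = pt S' j (r + t *\<^sub>R v)"
      using initial_velocityD by blast
    show ?thesis
    proof (intro exI[of _ e] conjI allI impI)
      fix b l assume b: "x \<le> b \<and> b - x < e \<and> 0 \<le> x \<and> b \<le> 1" and l: "broken_line S' X (f (\<gamma> x)) l"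
      have "broken_line S' X (pt S' j r) l" using l j(4)[of 0] j(2) by simp
      then have "broken_line S' X (pt S' j (r + (b - x) *\<^sub>R v)) (l + (b - x) * norm v)"
        by (rule broken_line_extend_ray) (use j b in auto)
      then show "broken_line S' X (f (\<gamma> b)) (l + (b - x) * norm v)" using j(4)[of "b - x"] b by simp
    qed (use j in auto)
  next
    case False
    then have "x = b" if "0 \<le> x" "x \<le> b" "b \<le> 1" for b using that by linarith
    then show ?thesis by (intro exI[of _ 1]) force
  qed
  have backward: "\<exists>d>0. \<forall>a l. a \<le> x \<and> x - a < d \<and> 0 \<le> a \<and> x \<le> 1 \<longrightarrow> broken_line S' X (f (\<gamma> a)) l
      \<longrightarrow> broken_line S' X (f (\<gamma> x)) (l + (x - a) * norm v)" for x
  proof (cases "0 < x \<and> x \<le> 1")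
    case True
    then have "initial_velocity S' (\<lambda>s. f (\<gamma> (x - s))) (- v)" using bwd by blast
    then obtain j r e where j: "j \<in> indices S'" "0 < e"
      "\<And>t. 0 \<le> t \<Longrightarrow> t \<le> e \<Longrightarrow> r + t *\<^sub>R (- v) \<in> piece S' j"
      "\<And>t. 0 \<le> t \<Longrightarrow> t \<le> e \<Longrightarrow> f (\<gamma> (x - t)) = pt S' j (r + t *\<^sub>R (- v))"
      using initial_velocityD by blast
    show ?thesis
    proof (intro exI[of _ e] conjI allI impI)
      fix a l assume a: "a \<le> x \<and> x - a < e \<and> 0 \<le> a \<and> x \<le> 1" and l: "broken_line S' X (f (\<gamma> a)) l"
      have "broken_line S' X (pt S' j (r + (x - a) *\<^sub>R - v)) l"
        using l j(4)[of "x - a"] a by simp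
      then have "broken_line S' X (pt S' j r) (l + (x - a) * norm (- v))"
        by (rule broken_line_extend_ray_back) (use j a in auto)
      then show "broken_line S' X (f (\<gamma> x)) (l + (x - a) * norm v)" using j(4)[of 0] j(2) by simp
    qed (use j in auto)
  next
    case False
    then have "x = a" if "0 \<le> a" "a \<le> x" "x \<le> 1" for a using that by linarith
    then show ?thesis by (intro exI[of _ 1]) force
  qed
  have "(0::real) \<le> 1" by simp
  then have "P 0 1"
  proof (induction rule: Bolzano)
    case (trans a b c)
    show ?case unfolding P_def
    proof (intro impI allI)
      fix l assume *: "0 \<le> a" "c \<le> 1" "broken_line S' X (f (\<gamma> a)) l"
      then have "broken_line S' X (f (\<gamma> b)) (l + (b - a) * norm v)" using trans unfolding P_def by auto
      then have "broken_line S' X (f (\<gamma> c)) (l + (b - a) * norm v + (c - b) * norm v)"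
        using trans * unfolding P_def by auto
      then show "broken_line S' X (f (\<gamma> c)) (l + (c - a) * norm v)" by (simp add: algebra_simps)
    qed
  next
    case (local x)
    obtain d1 where d1: "d1 > 0" "\<And>b l. x \<le> b \<and> b - x < d1 \<and> 0 \<le> x \<and> b \<le> 1 \<Longrightarrow> broken_line S' X (f (\<gamma> x)) l
      \<Longrightarrow> broken_line S' X (f (\<gamma> b)) (l + (b - x) * norm v)" using forward by blast
    obtain d2 where d2: "d2 > 0" "\<And>a l. a \<le> x \<and> x - a < d2 \<and> 0 \<le> a \<and> x \<le> 1 \<Longrightarrow> broken_line S' X (f (\<gamma> a)) l
      \<Longrightarrow> broken_line S' X (f (\<gamma> x)) (l + (x - a) * norm v)" using backward by blast
    have "P a b" if "a \<le> x \<and> x \<le> b \<and> b - a < min d1 d2" for a b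
      unfolding P_def
    proof (intro impI allI)
      fix l assume *: "0 \<le> a" "b \<le> 1" "broken_line S' X (f (\<gamma> a)) l"
      then have "broken_line S' X (f (\<gamma> x)) (l + (x - a) * norm v)" using d2 that by auto
      then have "broken_line S' X (f (\<gamma> b)) (l + (x - a) * norm v + (b - x) * norm v)"
        using d1 that * by auto
      then show "broken_line S' X (f (\<gamma> b)) (l + (b - a) * norm v)" by (simp add: algebra_simps)
    qed
    then show ?case using d1 d2 by (intro exI[of _ "min d1 d2"]) auto
  qed
  moreover have "\<gamma> 0 = pt S i p" "\<gamma> 1 = pt S i q" by (simp_all add: \<gamma>_def clamp_line_def v_def)
  ultimately have "broken_line S' X (f (pt S i q)) (l + norm v)" using bl unfolding P_def by auto
  then show ?thesis by (simp add: v_def dist_norm norm_minus_commute)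
qed

lemma broken_line_image:
  assumes bij: "bij_betw f (surface S) (surface S')" and dp: "direction_preserving S S' f"
    and "broken_line S X Y l"
  shows "broken_line S' (f X) (f Y) l"
  using assms(3)
proof induction
  case (start X)
  then show ?case using bij by (auto intro: broken_line.start dest: bij_betwE)
next
  case (extend X i p l q)
  show ?case by (rule broken_line_image_segment[OF bij dp extend.IH extend.hyps(2,3)])
qed

lemma direction_preserving_inverse:
  assumes bij: "bij_betw f (surface S) (surface S')" and dp: "direction_preserving S S' f"
  shows "direction_preserving S' S (the_inv_into (surface S) f)"
  unfolding direction_preserving_def
proof (intro allI impI)
  fix \<gamma> :: "real \<Rightarrow> _" and v assume \<gamma>: "range \<gamma> \<subseteq> surface S'"
  let ?g = "the_inv_into (surface S) f"
  have "f \<circ> (?g \<circ> \<gamma>) = \<gamma>" using \<gamma> f_the_inv_into_f_bij_betw[OF bij] by (auto simp: fun_eq_iff)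
  moreover have "range (?g \<circ> \<gamma>) \<subseteq> surface S"
    using \<gamma> bij_betw_the_inv_into[OF bij] by (auto dest: bij_betwE)
  ultimately show "initial_velocity S' \<gamma> v \<longleftrightarrow> initial_velocity S (?g \<circ> \<gamma>) v"
    using dp unfolding direction_preserving_def by metis
qed

text \<open>The map and its inverse carry broken lines to broken lines of the same length, so both
  distances are infima of the same set of lengths.\<close>

lemma direction_preserving_imp_isometry:
  assumes bij: "bij_betw f (surface S) (surface S')" and dp: "direction_preserving S S' f"
  shows "surface_isometry S S' f"
  unfolding surface_isometry_def
proof (intro conjI ballI bij)
  fix X Y assume XY: "X \<in> surface S" "Y \<in> surface S"
  let ?g = "the_inv_into (surface S) f"
  have g: "?g (f X) = X" "?g (f Y) = Y"
    using XY bij by (metis bij_betw_imp_inj_on the_inv_into_f_f)+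
  have "broken_line S X Y l \<longleftrightarrow> broken_line S' (f X) (f Y) l" for l
  proof
    assume "broken_line S X Y l"
    then show "broken_line S' (f X) (f Y) l" by (rule broken_line_image[OF bij dp])
  next
    assume "broken_line S' (f X) (f Y) l"
    then have "broken_line S (?g (f X)) (?g (f Y)) l"
      by (rule broken_line_image[OF bij_betw_the_inv_into[OF bij] direction_preserving_inverse[OF bij dp]])
    then show "broken_line S X Y l" using g by simp
  qed
  then show "surface_dist S' (f X) (f Y) = surface_dist S X Y" by (simp add: surface_dist_def)
qed

section \<open>The Veech group in terms of affine automorphisms\<close>

text \<open>The composition of an identification of A(S) with S and the tautological map from S to A(S),
  described on S alone. In this form automorphisms can be composed and inverted.\<close>

definition affine_automorphism ::
  "'i gluing \<Rightarrow> real^2^2 \<Rightarrow> (('i \<times> (real^2)) set \<Rightarrow> ('i \<times> (real^2)) set) \<Rightarrow> bool" where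
  "affine_automorphism S D g \<longleftrightarrow> bij_betw g (surface S) (surface S) \<and>
     (\<forall>\<gamma> v. range \<gamma> \<subseteq> surface S \<longrightarrow>
        (initial_velocity S \<gamma> v \<longleftrightarrow> initial_velocity S (g \<circ> \<gamma>) (D *v v)))"

lemma affine_automorphism_id: "affine_automorphism S (mat 1) id"
  by (simp add: affine_automorphism_def)

lemma affine_automorphism_comp:
  assumes "affine_automorphism S D g" "affine_automorphism S E h"
  shows "affine_automorphism S (D ** E) (g \<circ> h)"
  unfolding affine_automorphism_def
proof (intro conjI allI impI)
  show "bij_betw (g \<circ> h) (surface S) (surface S)"
    using assms bij_betw_trans unfolding affine_automorphism_def by blast
next
  fix \<gamma> :: "real \<Rightarrow> _" and v assume \<gamma>: "range \<gamma> \<subseteq> surface S"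
  have "range (h \<circ> \<gamma>) \<subseteq> surface S"
    using \<gamma> assms(2) by (auto simp: affine_automorphism_def dest: bij_betwE)
  then have "initial_velocity S (h \<circ> \<gamma>) (E *v v) \<longleftrightarrow> initial_velocity S (g \<circ> (h \<circ> \<gamma>)) (D *v (E *v v))"
    using assms(1) unfolding affine_automorphism_def by blast
  moreover have "initial_velocity S \<gamma> v \<longleftrightarrow> initial_velocity S (h \<circ> \<gamma>) (E *v v)"
    using assms(2) \<gamma> unfolding affine_automorphism_def by blast
  ultimately show "initial_velocity S \<gamma> v \<longleftrightarrow> initial_velocity S (g \<circ> h \<circ> \<gamma>) (D ** E *v v)"
    by (simp add: matrix_vector_mul_assoc comp_assoc)
qed

lemma affine_automorphism_inverse:
  assumes "affine_automorphism S D g" "D ** E = mat 1"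
  shows "affine_automorphism S E (the_inv_into (surface S) g)"
  unfolding affine_automorphism_def
proof (intro conjI allI impI)
  let ?h = "the_inv_into (surface S) g"
  have bij: "bij_betw g (surface S) (surface S)" using assms(1) by (simp add: affine_automorphism_def)
  then show "bij_betw ?h (surface S) (surface S)" by (rule bij_betw_the_inv_into)
  fix \<gamma> :: "real \<Rightarrow> _" and v assume \<gamma>: "range \<gamma> \<subseteq> surface S"
  have "g \<circ> (?h \<circ> \<gamma>) = \<gamma>" using \<gamma> f_the_inv_into_f_bij_betw[OF bij] by (auto simp: fun_eq_iff)
  moreover have "range (?h \<circ> \<gamma>) \<subseteq> surface S"
    using \<gamma> bij_betw_the_inv_into[OF bij] by (auto dest: bij_betwE)
  ultimately show "initial_velocity S \<gamma> v \<longleftrightarrow> initial_velocity S (?h \<circ> \<gamma>) (E *v v)"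
    using assms unfolding affine_automorphism_def by (metis matrix_vector_mul_assoc matrix_vector_mul_lid)
qed

abbreviation map_pts :: "real^2^2 \<Rightarrow> 'i \<times> (real^2) \<Rightarrow> 'i \<times> (real^2)" where
  "map_pts A \<equiv> map_prod id ((*v) A)"

context
  fixes A B :: "real^2^2"
  assumes inv: "A ** B = mat 1" "B ** A = mat 1"
begin

lemma inj_mul: "A *v p = A *v q \<longleftrightarrow> p = q"
  by (metis inv(2) matrix_vector_mul_assoc matrix_vector_mul_lid)

lemma mul_inv: "A *v (B *v p) = p"
  by (metis inv(1) matrix_vector_mul_assoc matrix_vector_mul_lid)

lemma inj_map_pts: "inj (map_pts A)"
  by (auto simp: inj_def inj_mul)

lemma map_pts_inv: "map_pts A (map_pts B x) = x"
  by (cases x) (simp add: mul_inv)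

lemma glued_linear_image:
  "glued (linear_image A S) (map_pts A x) (map_pts A y) \<longleftrightarrow> glued S x y" (is "?L \<longleftrightarrow> ?R")
proof
  assume ?L
  then obtain i E j w p where *: "(i, E, j, w) \<in> gluings S" "p \<in> E"
    "map_pts A x = (i, A *v p)" "map_pts A y = (j, A *v p + A *v w)"
    by (auto simp: glued_def linear_image_def)
  then have "x = (i, p)" "y = (j, p + w)"
    by (cases x, cases y, auto simp: inj_mul simp flip: matrix_vector_right_distrib)+
  then show ?R using * by (auto simp: glued_def)
next
  assume ?R
  then obtain i E j w p where *: "(i, E, j, w) \<in> gluings S" "p \<in> E" "x = (i, p)" "y = (j, p + w)"
    by (auto simp: glued_def)
  then have "(i, (*v) A ` E, j, A *v w) \<in> gluings (linear_image A S)"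
    by (force simp: linear_image_def)
  then show ?L using * unfolding glued_def
    by (intro exI[of _ i] exI[of _ "(*v) A ` E"] exI[of _ j] exI[of _ "A *v w"] exI[of _ "A *v p"])
      (simp add: matrix_vector_right_distrib)
qed

lemma equivclp_glued_linear_image:
  "equivclp (glued (linear_image A S)) (map_pts A x) (map_pts A y) \<longleftrightarrow> equivclp (glued S) x y"
  (is "?L \<longleftrightarrow> ?R")
proof
  assume ?L
  have "equivclp (glued (linear_image A S)) (map_pts A x) z \<Longrightarrow> equivclp (glued S) x (map_pts B z)" for z
  proof (induction rule: equivclp_induct)
    case base
    have "map_pts B (map_pts A x) = x" using map_pts_inv inj_map_pts by (metis injD)
    then show ?case by (simp only: equivclp_refl)
  next
    case (step y z)
    then have "glued S (map_pts B y) (map_pts B z) \<or> glued S (map_pts B z) (map_pts B y)"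
      by (metis map_pts_inv glued_linear_image)
    with step.IH show ?case by (rule equivclp_into_equivclp)
  qed
  from this[OF \<open>?L\<close>] show ?R by (metis map_pts_inv inj_map_pts injD)
next
  assume ?R
  then show ?L
  proof (induction rule: equivclp_induct)
    case (step y z)
    then have "glued (linear_image A S) (map_pts A y) (map_pts A z)
        \<or> glued (linear_image A S) (map_pts A z) (map_pts A y)"
      by (simp only: glued_linear_image)
    with step.IH show ?case by (rule equivclp_into_equivclp)
  qed (rule equivclp_refl)
qed

lemma glue_points_linear_image: "map_pts A x \<in> glue_points (linear_image A S) \<longleftrightarrow> x \<in> glue_points S"
  by (cases x) (auto simp: glue_points_def linear_image_def inj_mul)

lemma pt_linear_image: "pt (linear_image A S) i (A *v p) = map_pts A ` pt S i p"
proof -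
  have "map_pts A x \<in> pt (linear_image A S) i (A *v p) \<longleftrightarrow> x \<in> pt S i p" for x
    using glue_points_linear_image[of "(i, p)"] glue_points_linear_image[of x]
      equivclp_glued_linear_image[of S "(i, p)" x]
    by (simp add: pt_mem_iff del: mem_glue_points)
  then have "map_pts A x \<in> pt (linear_image A S) i (A *v p) \<longleftrightarrow> map_pts A x \<in> map_pts A ` pt S i p" for x
    by (simp only: inj_image_mem_iff[OF inj_map_pts])
  from this[of "map_pts B y" for y, unfolded map_pts_inv] show ?thesis unfolding set_eq_iff by blast
qed

lemma surface_linear_image: "surface (linear_image A S) = (`) (map_pts A) ` surface S"
proof
  show "surface (linear_image A S) \<subseteq> (`) (map_pts A) ` surface S"
  proof
    fix X assume "X \<in> surface (linear_image A S)"
    then obtain i p where ip: "(i, p) \<in> glue_points (linear_image A S)" "X = pt (linear_image A S) i p"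
      by (elim surface_cases)
    then have "(i, B *v p) \<in> glue_points S"
      using glue_points_linear_image[of "(i, B *v p)"] by (simp add: mul_inv del: mem_glue_points)
    moreover have "X = map_pts A ` pt S i (B *v p)" using ip pt_linear_image[of S i "B *v p"] mul_inv by simp
    ultimately show "X \<in> (`) (map_pts A) ` surface S" by (simp only: imageI pt_in_surface)
  qed
next
  show "(`) (map_pts A) ` surface S \<subseteq> surface (linear_image A S)"
  proof
    fix X assume "X \<in> (`) (map_pts A) ` surface S"
    then obtain i p where ip: "(i, p) \<in> glue_points S" "X = map_pts A ` pt S i p"
      by (auto elim: surface_cases)
    have "(i, A *v p) \<in> glue_points (linear_image A S)"
      using ip(1) glue_points_linear_image[of "(i, p)"] by (simp del: mem_glue_points)
    then show "X \<in> surface (linear_image A S)"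
      unfolding ip(2) pt_linear_image[symmetric] by (rule pt_in_surface)
  qed
qed

lemma initial_velocity_linear_image:
  "initial_velocity (linear_image A S) (\<lambda>t. map_pts A ` \<gamma> t) (A *v v) \<longleftrightarrow> initial_velocity S \<gamma> v"
proof -
  have 1: "indices (linear_image A S) = indices S" by (simp add: linear_image_def)
  have 2: "A *v p + t *\<^sub>R (A *v v) = A *v (p + t *\<^sub>R v)" for p t
    by (simp add: matrix_vector_right_distrib matrix_vector_mult_scaleR)
  have 3: "A *v q \<in> piece (linear_image A S) i \<longleftrightarrow> q \<in> piece S i" for q i
    by (auto simp: linear_image_def inj_mul)
  have 4: "map_pts A ` X = pt (linear_image A S) i (A *v q) \<longleftrightarrow> X = pt S i q" for X i q
    by (simp add: pt_linear_image inj_image_eq_iff[OF inj_map_pts])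
  have 5: "(\<exists>p. Q p) \<longleftrightarrow> (\<exists>p. Q (A *v p))" for Q by (metis mul_inv)
  show ?thesis
    unfolding initial_velocity_def 1 by (subst 5) (simp only: 2 3 4)
qed

lemma same_surface_linear_image:
  "same_surface (linear_image A S) S \<longleftrightarrow> (\<exists>g. affine_automorphism S A g)"
proof
  have inj: "inj ((`) (map_pts A))" using inj_map_pts by (simp add: inj_def inj_image_eq_iff)
  have bijA: "bij_betw ((`) (map_pts A)) (surface S) (surface (linear_image A S))"
    using inj by (auto simp: bij_betw_def surface_linear_image intro: inj_on_subset)
  {
    assume "same_surface (linear_image A S) S"
    then obtain f where f: "bij_betw f (surface (linear_image A S)) (surface S)"
      "direction_preserving (linear_image A S) S f"
      by (auto simp: same_surface_def surface_isometry_def)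
    have "affine_automorphism S A (f \<circ> (`) (map_pts A))"
      unfolding affine_automorphism_def
    proof (intro conjI allI impI)
      show "bij_betw (f \<circ> (`) (map_pts A)) (surface S) (surface S)" using bijA f(1) by (rule bij_betw_trans)
      fix \<gamma> :: "real \<Rightarrow> _" and v assume \<gamma>: "range \<gamma> \<subseteq> surface S"
      then have "range (\<lambda>t. map_pts A ` \<gamma> t) \<subseteq> surface (linear_image A S)"
        by (auto simp: surface_linear_image)
      then show "initial_velocity S \<gamma> v \<longleftrightarrow> initial_velocity S (f \<circ> (`) (map_pts A) \<circ> \<gamma>) (A *v v)"
        using f(2)[unfolded direction_preserving_def, rule_format, of "\<lambda>t. map_pts A ` \<gamma> t" "A *v v"]
        by (simp only: initial_velocity_linear_image comp_def)
    qed
    then show "\<exists>g. affine_automorphism S A g" by blast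
  next
    assume "\<exists>g. affine_automorphism S A g"
    then obtain g where g: "affine_automorphism S A g" by blast
    define f where "f = g \<circ> the_inv_into (surface S) ((`) (map_pts A))"
    have bij: "bij_betw f (surface (linear_image A S)) (surface S)"
      unfolding f_def using g bij_betw_the_inv_into[OF bijA]
      by (auto simp: affine_automorphism_def intro: bij_betw_trans)
    have f: "f (map_pts A ` X) = g X" if "X \<in> surface S" for X
      using that bijA by (simp add: f_def the_inv_into_f_f bij_betw_def)
    have "direction_preserving (linear_image A S) S f"
      unfolding direction_preserving_def
    proof (intro allI impI)
      fix \<gamma> :: "real \<Rightarrow> _" and v assume \<gamma>: "range \<gamma> \<subseteq> surface (linear_image A S)"
      have "\<exists>X. X \<in> surface S \<and> \<gamma> t = map_pts A ` X" for t
      proof -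
        have "\<gamma> t \<in> (`) (map_pts A) ` surface S" using \<gamma> surface_linear_image by blast
        then show ?thesis by (rule imageE) blast
      qed
      then obtain \<beta> where \<beta>: "\<And>t. \<beta> t \<in> surface S" "\<And>t. \<gamma> t = map_pts A ` \<beta> t" by metis
      have "initial_velocity (linear_image A S) \<gamma> v \<longleftrightarrow> initial_velocity S \<beta> (B *v v)"
        using initial_velocity_linear_image[of S \<beta> "B *v v"] unfolding mul_inv \<beta>(2)[symmetric] .
      also have "\<dots> \<longleftrightarrow> initial_velocity S (g \<circ> \<beta>) (A *v (B *v v))"
      proof -
        have "range \<beta> \<subseteq> surface S" using \<beta>(1) by blast
        then show ?thesis using g unfolding affine_automorphism_def by blast
      qed
      also have "A *v (B *v v) = v" by (rule mul_inv)
      also have "g \<circ> \<beta> = f \<circ> \<gamma>" by (rule ext) (simp only: comp_def \<beta>(2) f[OF \<beta>(1)])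
      finally show "initial_velocity (linear_image A S) \<gamma> v \<longleftrightarrow> initial_velocity S (f \<circ> \<gamma>) v" .
    qed
    with bij show "same_surface (linear_image A S) S"
      unfolding same_surface_def using direction_preserving_imp_isometry by blast
  }
qed

end

lemma veech_group_iff:
  "D \<in> veech_group S \<longleftrightarrow> invertible D \<and> (\<exists>g. affine_automorphism S D g)"
  unfolding veech_group_def invertible_def using same_surface_linear_image by auto

section \<open>The infinite polygon\<close>

definition vec2 :: "real \<Rightarrow> real \<Rightarrow> real^2" where
  "vec2 a b = vector [a, b]"

lemma vec2_nth [simp]: "vec2 a b $ 1 = a" "vec2 a b $ 2 = b"
  by (simp_all add: vec2_def)

lemma vec2_eq_iff: "p = q \<longleftrightarrow> p $ 1 = q $ 1 \<and> p $ 2 = (q $ 2 :: real)" for p q :: "real^2"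
  by (simp add: vec_eq_iff forall_2)

locale polygon_param =
  fixes c :: real
  assumes c_ge_1: "1 \<le> c"
begin

fun X Y :: "nat \<Rightarrow> real" where
  "X 0 = 0"
| "X (Suc n) = c * X n + (c - 1) * Y n + 1"
| "Y 0 = 0"
| "Y (Suc n) = (c + 1) * X n + c * Y n + 1"

declare X.simps(2) [simp del] Y.simps(2) [simp del]

abbreviation P :: "int \<Rightarrow> real^2" where
  "P \<equiv> vertex c"

lemma P_step: "P (k + 1) $ 1 = c * P k $ 1 + (c - 1) * P k $ 2 + 1"
    "P (k + 1) $ 2 = (c + 1) * P k $ 1 + c * P k $ 2 + 1"
  by (simp_all add: vertex_step T_map_def)

lemma P_of_nat: "P (int n) = vec2 (X n) (Y n)"
proof (induction n)
  case (Suc n)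
  then show ?case
    using P_step[of "int n"] by (simp add: vec2_eq_iff X.simps Y.simps add.commute)
qed (simp add: vertex_0 vec2_eq_iff)

lemma P_minus_nat: "P (- int n) = vec2 (- X n) (Y n)"
proof (induction n)
  case (Suc n)
  have "T_map c (P (- int (Suc n))) = P (- int n)" using vertex_step[of c "- int (Suc n)"] by simp
  also have "\<dots> = T_map c (vec2 (- X (Suc n)) (Y (Suc n)))"
    unfolding Suc by (simp add: T_map_def vec2_eq_iff X.simps Y.simps algebra_simps)
  finally show ?case using bij_is_inj[OF bij_T_map] by (metis injD)
qed (simp add: vertex_0 vec2_eq_iff)

lemma XY_1 [simp]: "X 1 = 1" "Y 1 = 1" "X (Suc 0) = 1" "Y (Suc 0) = 1"
  by (simp_all add: X.simps Y.simps)

lemma XY_nonneg: "0 \<le> X n \<and> 0 \<le> Y n"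
  by (induction n) (use c_ge_1 in \<open>auto simp: X.simps Y.simps\<close>)

lemma X_nonneg [simp]: "0 \<le> X n" and Y_nonneg [simp]: "0 \<le> Y n"
  using XY_nonneg by auto

text \<open>The height of the strip between two consecutive horizontal chords is half the sum of the
  lengths of these chords. This makes all horizontal cylinders similar to each other.\<close>

lemma Y_diff: "Y (Suc n) - Y n = X n + X (Suc n)"
  by (simp add: X.simps Y.simps algebra_simps)

lemma X_step: "X n + 1 \<le> X (Suc n)"
proof -
  have "0 \<le> (c - 1) * X n" "0 \<le> (c - 1) * Y n" using c_ge_1 by simp_all
  then show ?thesis by (simp add: X.simps algebra_simps)
qed

lemma X_ge_nat: "real n \<le> X n"
proof (induction n)
  case (Suc n)
  then show ?case using X_step[of n] by simp
qed simp

definition ht :: "nat \<Rightarrow> real" where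
  "ht n = X n + X (Suc n)"

lemma Y_Suc: "Y (Suc n) = Y n + ht n"
  using Y_diff[of n] by (simp add: ht_def)

lemma ht_ge: "2 * real n + 1 \<le> ht n"
  using X_ge_nat[of n] X_step[of n] by (simp add: ht_def)

lemma ht_ge_1: "1 \<le> ht n" and ht_pos [simp]: "0 < ht n"
  using ht_ge[of n] by simp_all

lemma ht_nonneg [simp]: "0 \<le> ht n" and ht_neq_0 [simp]: "ht n \<noteq> 0"
  using ht_pos[of n] by linarith+

lemma ht_0 [simp]: "ht 0 = 1" by (simp add: ht_def)

lemma Y_strict_mono: "strict_mono Y"
  by (rule strict_mono_Suc_iff[THEN iffD2]) (simp add: Y_Suc)

lemma Y_less_iff [simp]: "Y m < Y n \<longleftrightarrow> m < n" and Y_le_iff [simp]: "Y m \<le> Y n \<longleftrightarrow> m \<le> n"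
  and Y_eq_iff [simp]: "Y m = Y n \<longleftrightarrow> m = n"
  using Y_strict_mono by (simp_all add: strict_mono_less strict_mono_less_eq strict_mono_eq)

lemma Y_ge_nat: "real n \<le> Y n"
proof (induction n)
  case (Suc n)
  then show ?case using ht_ge_1[of n] by (simp add: Y_Suc)
qed simp

lemma Y_interval:
  assumes "0 \<le> y"
  obtains n where "Y n \<le> y" "y < Y (Suc n)"
proof -
  obtain N where "y < real N" using reals_Archimedean2 by blast
  then have ex: "y < Y N" using Y_ge_nat[of N] by simp
  define m where "m = (LEAST m. y < Y m)"
  have m: "y < Y m" unfolding m_def using ex by (rule LeastI)
  then obtain n where n: "m = Suc n" using assms by (cases m) auto
  have "\<not> y < Y n" using not_less_Least[of n "\<lambda>m. y < Y m"] n unfolding m_def by simp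
  then show thesis using that[of n] m n by simp
qed

lemma Y_interval_unique:
  assumes "Y n \<le> y" "y \<le> Y (Suc n)" "Y m < y" "y < Y (Suc m)"
  shows "m = n"
proof -
  have "Y n < Y (Suc m)" "Y m < Y (Suc n)" using assms by linarith+
  then show ?thesis by simp
qed

lemma int_sign_cases:
  obtains n where "k = int n" | n where "k = - int (Suc n)"
  by (metis int_cases)

text \<open>Up to a positive factor, the signed distance of q from the line through the k-th edge. The map
  T moves edges to edges and has determinant one, so values at vertices depend on index
  differences only.\<close>

definition side :: "int \<Rightarrow> real^2 \<Rightarrow> real" where
  "side k q = (P (k + 1) $ 1 - P k $ 1) * (q $ 2 - P k $ 2) - (P (k + 1) $ 2 - P k $ 2) * (q $ 1 - P k $ 1)"

lemma side_T: "side (k + 1) (T_map c q) = side k q"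
  unfolding side_def P_step by (simp add: T_map_def power2_eq_square algebra_simps)

lemma side_shift: "side k (P (j + k)) = side 0 (P j)"
proof (induction k rule: int_induct[of _ 0])
  case (step1 i)
  then show ?case using side_T[of i "P (j + i)"] by (simp add: vertex_step[symmetric] algebra_simps)
next
  case (step2 i)
  then show ?case using side_T[of "i - 1" "P (j + (i - 1))"]
    by (simp add: vertex_step[symmetric] algebra_simps)
qed simp

lemma side_0: "side 0 q = q $ 2 - q $ 1"
  using P_of_nat[of 1] P_of_nat[of 0] by (simp add: side_def)

lemma side_0_P: "j = 0 \<or> j = 1 \<or> 0 < side 0 (P j)"
proof (cases j rule: int_sign_cases)
  case (1 n)
  show ?thesis
  proof (cases n)
    case (Suc m)
    show ?thesis
    proof (cases m)
      case 0
      then show ?thesis using 1 Suc by simp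
    next
      case (Suc l)
      have "0 < X m" using X_ge_nat[of m] Suc by simp
      moreover have "side 0 (P j) = Y n - X n" by (simp add: 1 P_of_nat side_0)
      moreover have "Y n - X n = X m + Y m" using \<open>n = Suc m\<close> by (simp add: X.simps Y.simps algebra_simps)
      ultimately show ?thesis using Y_nonneg[of m] by linarith
    qed
  qed (use 1 in simp)
next
  case (2 n)
  have "0 < X (Suc n)" using X_ge_nat[of "Suc n"] by simp
  then show ?thesis using 2 Y_nonneg[of "Suc n"] P_minus_nat[of "Suc n"]
    by (simp add: side_0 add_nonneg_pos del: Y_nonneg)
qed

lemma side_P: "j = k \<or> j = k + 1 \<or> 0 < side k (P j)"
  using side_0_P[of "j - k"] side_shift[of k "j - k"] by auto

lemma side_P_self [simp]: "side k (P k) = 0" "side k (P (k + 1)) = 0"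
  by (simp_all add: side_def)

lemma side_P_eq_0: "side k (P j) = 0 \<Longrightarrow> j = k \<or> j = k + 1"
  using side_P[of j k] by auto

lemma side_affine: "side k ((1 - t) *\<^sub>R p + t *\<^sub>R q) = (1 - t) * side k p + t * side k q"
  by (simp add: side_def algebra_simps)

lemma side_edge:
  assumes "q \<in> edge c k" shows "side k q = 0"
  using assms by (auto simp: edge_def closed_segment_def side_affine)

lemma P_inj: "P j = P k \<longleftrightarrow> j = k"
proof
  assume eq: "P j = P k"
  have "side k (P j) = 0" "side j (P k) = 0" using eq side_P_self by metis+
  then show "j = k" using side_P_eq_0[of k j] side_P_eq_0[of j k] by auto
qed simp

text \<open>The open half-plane of an edge together with the edge itself is convex and contains all
  vertices, so it contains the polygon: the polygon meets the line of an edge in that edge only.\<close>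

lemma Q_plus_side:
  assumes "q \<in> Q_plus c"
  shows "0 < side k q \<or> q \<in> edge c k"
proof -
  let ?C = "{q. 0 < side k q} \<union> edge c k"
  have "P j \<in> ?C" for j using side_P[of j k] by (auto simp: edge_def)
  moreover have "convex ?C"
    unfolding convex_alt
  proof (intro ballI allI impI)
    fix p q and t :: real assume pq: "p \<in> ?C" "q \<in> ?C" and t: "0 \<le> t \<and> t \<le> 1"
    have nn: "0 \<le> side k p" "0 \<le> side k q" using pq side_edge[of p k] side_edge[of q k] by auto
    show "(1 - t) *\<^sub>R p + t *\<^sub>R q \<in> ?C"
    proof (cases "(t < 1 \<and> 0 < side k p) \<or> (0 < t \<and> 0 < side k q)")
      case True
      then have "0 < (1 - t) * side k p + t * side k q"
        using t nn by (auto intro: add_pos_nonneg add_nonneg_pos)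
      then show ?thesis by (simp add: side_affine)
    next
      case False
      consider "t = 0" | "t = 1" | "0 < t" "t < 1" using t by linarith
      then show ?thesis
      proof cases
        case 3
        then have "p \<in> edge c k" "q \<in> edge c k" using False pq by auto
        moreover have "convex (edge c k)" by (simp add: edge_def)
        ultimately show ?thesis using t by (auto simp: convex_alt)
      qed (use pq in auto)
    qed
  qed
  ultimately have "Q_plus c \<subseteq> ?C" unfolding Q_plus_def by (intro hull_minimal) auto
  then show ?thesis using assms by auto
qed

lemma side_nonneg: "q \<in> Q_plus c \<Longrightarrow> 0 \<le> side k q"
  using Q_plus_side[of q k] side_edge[of q k] by fastforce

lemma edge_iff: "q \<in> edge c k \<longleftrightarrow> q \<in> Q_plus c \<and> side k q = 0"
proof
  assume q: "q \<in> edge c k"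
  have "edge c k \<subseteq> Q_plus c"
    unfolding edge_def Q_plus_def by (intro closed_segment_subset) (auto intro: hull_inc)
  then show "q \<in> Q_plus c \<and> side k q = 0" using q side_edge by auto
next
  show "q \<in> Q_plus c \<and> side k q = 0 \<Longrightarrow> q \<in> edge c k" using Q_plus_side[of q k] by auto
qed

lemma P_in_Q [simp]: "P k \<in> Q_plus c"
  unfolding Q_plus_def by (auto intro: hull_inc)

lemma convex_Q: "convex (Q_plus c)"
  by (simp add: Q_plus_def)

text \<open>Two different edges meet in vertices only: an interior point of an edge that lay on another edge
  would force both ends of its edge onto the line of the other one.\<close>

lemma edge_cases:
  assumes "q \<in> edge c k"
  obtains "q = P k" | "q = P (k + 1)" | "\<And>j. q \<in> edge c j \<Longrightarrow> j = k" "\<And>j. q \<noteq> P j"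
proof -
  obtain t where t: "0 \<le> t" "t \<le> 1" and q: "q = (1 - t) *\<^sub>R P k + t *\<^sub>R P (k + 1)"
    using assms by (auto simp: edge_def closed_segment_def)
  consider "t = 0" | "t = 1" | "0 < t" "t < 1" using t by linarith
  then show thesis
  proof cases
    case 3
    have uniq: "j = k" if "q \<in> edge c j" for j
    proof -
      have "side j q = 0" using that by (simp add: edge_iff)
      then have "(1 - t) * side j (P k) + t * side j (P (k + 1)) = 0" by (simp add: q side_affine)
      moreover have "0 \<le> (1 - t) * side j (P k)" "0 \<le> t * side j (P (k + 1))"
        using 3 side_nonneg[OF P_in_Q] by simp_all
      ultimately have "(1 - t) * side j (P k) = 0" "t * side j (P (k + 1)) = 0" by linarith+
      then have "side j (P k) = 0" "side j (P (k + 1)) = 0" using 3 by simp_all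
      then show ?thesis using side_P_eq_0[of j k] side_P_eq_0[of j "k + 1"] by auto
    qed
    have "q \<noteq> P j" for j
    proof
      assume "q = P j"
      then have "q \<in> edge c j" "q \<in> edge c (j - 1)" by (simp_all add: edge_def)
      then show False using uniq[of j] uniq[of "j - 1"] by simp
    qed
    with uniq show thesis by (rule that(3))
  qed (use q that(1,2) in auto)
qed

lemma P_in_edge_iff: "P j \<in> edge c k \<longleftrightarrow> j = k \<or> j = k + 1"
  using side_P_eq_0[of k j] by (auto simp: edge_iff)

subsection \<open>Horizontal chords\<close>

text \<open>The chord at height y of the n-th strip extends from - W n y to W n y.\<close>

definition W :: "nat \<Rightarrow> real \<Rightarrow> real" where
  "W n y = X n + (y - Y n) / ht n * (X (Suc n) - X n)"

lemma ht_W: "ht n * W n y = ht n * X n + (y - Y n) * (X (Suc n) - X n)"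
  by (simp add: W_def distrib_left)

lemma W_0 [simp]: "W 0 y = y"
  by (simp add: W_def)

lemma side_right: "side (int n) q = ht n * (W n (q $ 2) - q $ 1)"
proof -
  have "P (int n + 1) = vec2 (X (Suc n)) (Y (Suc n))" using P_of_nat[of "Suc n"] by (simp add: add.commute)
  then show ?thesis
    unfolding side_def P_of_nat right_diff_distrib ht_W by (simp add: Y_Suc algebra_simps)
qed

lemma side_left: "side (- int (Suc n)) q = ht n * (W n (q $ 2) + q $ 1)"
proof -
  have eq: "- int (Suc n) + 1 = - int n" by simp
  show ?thesis
    unfolding side_def eq P_minus_nat distrib_left ht_W by (simp add: Y_Suc algebra_simps)
qed

lemma W_Y: "W n (Y n) = X n" "W n (Y (Suc n)) = X (Suc n)"
  by (simp_all add: W_def Y_Suc)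

lemma W_bounds:
  assumes "Y n \<le> y" "y \<le> Y (Suc n)"
  shows "X n \<le> W n y" "W n y \<le> X (Suc n)"
proof -
  define s where "s = (y - Y n) / ht n"
  have s: "0 \<le> s" "s \<le> 1" using assms ht_pos[of n] by (auto simp: s_def Y_Suc divide_simps)
  have d: "0 \<le> X (Suc n) - X n" using X_step[of n] by simp
  have "W n y = X n + s * (X (Suc n) - X n)" by (simp add: W_def s_def)
  then show "X n \<le> W n y" "W n y \<le> X (Suc n)"
    using mult_nonneg_nonneg[OF s(1) d] mult_right_mono[OF s(2) d] by simp_all
qed

lemma chord_end_in_Q:
  assumes "Y n \<le> y" "y \<le> Y (Suc n)"
  shows "vec2 (W n y) y \<in> edge c (int n)" "vec2 (- W n y) y \<in> edge c (- int (Suc n))"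
proof -
  define s where "s = (y - Y n) / ht n"
  have s: "0 \<le> s" "s \<le> 1" using assms ht_pos[of n] by (auto simp: s_def Y_Suc divide_simps)
  have "y = Y n + s * ht n" by (simp add: s_def)
  then have y: "y = (1 - s) * Y n + s * Y (Suc n)" by (simp add: Y_Suc algebra_simps)
  have "W n y = X n + s * (X (Suc n) - X n)" by (simp add: W_def s_def)
  then have W: "W n y = (1 - s) * X n + s * X (Suc n)" by (simp add: algebra_simps)
  have eq: "vec2 (W n y) y = vec2 ((1 - s) * X n + s * X (Suc n)) ((1 - s) * Y n + s * Y (Suc n))"
    "vec2 (- W n y) y = vec2 (- ((1 - s) * X n + s * X (Suc n))) ((1 - s) * Y n + s * Y (Suc n))"
    using W y by metis+
  have "P (int n + 1) = vec2 (X (Suc n)) (Y (Suc n))" using P_of_nat[of "Suc n"] by (simp add: add.commute)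
  then have "vec2 (W n y) y = (1 - s) *\<^sub>R P (int n) + s *\<^sub>R P (int n + 1)"
    unfolding eq by (simp add: P_of_nat vec2_eq_iff)
  then show "vec2 (W n y) y \<in> edge c (int n)"
    unfolding edge_def closed_segment_def using s by blast
  have eq': "- int (Suc n) + 1 = - int n" by simp
  have "vec2 (- W n y) y = (1 - (1 - s)) *\<^sub>R P (- int (Suc n)) + (1 - s) *\<^sub>R P (- int (Suc n) + 1)"
    unfolding eq eq' P_minus_nat by (simp add: vec2_eq_iff algebra_simps)
  then show "vec2 (- W n y) y \<in> edge c (- int (Suc n))"
    unfolding edge_def closed_segment_def using s by (auto intro!: exI[of _ "1 - s"])
qed

lemma Q_plus_height: "q \<in> Q_plus c \<Longrightarrow> 0 \<le> q $ 2"
proof -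
  assume "q \<in> Q_plus c"
  then have "0 \<le> side 0 q" "0 \<le> side (- 1) q" using side_nonneg by blast+
  then show ?thesis using side_right[of 0 q] side_left[of 0 q] by simp
qed

text \<open>Between two consecutive horizontal chords the polygon is a trapezoid.\<close>

lemma Q_plus_strip:
  assumes "Y n \<le> q $ 2" "q $ 2 \<le> Y (Suc n)"
  shows "q \<in> Q_plus c \<longleftrightarrow> \<bar>q $ 1\<bar> \<le> W n (q $ 2)"
proof
  assume "q \<in> Q_plus c"
  then have "0 \<le> side (int n) q" "0 \<le> side (- int (Suc n)) q" using side_nonneg by blast+
  then show "\<bar>q $ 1\<bar> \<le> W n (q $ 2)"
    unfolding side_right side_left using ht_pos[of n] by (simp add: zero_le_mult_iff)
next
  assume q: "\<bar>q $ 1\<bar> \<le> W n (q $ 2)"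
  let ?w = "W n (q $ 2)"
  have ends: "vec2 ?w (q $ 2) \<in> Q_plus c" "vec2 (- ?w) (q $ 2) \<in> Q_plus c"
    using chord_end_in_Q[OF assms] by (simp_all add: edge_iff)
  show "q \<in> Q_plus c"
  proof (cases "?w = 0")
    case True
    then have "q = vec2 ?w (q $ 2)" using q by (simp add: vec2_eq_iff)
    then show ?thesis using ends by metis
  next
    case False
    then have w: "0 < ?w" using q by linarith
    define s where "s = (q $ 1 + ?w) / (2 * ?w)"
    have s: "0 \<le> s" "s \<le> 1" using q w by (auto simp: s_def divide_simps)
    have "q = (1 - s) *\<^sub>R vec2 (- ?w) (q $ 2) + s *\<^sub>R vec2 ?w (q $ 2)"
    proof -
      have "2 * (s * ?w) = q $ 1 + ?w" using w by (simp add: s_def)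
      then show ?thesis by (simp add: vec2_eq_iff algebra_simps)
    qed
    then show ?thesis using convex_Q[unfolded convex_alt] ends s by metis
  qed
qed

text \<open>In each strip two of the half-planes already cut out the trapezoid.\<close>

lemma Q_plus_iff_sides: "q \<in> Q_plus c \<longleftrightarrow> (\<forall>k. 0 \<le> side k q)"
proof
  assume *: "\<forall>k. 0 \<le> side k q"
  then have "0 \<le> side 0 q" "0 \<le> side (- 1) q" by blast+
  then have "0 \<le> q $ 2" using side_right[of 0 q] side_left[of 0 q] by simp
  then obtain n where n: "Y n \<le> q $ 2" "q $ 2 < Y (Suc n)" by (rule Y_interval)
  have "0 \<le> side (int n) q" "0 \<le> side (- int (Suc n)) q" using * by blast+
  then have "\<bar>q $ 1\<bar> \<le> W n (q $ 2)"
    unfolding side_right side_left using ht_pos[of n] by (simp add: zero_le_mult_iff)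
  then show "q \<in> Q_plus c" using Q_plus_strip n by simp
qed (use side_nonneg in blast)

lemma edge_height:
  assumes "q \<in> edge c (int n) \<or> q \<in> edge c (- int (Suc n))"
  shows "Y n \<le> q $ 2" "q $ 2 \<le> Y (Suc n)"
proof -
  have seg: "u \<in> closed_segment a b \<Longrightarrow> a $ 2 = Y n \<and> b $ 2 = Y (Suc n) \<or> a $ 2 = Y (Suc n) \<and> b $ 2 = Y n
      \<Longrightarrow> Y n \<le> u $ 2 \<and> u $ 2 \<le> Y (Suc n)" for u a b :: "real^2"
  proof -
    assume "u \<in> closed_segment a b" and *: "a $ 2 = Y n \<and> b $ 2 = Y (Suc n) \<or> a $ 2 = Y (Suc n) \<and> b $ 2 = Y n"
    then obtain t where "u = (1 - t) *\<^sub>R a + t *\<^sub>R b" "0 \<le> t" "t \<le> 1" by (auto simp: closed_segment_def)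
    then have u: "u $ 2 = a $ 2 + t * (b $ 2 - a $ 2)" "0 \<le> t" "t \<le> 1"
      by (simp_all add: left_diff_distrib right_diff_distrib)
    have "0 \<le> t * ht n" "t * ht n \<le> ht n"
      using u(2,3) ht_nonneg[of n] by (simp_all add: mult_left_le_one_le)
    then show ?thesis using * u by (auto simp: Y_Suc)
  qed
  have 1: "P (int n + 1) = vec2 (X (Suc n)) (Y (Suc n))" using P_of_nat[of "Suc n"] by (simp add: add.commute)
  have 2: "- int (Suc n) + 1 = - int n" by simp
  from assms have "Y n \<le> q $ 2 \<and> q $ 2 \<le> Y (Suc n)"
  proof
    assume "q \<in> edge c (int n)"
    then show ?thesis unfolding edge_def 1 P_of_nat by (rule seg) simp
  next
    assume "q \<in> edge c (- int (Suc n))"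
    then show ?thesis unfolding edge_def 2 P_minus_nat by (rule seg) simp
  qed
  then show "Y n \<le> q $ 2" "q $ 2 \<le> Y (Suc n)" by auto
qed

end

section \<open>Points of the surface\<close>

context polygon_param
begin

abbreviation S :: "bool gluing" where
  "S \<equiv> S_surf c"

lemma S_indices [simp]: "indices S = UNIV"
  by (simp add: S_surf_def)

lemma S_piece: "p \<in> piece S i \<longleftrightarrow> (if i then p else - p) \<in> Q_plus c"
proof -
  have "p \<in> uminus ` Q_plus c \<longleftrightarrow> - p \<in> Q_plus c" by (metis (no_types) image_iff minus_minus)
  then show ?thesis by (simp add: S_surf_def Q_minus_def)
qed

lemma S_piece_simps [simp]:
  "p \<in> piece S True \<longleftrightarrow> p \<in> Q_plus c" "p \<in> piece S False \<longleftrightarrow> - p \<in> Q_plus c"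
  by (simp_all add: S_piece)

text \<open>Twice the midpoint of an edge. The gluing of the k-th edge is the translation by - E k.\<close>

abbreviation E :: "int \<Rightarrow> real^2" where
  "E k \<equiv> P k + P (k + 1)"

lemma glued_S: "glued S x y \<longleftrightarrow> (\<exists>k. \<exists>p\<in>edge c k. x = (True, p) \<and> y = (False, p - E k))"
  (is "_ \<longleftrightarrow> ?R")
proof
  have gl: "gluings S = range (\<lambda>k. (True, edge c k, False, - E k))"
    by (simp add: S_surf_def full_SetCompr_eq)
  {
    assume "glued S x y"
    then obtain i F j w p where *: "(i, F, j, w) \<in> gluings S" "p \<in> F" "x = (i, p)" "y = (j, p + w)"
      unfolding glued_def by blast
    then obtain k where "i = True" "F = edge c k" "j = False" "w = - E k" unfolding gl by blast
    with * show ?R by (intro exI[of _ k] bexI[of _ p]) simp_all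
  next
    assume ?R
    then obtain k p where *: "p \<in> edge c k" "x = (True, p)" "y = (False, p - E k)" by blast
    have "(True, edge c k, False, - E k) \<in> gluings S" unfolding gl by (rule rangeI)
    moreover have "y = (False, p + - E k)" using * by simp
    ultimately show "glued S x y" unfolding glued_def using * by blast
  }
qed

text \<open>The gluing along an edge is the point reflection in its midpoint, followed by the rotation
  that exchanges the two polygons.\<close>

lemma side_reflect: "side k (E k - q) = - side k q"
  by (simp add: side_def algebra_simps)

lemma edge_reflect: "p \<in> edge c k \<Longrightarrow> E k - p \<in> edge c k"
proof -
  assume "p \<in> edge c k"
  then obtain t where "p = (1 - t) *\<^sub>R P k + t *\<^sub>R P (k + 1)" "0 \<le> t" "t \<le> 1"
    by (auto simp: edge_def closed_segment_def)
  then have "E k - p = (1 - (1 - t)) *\<^sub>R P k + (1 - t) *\<^sub>R P (k + 1)" "0 \<le> 1 - t" "1 - t \<le> 1"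
    by (simp_all add: algebra_simps)
  then show ?thesis unfolding edge_def closed_segment_def by blast
qed

lemma edge_in_Q: "p \<in> edge c k \<Longrightarrow> p \<in> Q_plus c"
  by (simp add: edge_iff)

lemma pt_edge:
  assumes "p \<in> edge c k"
  shows "pt S True p = pt S False (p - E k)"
proof (rule pt_eqI_glued)
  show "glued S (True, p) (False, p - E k)" unfolding glued_S using assms by blast
  show "(True, p) \<in> glue_points S" using edge_in_Q[OF assms] by simp
  show "(False, p - E k) \<in> glue_points S" using edge_in_Q[OF edge_reflect[OF assms]] by simp
qed

text \<open>A function on pairs that agrees on glued pairs descends to the surface. The
  identifications of points of the surface are all derived from suitable predicates of this kind.\<close>

lemma pt_invariant:
  assumes "\<And>k p. p \<in> edge c k \<Longrightarrow> F (True, p) = F (False, p - E k)"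
    and "pt S i p = pt S j q" "p \<in> piece S i"
  shows "F (i, p) = F (j, q)"
proof -
  have "equivclp (glued S) (i, p) (j, q)"
    using assms(2,3) by (simp add: pt_eq_iff)
  then show ?thesis
  proof (induction rule: equivclp_induct)
    case (step y z)
    then have "F y = F z" unfolding glued_S using assms(1) by auto
    then show ?case using step.IH by simp
  qed simp
qed

text \<open>A point off the edges is not identified with any other point.\<close>

lemma pt_inner_eq:
  assumes "pt S i p = pt S j q" "p \<in> piece S i" "\<And>k. (if i then p else - p) \<notin> edge c k"
  shows "j = i" "q = p"
proof -
  have "((i, p) = (i, p)) = ((j, q) = (i, p))"
  proof (rule pt_invariant[OF _ assms(1,2), of "\<lambda>x. x = (i, p)"])
    fix k r assume r: "r \<in> edge c k"
    have "(True, r) \<noteq> (i, p)" using r assms(3)[of k] by auto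
    moreover have "(False, r - E k) \<noteq> (i, p)" using edge_reflect[OF r] assms(3)[of k] by auto
    ultimately show "((True, r) = (i, p)) = ((False, r - E k) = (i, p))" by blast
  qed
  then show "j = i" "q = p" by auto
qed

text \<open>A point on a single edge has exactly two representatives. The hypothesis excludes vertices, which
  lie on two edges.\<close>

lemma pt_edge_eq:
  assumes "pt S True p = pt S j q" "p \<in> edge c k" "\<And>m. p \<in> edge c m \<Longrightarrow> m = k" 
  shows "(j, q) = (True, p) \<or> (j, q) = (False, p - E k)"
proof -
  let ?F = "\<lambda>x. x = (True, p) \<or> x = (False, p - E k)"
  have "?F (True, p) = ?F (j, q)"
  proof (rule pt_invariant[OF _ assms(1)])
    fix m r assume r: "r \<in> edge c m"
    show "?F (True, r) = ?F (False, r - E m)"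
    proof
      assume "?F (True, r)"
      then show "?F (False, r - E m)" using assms(3) r by auto
    next
      assume "?F (False, r - E m)"
      then have eq: "E m - r = E k - p" by (simp add: algebra_simps)
      have "side m p = 0"
      proof -
        have p: "p = E k - (E m - r)" using eq by simp
        have em: "E m - r \<in> edge c m" "E k - p \<in> edge c k" using r assms(2) edge_reflect by blast+
        from em(2) show ?thesis
        proof (cases rule: edge_cases)
          case 1
          then have "p = P (k + 1)" by (simp add: algebra_simps)
          then have "p \<in> edge c (k + 1)" by (simp add: edge_def)
          then show ?thesis using assms(3) by force
        next
          case 2
          then have "p = P k" by (simp add: algebra_simps)
          then have "p \<in> edge c (k - 1)" by (simp add: edge_def)
          then show ?thesis using assms(3) by force
        next
          case 3
          then have "m = k" using em(1) eq by simp
          then show ?thesis using eq em(2) r edge_iff by simp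
        qed
      qed
      then have "m = k" using assms(2,3) by (simp add: edge_iff)
      then show "?F (True, r)" using eq by simp
    qed
  qed (use edge_in_Q[OF assms(2)] in simp)
  then show ?thesis by simp
qed

subsection \<open>The two singular points\<close>

definition sing :: "bool \<Rightarrow> (bool \<times> (real^2)) set" where
  "sing b = pt S True (P (if b then 0 else 1))"

text \<open>The gluing of the k-th edge exchanges its ends, up to the rotation: the vertices k and k + 1 of
  the upper polygon meet the vertices - P (k + 1) and - P k of the lower one. So the parity of the index, read with
  opposite conventions in the two polygons, is what the gluings preserve.\<close>

definition vertex_class :: "bool \<Rightarrow> bool \<times> (real^2) \<Rightarrow> bool" where
  "vertex_class b x \<longleftrightarrow> (\<exists>k. x = (True, P k) \<and> even k = b \<or> x = (False, - P k) \<and> odd k = b)"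

lemma pt_vertex_step: "pt S True (P k) = pt S False (- P (k + 1))" "pt S True (P (k + 1)) = pt S False (- P k)"
  using pt_edge[of "P k" k] pt_edge[of "P (k + 1)" k] by (simp_all add: edge_def)

lemma pt_vertex: "pt S True (P k) = sing (even k)"
proof -
  have step: "pt S True (P (k + 1 + 1)) = pt S True (P k)" for k
    using pt_vertex_step(2)[of "k + 1"] pt_vertex_step(1)[of k] by simp
  have "pt S True (P k) = sing (even k) \<and> pt S True (P (k + 1)) = sing (odd k)"
  proof (induction k rule: int_induct[of _ 0])
    case (step1 i)
    then show ?case using step[of i] by auto
  next
    case (step2 i)
    then show ?case using step[of "i - 1"] by auto
  qed (simp add: sing_def)
  then show ?thesis by simp
qed

lemma pt_vertex_minus: "pt S False (- P k) = sing (odd k)"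
  using pt_vertex_step(2)[of k] pt_vertex[of "k + 1"] by simp

lemma vertex_class_pt:
  assumes "vertex_class b (i, p)" shows "pt S i p = sing b"
  using assms pt_vertex pt_vertex_minus by (auto simp: vertex_class_def)

lemma sing_in_surface: "sing b \<in> surface S"
  unfolding sing_def by (rule pt_in_surface) simp

lemma vertex_class_edge:
  assumes "p \<in> edge c k"
  shows "vertex_class b (True, p) = vertex_class b (False, p - E k)"
proof
  assume "vertex_class b (True, p)"
  then obtain j where j: "p = P j" "even j = b" by (auto simp: vertex_class_def)
  then have "j = k \<or> j = k + 1" using assms P_in_edge_iff by simp
  then show "vertex_class b (False, p - E k)"
    unfolding vertex_class_def using j by (auto intro: exI[of _ "k + 1"] exI[of _ k])
next
  assume "vertex_class b (False, p - E k)"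
  then obtain j where "p - E k = - P j" and j: "odd j = b"
    by (auto simp: vertex_class_def)
  then have "- (p - E k) = P j" by simp
  with j have j: "E k - p = P j" "odd j = b" by simp_all
  then have "j = k \<or> j = k + 1" using edge_reflect[OF assms] P_in_edge_iff by simp
  then show "vertex_class b (True, p)"
  proof
    assume "j = k"
    then have "p = P (k + 1)" using j by (simp add: algebra_simps)
    then show ?thesis unfolding vertex_class_def using j \<open>j = k\<close> by (auto intro: exI[of _ "k + 1"])
  next
    assume "j = k + 1"
    then have "p = P k" using j by (simp add: algebra_simps)
    then show ?thesis unfolding vertex_class_def using j \<open>j = k + 1\<close> by (auto intro: exI[of _ k])
  qed
qed

lemma pt_eq_sing:
  assumes "pt S i p = sing b"
  shows "vertex_class b (i, p)"
proof -
  let ?k = "if b then 0 else 1 :: int"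
  have "vertex_class b (True, P ?k) = vertex_class b (i, p)"
    by (rule pt_invariant[OF vertex_class_edge]) (use assms in \<open>auto simp: sing_def\<close>)
  moreover have "vertex_class b (True, P ?k)" unfolding vertex_class_def by (intro exI[of _ ?k]) simp
  ultimately show ?thesis by simp
qed

lemma sing_eq_iff [simp]: "sing a = sing b \<longleftrightarrow> a = b"
proof
  assume eq: "sing a = sing b"
  have "vertex_class b (True, P (if a then 0 else 1))" by (rule pt_eq_sing) (use eq in \<open>simp add: sing_def\<close>)
  then show "a = b" by (auto simp: vertex_class_def P_inj split: if_splits)
qed simp

subsection \<open>Directions that lead to infinity inside a polygon\<close>

text \<open>The rate of change of the signed distance from the line of an edge, in direction v.\<close>

definition slope :: "int \<Rightarrow> real^2 \<Rightarrow> real" where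
  "slope k v = (P (k + 1) $ 1 - P k $ 1) * v $ 2 - (P (k + 1) $ 2 - P k $ 2) * v $ 1"

lemma side_add: "side k (q + t *\<^sub>R v) = side k q + t * slope k v"
  by (simp add: side_def slope_def algebra_simps)

text \<open>The edge vectors form an orbit of a linear map that preserves the quadratic form below;
  so they are less steep than the asymptotes of its level sets.\<close>

lemma edge_vector_form: "(c + 1) * (X (Suc n) - X n)\<^sup>2 - (c - 1) * (ht n)\<^sup>2 = 2"
proof (induction n)
  case (Suc n)
  define d e where "d = X (Suc n) - X n" and "e = ht n"
  have "X (Suc (Suc n)) - X (Suc n) = c * d + (c - 1) * e"
    unfolding d_def e_def Y_diff[folded ht_def, symmetric]
    by (simp add: X.simps(2)[of "Suc n"] X.simps(2)[of n] algebra_simps)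
  moreover have "ht (Suc n) = (c + 1) * d + c * e"
    unfolding d_def e_def Y_diff[folded ht_def, symmetric]
    by (simp add: Y.simps(2)[of "Suc n"] Y.simps(2)[of n] algebra_simps)
  moreover have "(c + 1) * (c * d + (c - 1) * e)\<^sup>2 - (c - 1) * ((c + 1) * d + c * e)\<^sup>2
      = (c + 1) * d\<^sup>2 - (c - 1) * e\<^sup>2"
    by (simp add: power2_eq_square algebra_simps)
  ultimately show ?case using Suc unfolding d_def e_def by metis
qed (simp add: algebra_simps)

text \<open>The hypotheses describe a part of the recession cone, for c = 1 just the vertical ray, that is
  convenient for the matrix C: they say that v lies between the vertical line and the line fixed by C.\<close>

lemma slope_pos:
  assumes v: "0 < v $ 2" "0 \<le> v $ 1" "(c + 1) * v $ 1 \<le> (c - 1) * v $ 2"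
  shows "0 < slope k v"
proof -
  have main: "ht n * v $ 1 < (X (Suc n) - X n) * v $ 2" for n
  proof -
    define d where "d = X (Suc n) - X n"
    have d: "1 \<le> d" using X_step[of n] by (simp add: d_def)
    have form: "(c - 1) * (ht n)\<^sup>2 < (c + 1) * d\<^sup>2" using edge_vector_form[of n] by (simp add: d_def)
    have le: "(c + 1) * (v $ 1)\<^sup>2 \<le> (c - 1) * (v $ 2)\<^sup>2"
    proof -
      have "(c - 1) * v $ 2 \<le> (c + 1) * v $ 2" using v by simp
      then have "(c + 1) * v $ 1 \<le> (c + 1) * v $ 2" using v(3) by linarith
      then have le: "v $ 1 \<le> v $ 2" using c_ge_1 by simp
      have "0 \<le> (c - 1) * v $ 2" using v c_ge_1 by (intro mult_nonneg_nonneg) auto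
      from mult_mono[OF v(3) le this v(2)]
      have "(c + 1) * v $ 1 * v $ 1 \<le> (c - 1) * v $ 2 * v $ 2" .
      then show ?thesis by (simp add: power2_eq_square)
    qed
    have "(c + 1) * (ht n * v $ 1)\<^sup>2 = (ht n)\<^sup>2 * ((c + 1) * (v $ 1)\<^sup>2)" by (simp add: power_mult_distrib)
    also have "\<dots> \<le> (ht n)\<^sup>2 * ((c - 1) * (v $ 2)\<^sup>2)" using le by (intro mult_left_mono) auto
    also have "\<dots> = ((c - 1) * (ht n)\<^sup>2) * (v $ 2)\<^sup>2" by simp
    also have "\<dots> < ((c + 1) * d\<^sup>2) * (v $ 2)\<^sup>2" using form v(1) by (intro mult_strict_right_mono) auto
    also have "\<dots> = (c + 1) * (d * v $ 2)\<^sup>2" by (simp add: power_mult_distrib)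
    finally have "(ht n * v $ 1)\<^sup>2 < (d * v $ 2)\<^sup>2" using c_ge_1 by simp
    then show ?thesis unfolding d_def by (rule power2_less_imp_less) (use d v in \<open>simp add: d_def\<close>)
  qed
  show ?thesis
  proof (cases k rule: int_sign_cases)
    case (1 n)
    have "P (int n + 1) = vec2 (X (Suc n)) (Y (Suc n))" using P_of_nat[of "Suc n"] by (simp add: add.commute)
    then show ?thesis unfolding slope_def 1 P_of_nat using main[of n] by (simp add: Y_Suc)
  next
    case (2 n)
    have eq: "- int (Suc n) + 1 = - int n" by simp
    have "0 \<le> ht n * v $ 1" using v by simp
    moreover have "0 < (X (Suc n) - X n) * v $ 2" using X_step[of n] v by simp
    ultimately show ?thesis unfolding slope_def 2 eq P_minus_nat by (simp add: Y_Suc algebra_simps)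
  qed
qed

text \<open>A ray on which no signed distance from an edge decreases stays in the polygon; if all of them
  increase, it leaves the boundary at once.\<close>

lemma ray_inside:
  assumes "\<And>k. 0 < slope k v" "q \<in> Q_plus c" "0 < t"
  shows "q + t *\<^sub>R v \<in> Q_plus c" "q + t *\<^sub>R v \<notin> edge c j"
proof -
  have pos: "0 < side k (q + t *\<^sub>R v)" for k
    using assms(1)[of k] side_nonneg[OF assms(2), of k] assms(3) by (simp add: side_add add_nonneg_pos)
  then show "q + t *\<^sub>R v \<in> Q_plus c" unfolding Q_plus_iff_sides by (simp add: less_imp_le)
  show "q + t *\<^sub>R v \<notin> edge c j" using pos[of j] by (simp add: edge_iff)
qed

subsection \<open>Singular points are the points at which straight germs branch\<close>

text \<open>This notion only refers to germs of straight segments, so affine automorphisms preserve it.\<close>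

definition branching :: "(bool \<times> (real^2)) set \<Rightarrow> bool" where
  "branching x \<longleftrightarrow> (\<exists>\<gamma> \<beta> v. range \<gamma> \<subseteq> surface S \<and> range \<beta> \<subseteq> surface S \<and>
     initial_velocity S \<gamma> v \<and> initial_velocity S \<beta> v \<and> \<gamma> 0 = x \<and> \<beta> 0 = x \<and>
     (\<forall>e>0. \<exists>t\<in>{0..e}. \<gamma> t \<noteq> \<beta> t))"

text \<open>The vertical rays from two vertices with indices k and k + 2 start at the same point of the
  surface, with the same velocity, and run through different interior points.\<close>

lemma branching_sing: "branching (sing b)"
proof -
  define v where "v = vec2 0 1"
  have slope: "0 < slope k v" for k by (rule slope_pos) (use c_ge_1 in \<open>simp_all add: v_def\<close>)
  define \<gamma> where "\<gamma> k = clamp_line S True (P k) v 1" for k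
  have inQ: "P k + t *\<^sub>R v \<in> Q_plus c" if "0 \<le> t" for k t
    using ray_inside(1)[OF slope P_in_Q, of t] that by (cases "t = 0") auto
  have surf: "range (\<gamma> k) \<subseteq> surface S" for k
    using inQ by (auto simp: \<gamma>_def intro!: clamp_line_in_surface)
  have iv: "initial_velocity S (\<gamma> k) v" for k
    by (rule initial_velocity_line[of True S 1 "P k"]) (auto simp: \<gamma>_def clamp_line_eq inQ)
  define k where "k = (if b then 0 else 1 :: int)"
  have start: "\<gamma> k 0 = sing b" "\<gamma> (k + 2) 0 = sing b"
    by (simp_all add: \<gamma>_def clamp_line_def pt_vertex k_def)
  have differ: "\<gamma> k t \<noteq> \<gamma> (k + 2) t" if t: "0 < t" "t \<le> 1" for t
  proof
    assume "\<gamma> k t = \<gamma> (k + 2) t"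
    then have eq: "pt S True (P k + t *\<^sub>R v) = pt S True (P (k + 2) + t *\<^sub>R v)"
      using t by (simp add: \<gamma>_def clamp_line_eq)
    have "P (k + 2) + t *\<^sub>R v = P k + t *\<^sub>R v"
      by (rule pt_inner_eq(2)[OF eq]) (use t inQ ray_inside(2)[OF slope P_in_Q] in auto)
    then show False by (simp add: P_inj)
  qed
  have "\<exists>t\<in>{0..e}. \<gamma> k t \<noteq> \<gamma> (k + 2) t" if "0 < e" for e :: real
    using differ[of "min e 1"] that by (intro bexI[of _ "min e 1"]) auto
  with surf iv start show ?thesis unfolding branching_def by blast
qed

text \<open>If a ray from a point of an edge continues in the upper polygon, and the corresponding ray
  continues in the lower one, then it runs along the edge, since the two polygons lie on
  opposite sides of the edge. In that case the gluing identifies both rays.\<close>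

lemma edge_ray_unique:
  assumes q: "q \<in> edge c k" and ray: "\<And>t. 0 \<le> t \<Longrightarrow> t \<le> e \<Longrightarrow> q + t *\<^sub>R v \<in> Q_plus c"
    and ray': "\<And>t. 0 \<le> t \<Longrightarrow> t \<le> e \<Longrightarrow> - (q - E k + t *\<^sub>R v) \<in> Q_plus c"
    and t: "0 \<le> t" "t \<le> e"
  shows "pt S True (q + t *\<^sub>R v) = pt S False (q - E k + t *\<^sub>R v)"
proof -
  have "0 \<le> side k (q + t *\<^sub>R v)" using ray t side_nonneg by blast
  moreover have "0 \<le> side k (E k - (q + t *\<^sub>R v))"
    using side_nonneg[OF ray'[OF t], of k] by (simp add: algebra_simps)
  ultimately have "side k (q + t *\<^sub>R v) = 0" unfolding side_reflect by linarith
  then have "q + t *\<^sub>R v \<in> edge c k" using ray t by (simp add: edge_iff)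
  from pt_edge[OF this] show ?thesis by (simp add: algebra_simps)
qed

lemma branching_imp_sing:
  assumes "branching x" shows "\<exists>b. x = sing b"
proof (rule ccontr)
  assume nsing: "\<nexists>b. x = sing b"
  obtain \<gamma> \<beta> v where \<gamma>: "initial_velocity S \<gamma> v" "initial_velocity S \<beta> v" "\<gamma> 0 = x" "\<beta> 0 = x"
    and differ: "\<And>e. 0 < e \<Longrightarrow> \<exists>t\<in>{0..e}. \<gamma> t \<noteq> \<beta> t"
    using assms unfolding branching_def by blast
  obtain i p d where i: "0 < d" "\<And>t. 0 \<le> t \<Longrightarrow> t \<le> d \<Longrightarrow> p + t *\<^sub>R v \<in> piece S i"
    "\<And>t. 0 \<le> t \<Longrightarrow> t \<le> d \<Longrightarrow> \<gamma> t = pt S i (p + t *\<^sub>R v)"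
    using initial_velocityD[OF \<gamma>(1)] by blast
  obtain j q e where j: "0 < e" "\<And>t. 0 \<le> t \<Longrightarrow> t \<le> e \<Longrightarrow> q + t *\<^sub>R v \<in> piece S j"
    "\<And>t. 0 \<le> t \<Longrightarrow> t \<le> e \<Longrightarrow> \<beta> t = pt S j (q + t *\<^sub>R v)"
    using initial_velocityD[OF \<gamma>(2)] by blast
  have p: "p \<in> piece S i" "x = pt S i p" and q: "q \<in> piece S j" "x = pt S j q"
    using i(2,3)[of 0] j(2,3)[of 0] i(1) j(1) \<gamma>(3,4) by auto
  have novertex: False if "vertex_class b (i', p')" "x = pt S i' p'" for b i' p'
    using vertex_class_pt[OF that(1)] that(2) nsing by blast
  have at_edge: "(j', q') = (True, p') \<or> (j', q') = (False, p' - E k)"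
    if k: "p' \<in> edge c k" and x: "x = pt S True p'" "x = pt S j' q'" for p' k j' q'
  proof -
    have "m = k" if m: "p' \<in> edge c m" for m
      using k
    proof (cases rule: edge_cases)
      case 1
      then have "vertex_class (even k) (True, p')" unfolding vertex_class_def by blast
      then show ?thesis using novertex x(1) by blast
    next
      case 2
      then have "vertex_class (even (k + 1)) (True, p')" unfolding vertex_class_def by blast
      then show ?thesis using novertex x(1) by blast
    next
      case 3
      from 3(1)[OF m] show ?thesis .
    qed
    moreover have "pt S True p' = pt S j' q'" using x by simp
    ultimately show ?thesis using pt_edge_eq k by blast
  qed
  have inner: "(j', q') = (i', p')"
    if "\<And>k. (if i' then p' else - p') \<notin> edge c k" "p' \<in> piece S i'" "x = pt S i' p'" "x = pt S j' q'"
    for i' p' j' q'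
  proof -
    have "pt S i' p' = pt S j' q'" using that by simp
    from pt_inner_eq[OF this that(2,1)] show ?thesis by simp
  qed
  have unique: "pt S i (p + t *\<^sub>R v) = pt S j (q + t *\<^sub>R v)" if t: "0 \<le> t" "t \<le> min d e" for t
  proof -
    have cross: "pt S True (p' + t *\<^sub>R v) = pt S False (q' + t *\<^sub>R v)"
      if p': "\<And>t. 0 \<le> t \<Longrightarrow> t \<le> min d e \<Longrightarrow> p' + t *\<^sub>R v \<in> Q_plus c"
        and q': "\<And>t. 0 \<le> t \<Longrightarrow> t \<le> min d e \<Longrightarrow> - (q' + t *\<^sub>R v) \<in> Q_plus c"
        and x: "x = pt S True p'" "x = pt S False q'" for p' q'
    proof -
      have "p' \<in> Q_plus c" using p'[of 0] i(1) j(1) by simp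
      then obtain k where k: "p' \<in> edge c k" using inner[of True p' False q'] x by auto
      have q'_eq: "q' = p' - E k" using at_edge[OF k x] by simp
      show ?thesis unfolding q'_eq
        by (rule edge_ray_unique[OF k p' q'[unfolded q'_eq] t])
    qed
    have same: "q = p" if "i = j"
    proof (cases "\<exists>k. (if i then p else - p) \<in> edge c k")
      case False
      then show ?thesis using inner[of i p j q] p q by auto
    next
      case True
      then obtain k where k: "(if i then p else - p) \<in> edge c k" by blast
      show ?thesis
      proof (cases i)
        case True
        then show ?thesis using at_edge[of p k j q] k p(2) q(2) that by simp
      next
        case False
        then have k: "p + E k \<in> edge c k" using edge_reflect[of "- p" k] k by (simp add: algebra_simps)
        have "x = pt S True (p + E k)" using pt_edge[OF k] p(2) False by simp
        then show ?thesis using at_edge[OF k, of j q] q(2) that False by simp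
      qed
    qed
    show ?thesis
    proof (cases "i = j")
      case True
      then show ?thesis using same by simp
    next
      case ij: False
      show ?thesis
      proof (cases i)
        case True
        then show ?thesis using cross[of p q] i(2) j(2) p(2) q(2) ij by simp
      next
        case False
        then show ?thesis using cross[of q p] i(2) j(2) p(2) q(2) ij by simp
      qed
    qed
  qed
  have "0 < min d e" using i(1) j(1) by simp
  from differ[OF this] obtain t where t: "t \<in> {0..min d e}" "\<gamma> t \<noteq> \<beta> t" by blast
  then have "\<gamma> t = \<beta> t" using i(3)[of t] j(3)[of t] unique[of t] by simp
  then show False using t by simp
qed

lemma affine_automorphism_branching:
  assumes g: "affine_automorphism S D g" and "branching x"
  shows "branching (g x)"
proof -
  obtain \<gamma> \<beta> v where \<gamma>: "range \<gamma> \<subseteq> surface S" "range \<beta> \<subseteq> surface S"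
     "initial_velocity S \<gamma> v" "initial_velocity S \<beta> v" "\<gamma> 0 = x" "\<beta> 0 = x"
     "\<And>e. 0 < e \<Longrightarrow> \<exists>t\<in>{0..e}. \<gamma> t \<noteq> \<beta> t"
    using assms(2) unfolding branching_def by blast
  have bij: "bij_betw g (surface S) (surface S)" using g by (simp add: affine_automorphism_def)
  have ne: "\<exists>t\<in>{0..e}. (g \<circ> \<gamma>) t \<noteq> (g \<circ> \<beta>) t" if e: "0 < e" for e
  proof -
    obtain t where t: "t \<in> {0..e}" "\<gamma> t \<noteq> \<beta> t" using \<gamma>(7)[OF e] by blast
    have "\<gamma> t \<in> surface S" "\<beta> t \<in> surface S" using \<gamma>(1,2) by auto
    then have "g (\<gamma> t) \<noteq> g (\<beta> t)" using bij t(2) by (auto simp: bij_betw_def dest: inj_onD)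
    then show ?thesis using t(1) by auto
  qed
  have "initial_velocity S (g \<circ> \<gamma>) (D *v v)" "initial_velocity S (g \<circ> \<beta>) (D *v v)"
    using g \<gamma>(1-4) unfolding affine_automorphism_def by blast+
  moreover have "range (g \<circ> \<gamma>) \<subseteq> surface S" "range (g \<circ> \<beta>) \<subseteq> surface S"
    using bij_betwE[OF bij] \<gamma>(1,2) by auto
  moreover have "(g \<circ> \<gamma>) 0 = g x" "(g \<circ> \<beta>) 0 = g x" using \<gamma>(5,6) by simp_all
  ultimately show ?thesis unfolding branching_def using ne by blast
qed

lemma affine_automorphism_sing:
  assumes "affine_automorphism S D g"
  shows "\<exists>b'. g (sing b) = sing b'"
  using branching_imp_sing affine_automorphism_branching[OF assms branching_sing] by blast

subsection \<open>Straight connections of singular points\<close>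

text \<open>Connections are allowed to pass through singular points, where they may turn by any angle
  that leads back to the same direction.\<close>

definition straight :: "(real \<Rightarrow> (bool \<times> (real^2)) set) \<Rightarrow> real^2 \<Rightarrow> bool" where
  "straight \<gamma> v \<longleftrightarrow> range \<gamma> \<subseteq> surface S \<and>
     (\<forall>t. 0 \<le> t \<and> t < 1 \<longrightarrow> initial_velocity S (\<lambda>s. \<gamma> (t + s)) v) \<and>
     (\<forall>t. 0 < t \<and> t \<le> 1 \<longrightarrow> initial_velocity S (\<lambda>s. \<gamma> (t - s)) (- v))"

definition joined :: "real^2 \<Rightarrow> bool \<Rightarrow> bool \<Rightarrow> bool" where
  "joined v a b \<longleftrightarrow> (\<exists>\<gamma>. straight \<gamma> v \<and> \<gamma> 0 = sing a \<and> \<gamma> 1 = sing b)"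

lemma straight_image:
  assumes g: "affine_automorphism S D g" and "straight \<gamma> v"
  shows "straight (g \<circ> \<gamma>) (D *v v)"
proof -
  have surf: "range \<gamma> \<subseteq> surface S" using assms(2) by (simp add: straight_def)
  have "range (\<lambda>s. \<gamma> (t + s)) \<subseteq> surface S" "range (\<lambda>s. \<gamma> (t - s)) \<subseteq> surface S" for t
    using surf by auto
  note range = this
  have iv: "initial_velocity S (\<lambda>s. \<gamma> (t + s)) v \<Longrightarrow> initial_velocity S (g \<circ> (\<lambda>s. \<gamma> (t + s))) (D *v v)"
    "initial_velocity S (\<lambda>s. \<gamma> (t - s)) (- v) \<Longrightarrow> initial_velocity S (g \<circ> (\<lambda>s. \<gamma> (t - s))) (D *v (- v))" for t
    using g[unfolded affine_automorphism_def, THEN conjunct2, rule_format, OF range(1)[of t], of v]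
      g[unfolded affine_automorphism_def, THEN conjunct2, rule_format, OF range(2)[of t], of "- v"] by blast+
  have "range (g \<circ> \<gamma>) \<subseteq> surface S"
    using g surf by (auto simp: affine_automorphism_def dest: bij_betwE)
  moreover have "D *v (- v) = - (D *v v)" by (simp add: vec.neg)
  ultimately show ?thesis
    using assms(2) iv unfolding straight_def comp_def by simp
qed

lemma joined_image:
  assumes g: "affine_automorphism S D g" and "joined v a b"
  shows "\<exists>a' b'. joined (D *v v) a' b' \<and> (a' = b' \<longleftrightarrow> a = b)"
proof -
  obtain \<gamma> where \<gamma>: "straight \<gamma> v" "\<gamma> 0 = sing a" "\<gamma> 1 = sing b" using assms(2) by (auto simp: joined_def)
  obtain a' b' where ab: "g (sing a) = sing a'" "g (sing b) = sing b'"
    using affine_automorphism_sing[OF g] by metis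
  have "inj_on g (surface S)" using g by (simp add: affine_automorphism_def bij_betw_def)
  then have "g (sing a) = g (sing b) \<longleftrightarrow> sing a = sing b"
    using sing_in_surface by (auto dest: inj_onD)
  then have "a' = b' \<longleftrightarrow> a = b" using ab by simp
  moreover have "joined (D *v v) a' b'"
    unfolding joined_def using straight_image[OF g \<gamma>(1)] \<gamma>(2,3) ab by (intro exI[of _ "g \<circ> \<gamma>"]) simp
  ultimately show ?thesis by blast
qed

lemma straight_line:
  assumes "p \<in> piece S i" "p + v \<in> piece S i"
  shows "straight (clamp_line S i p v 1) v"
proof -
  have convex: "convex (piece S i)"
  proof (cases i)
    case False
    have "piece S False = uminus ` Q_plus c" by (simp add: S_surf_def Q_minus_def)
    then show ?thesis using False convex_negations[OF convex_Q] by simp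
  qed (simp add: S_surf_def convex_Q)
  have mem: "p + t *\<^sub>R v \<in> piece S i" if "0 \<le> t" "t \<le> 1" for t
  proof -
    have "p + t *\<^sub>R v = (1 - t) *\<^sub>R p + t *\<^sub>R (p + v)" by (simp add: algebra_simps)
    then show ?thesis using convex[unfolded convex_alt] assms that by metis
  qed
  show ?thesis unfolding straight_def
  proof (intro conjI allI impI)
    show "range (clamp_line S i p v 1) \<subseteq> surface S"
      using mem by (auto intro!: clamp_line_in_surface)
  next
    fix t :: real assume t: "0 \<le> t \<and> t < 1"
    show "initial_velocity S (\<lambda>s. clamp_line S i p v 1 (t + s)) v"
    proof (rule initial_velocity_line[of i S "1 - t" "p + t *\<^sub>R v"])
      fix s assume s: "0 \<le> s" "s \<le> 1 - t"
      have eq: "p + t *\<^sub>R v + s *\<^sub>R v = p + (t + s) *\<^sub>R v" by (simp add: algebra_simps)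
      show "p + t *\<^sub>R v + s *\<^sub>R v \<in> piece S i" unfolding eq using mem s t by simp
      show "clamp_line S i p v 1 (t + s) = pt S i (p + t *\<^sub>R v + s *\<^sub>R v)"
        unfolding eq using s t by (intro clamp_line_eq) auto
    qed (use t in auto)
  next
    fix t :: real assume t: "0 < t \<and> t \<le> 1"
    show "initial_velocity S (\<lambda>s. clamp_line S i p v 1 (t - s)) (- v)"
    proof (rule initial_velocity_line[of i S t "p + t *\<^sub>R v"])
      fix s assume s: "0 \<le> s" "s \<le> t"
      have eq: "p + t *\<^sub>R v + s *\<^sub>R - v = p + (t - s) *\<^sub>R v" by (simp add: algebra_simps)
      show "p + t *\<^sub>R v + s *\<^sub>R - v \<in> piece S i" unfolding eq using mem s t by simp
      show "clamp_line S i p v 1 (t - s) = pt S i (p + t *\<^sub>R v + s *\<^sub>R - v)"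
        unfolding eq using s t by (intro clamp_line_eq) auto
    qed (use t in auto)
  qed
qed

lemma joined_chord: "joined (P k - P j) (even j) (even k)"
proof -
  have "straight (clamp_line S True (P j) (P k - P j) 1) (P k - P j)"
    by (rule straight_line) simp_all
  then show ?thesis unfolding joined_def
    by (intro exI[of _ "clamp_line S True (P j) (P k - P j) 1"]) (simp add: clamp_line_def pt_vertex)
qed

end

section \<open>Directions and lengths of straight connections\<close>

context polygon_param
begin

definition interior_point :: "bool \<Rightarrow> real^2 \<Rightarrow> bool" where
  "interior_point i p \<longleftrightarrow> p \<in> piece S i \<and> (\<forall>k. (if i then p else - p) \<notin> edge c k)"

lemma interior_pt_eq: "interior_point i p \<Longrightarrow> pt S i p = pt S j q \<Longrightarrow> j = i \<and> q = p"
  unfolding interior_point_def using pt_inner_eq by blast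

lemma straight_forward:
  assumes "straight \<gamma> v" "0 \<le> t" "t < 1"
  shows "\<exists>i p e. 0 < e \<and> (\<forall>s. 0 \<le> s \<longrightarrow> s \<le> e \<longrightarrow>
    p + s *\<^sub>R v \<in> piece S i \<and> \<gamma> (t + s) = pt S i (p + s *\<^sub>R v))"
proof -
  have "initial_velocity S (\<lambda>s. \<gamma> (t + s)) v" using assms by (simp add: straight_def)
  from initial_velocityD[OF this] show ?thesis by blast
qed

lemma straight_backward:
  assumes "straight \<gamma> v" "0 < t" "t \<le> 1"
  shows "\<exists>i p e. 0 < e \<and> (\<forall>s. 0 \<le> s \<longrightarrow> s \<le> e \<longrightarrow>
    p - s *\<^sub>R v \<in> piece S i \<and> \<gamma> (t - s) = pt S i (p - s *\<^sub>R v))"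
proof -
  have "initial_velocity S (\<lambda>s. \<gamma> (t - s)) (- v)" using assms by (simp add: straight_def)
  from initial_velocityD[OF this] show ?thesis by simp
qed

text \<open>Here C t i p is a condition on a representative (i, p) of the point of the path at time t.
  It is carried along segments in a single polygon (move), and it does not depend on the choice of
  the representative (all), which allows the path to change polygons. Compactness of the
  parameter interval does the rest.\<close>

lemma straight_continuation:
  assumes \<gamma>: "straight \<gamma> v" and ab: "0 < a" "a \<le> b" "b \<le> 1"
    and start: "\<exists>i p. p \<in> piece S i \<and> \<gamma> a = pt S i p \<and> C a i p"
    and all: "\<And>t i p j q. a \<le> t \<Longrightarrow> t \<le> b \<Longrightarrow> p \<in> piece S i \<Longrightarrow> C t i p \<Longrightarrow> pt S i p = pt S j q \<Longrightarrow> C t j q"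
    and move: "\<And>t t' i p. a \<le> t \<Longrightarrow> t \<le> b \<Longrightarrow> a \<le> t' \<Longrightarrow> t' \<le> b \<Longrightarrow> C t i p \<Longrightarrow> C t' i (p + (t' - t) *\<^sub>R v)"
  shows "\<exists>i p. p \<in> piece S i \<and> \<gamma> b = pt S i p \<and> C b i p"
proof -
  define H where "H t \<longleftrightarrow> (\<exists>i p. p \<in> piece S i \<and> \<gamma> t = pt S i p \<and> C t i p)" for t
  define Q where "Q s t \<longleftrightarrow> (a \<le> s \<longrightarrow> t \<le> b \<longrightarrow> H s \<longrightarrow> H t)" for s t
  have "Q a b" using ab(2)
  proof (induction rule: Bolzano)
    case (trans s t u)
    then show ?case unfolding Q_def by auto
  next
    case (local x)
    note range = "local"
    have x: "0 < x" "x \<le> 1" using range ab by auto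
    obtain i p e where i: "0 < e" "\<And>s. 0 \<le> s \<Longrightarrow> s \<le> e \<Longrightarrow> p - s *\<^sub>R v \<in> piece S i"
      "\<And>s. 0 \<le> s \<Longrightarrow> s \<le> e \<Longrightarrow> \<gamma> (x - s) = pt S i (p - s *\<^sub>R v)"
      using straight_backward[OF \<gamma> x] by blast
    have bwd: "H x" if s: "a \<le> s" "s \<le> x" "x - s \<le> e" "H s" for s
    proof -
      obtain j q where j: "q \<in> piece S j" "\<gamma> s = pt S j q" "C s j q" using s(4) unfolding H_def by blast
      have "\<gamma> s = pt S i (p - (x - s) *\<^sub>R v)" using i(3)[of "x - s"] s by simp
      then have "C s i (p - (x - s) *\<^sub>R v)" using all[of s q j i] j s range by simp
      then have "C x i (p - (x - s) *\<^sub>R v + (x - s) *\<^sub>R v)" by (rule move[rotated 4]) (use s range in auto)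
      moreover have "p \<in> piece S i" "\<gamma> x = pt S i p" using i(2,3)[of 0] i(1) by simp_all
      ultimately show "H x" unfolding H_def by (intro exI[of _ i] exI[of _ p]) simp
    qed
    have fwd: "\<exists>d>0. \<forall>t. x \<le> t \<and> t < x + d \<and> t \<le> b \<and> H x \<longrightarrow> H t"
    proof (cases "x < 1")
      case True
      then obtain j q d where j: "0 < d" "\<And>s. 0 \<le> s \<Longrightarrow> s \<le> d \<Longrightarrow> q + s *\<^sub>R v \<in> piece S j"
        "\<And>s. 0 \<le> s \<Longrightarrow> s \<le> d \<Longrightarrow> \<gamma> (x + s) = pt S j (q + s *\<^sub>R v)"
        using straight_forward[OF \<gamma> less_imp_le[OF x(1)]] by blast
      have "H t" if t: "x \<le> t" "t < x + d" "t \<le> b" "H x" for t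
      proof -
        obtain i p where i: "p \<in> piece S i" "\<gamma> x = pt S i p" "C x i p" using t(4) unfolding H_def by blast
        have "\<gamma> x = pt S j q" using j(3)[of 0] j(1) by simp
        then have "C x j q" using all[of x p i j q] i t range by simp
        then have "C t j (q + (t - x) *\<^sub>R v)" by (rule move[rotated 4]) (use t range in auto)
        moreover have "q + (t - x) *\<^sub>R v \<in> piece S j" using j(2)[of "t - x"] t by simp
        moreover have "\<gamma> t = pt S j (q + (t - x) *\<^sub>R v)" using j(3)[of "t - x"] t by simp
        ultimately show "H t" unfolding H_def by blast
      qed
      then show ?thesis using j(1) by blast
    next
      case False
      then have "t = x" if "x \<le> t" "t \<le> b" for t using that ab by linarith
      then have "x \<le> t \<and> t < x + 1 \<and> t \<le> b \<and> H x \<longrightarrow> H t" for t by metis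
      then show ?thesis by (intro exI[of _ 1]) simp
    qed
    then obtain d where d: "0 < d" "\<And>t. x \<le> t \<Longrightarrow> t < x + d \<Longrightarrow> t \<le> b \<Longrightarrow> H x \<Longrightarrow> H t" by blast
    have "Q s t" if st: "s \<le> x \<and> x \<le> t \<and> t - s < min d e" for s t
      unfolding Q_def
    proof (intro impI)
      assume *: "a \<le> s" "t \<le> b" "H s"
      have "H x" by (rule bwd[of s]) (use st * in auto)
      then show "H t" by (rule d(2)[rotated 3]) (use st * in auto)
    qed
    then show ?case using d(1) i(1) by (intro exI[of _ "min d e"]) simp
  qed
  then show ?thesis using start unfolding Q_def H_def by blast
qed

lemma straight_follow:
  assumes \<gamma>: "straight \<gamma> v" and ab: "0 < a" "a \<le> b" "b \<le> 1"
    and start: "\<gamma> a = pt S i (p + a *\<^sub>R v)"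
    and inner: "\<And>t. a \<le> t \<Longrightarrow> t \<le> b \<Longrightarrow> interior_point i (p + t *\<^sub>R v)"
  shows "\<gamma> b = pt S i (p + b *\<^sub>R v)"
proof -
  define C where "C t j q \<longleftrightarrow> j = i \<and> q = p + t *\<^sub>R v" for t j q
  have "\<exists>j q. q \<in> piece S j \<and> \<gamma> b = pt S j q \<and> C b j q"
  proof (rule straight_continuation[OF \<gamma> ab])
    show "\<exists>j q. q \<in> piece S j \<and> \<gamma> a = pt S j q \<and> C a j q"
      using start inner[of a] ab unfolding C_def interior_point_def by simp
  next
    fix t j q j' q' assume *: "a \<le> t" "t \<le> b" "C t j q" "pt S j q = pt S j' q'"
    then show "C t j' q'" using interior_pt_eq[OF inner[of t], of j' q'] unfolding C_def by simp
  next
    fix t t' j q assume "C t j q"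
    then show "C t' j (q + (t' - t) *\<^sub>R v)" unfolding C_def by (simp add: algebra_simps)
  qed
  then show ?thesis unfolding C_def by blast
qed

text \<open>A connection starts along a ray from a vertex of one of the two polygons. The ray cannot stay in
  the interior all the time, because paths continue uniquely there and the end point is singular.\<close>

lemma joined_start:
  assumes "joined v a b"
  obtains i p e where "vertex_class a (i, p)" "0 < e" "\<And>t. 0 \<le> t \<Longrightarrow> t \<le> e \<Longrightarrow> p + t *\<^sub>R v \<in> piece S i"
    "\<not> (\<forall>t. 0 < t \<longrightarrow> t \<le> 1 \<longrightarrow> interior_point i (p + t *\<^sub>R v))"
proof -
  obtain \<gamma> where \<gamma>: "straight \<gamma> v" "\<gamma> 0 = sing a" "\<gamma> 1 = sing b" using assms by (auto simp: joined_def)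
  obtain i p e where i: "0 < e" "\<And>s. 0 \<le> s \<Longrightarrow> s \<le> e \<Longrightarrow> p + s *\<^sub>R v \<in> piece S i"
      "\<And>s. 0 \<le> s \<Longrightarrow> s \<le> e \<Longrightarrow> \<gamma> (0 + s) = pt S i (p + s *\<^sub>R v)"
    using straight_forward[OF \<gamma>(1) order_refl zero_less_one] by blast
  have "pt S i p = sing a" using i(3)[of 0] i(1) \<gamma>(2) by simp
  then have "vertex_class a (i, p)" by (rule pt_eq_sing)
  moreover have "\<not> (\<forall>t. 0 < t \<longrightarrow> t \<le> 1 \<longrightarrow> interior_point i (p + t *\<^sub>R v))"
  proof
    assume inn: "\<forall>t. 0 < t \<longrightarrow> t \<le> 1 \<longrightarrow> interior_point i (p + t *\<^sub>R v)"
    define d where "d = min e 1"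
    have d: "0 < d" "d \<le> 1" "d \<le> e" using i(1) by (auto simp: d_def)
    have "\<gamma> 1 = pt S i (p + 1 *\<^sub>R v)"
      by (rule straight_follow[OF \<gamma>(1) d(1,2) order_refl]) (use i(3)[of d] d inn in auto)
    then have "vertex_class b (i, p + 1 *\<^sub>R v)" using \<gamma>(3) pt_eq_sing by metis
    then obtain k where k: "P k = (if i then p + 1 *\<^sub>R v else - (p + 1 *\<^sub>R v))"
      unfolding vertex_class_def by (cases i) (auto simp: equation_minus_iff)
    have "interior_point i (p + 1 *\<^sub>R v)" using inn zero_less_one order_refl by blast
    then have "P k \<notin> edge c k" unfolding interior_point_def k[symmetric] by blast
    then show False by (simp add: edge_def)
  qed
  ultimately show thesis using that i by blast
qed

text \<open>In a direction of the recession cone of the upper polygon, every ray from a singular point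
  escapes to infinity inside that polygon.\<close>

lemma not_joined_recession:
  assumes "joined v a b" and v: "0 < v $ 2" "0 \<le> v $ 1"
  shows "(c - 1) * v $ 2 < (c + 1) * v $ 1"
proof (rule ccontr)
  assume "\<not> ?thesis"
  then have slope: "0 < slope k v" for k using slope_pos[OF v] by simp
  obtain i p e where i: "vertex_class a (i, p)" "0 < e" "\<And>t. 0 \<le> t \<Longrightarrow> t \<le> e \<Longrightarrow> p + t *\<^sub>R v \<in> piece S i"
    "\<not> (\<forall>t. 0 < t \<longrightarrow> t \<le> 1 \<longrightarrow> interior_point i (p + t *\<^sub>R v))"
    using joined_start[OF assms(1)] by metis
  show False
  proof (cases i)
    case True
    then obtain k where "p = P k" using i(1) by (auto simp: vertex_class_def)
    then have "interior_point i (p + t *\<^sub>R v)" if "0 < t" for t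
      using ray_inside[OF slope P_in_Q that] True by (simp add: interior_point_def)
    then show False using i(4) by blast
  next
    case False
    then obtain k where p: "p = - P k" using i(1) by (auto simp: vertex_class_def)
    have "- (p + e *\<^sub>R v) \<in> Q_plus c" using i(3)[of e] i(2) False by simp
    moreover have "- (p + e *\<^sub>R v) = P k + (- e) *\<^sub>R v" using p by simp
    ultimately have "0 \<le> side k (P k + (- e) *\<^sub>R v)" using side_nonneg by metis
    then have "0 \<le> side k (P k) + (- e) * slope k v" unfolding side_add .
    then have "e * slope k v \<le> 0" by simp
    moreover have "0 < e * slope k v" using i(2) slope[of k] by simp
    ultimately show False by simp
  qed
qed

lemma P_height: "P k $ 2 = Y (nat \<bar>k\<bar>)" and P_abs: "\<bar>P k $ 1\<bar> = X (nat \<bar>k\<bar>)"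
proof -
  have "P k $ 2 = Y (nat \<bar>k\<bar>) \<and> \<bar>P k $ 1\<bar> = X (nat \<bar>k\<bar>)"
    by (cases k rule: int_cases2) (simp_all add: P_of_nat P_minus_nat)
  then show "P k $ 2 = Y (nat \<bar>k\<bar>)" "\<bar>P k $ 1\<bar> = X (nat \<bar>k\<bar>)" by auto
qed

text \<open>A point strictly between the two ends of its chord lies on no edge. At the height Y n the edge may
  belong to the adjacent strip, which has the same chord at that height.\<close>

lemma inside_strip:
  assumes "Y n \<le> q $ 2" "q $ 2 \<le> Y (Suc n)" "\<bar>q $ 1\<bar> < W n (q $ 2)"
  shows "q \<in> Q_plus c" "q \<notin> edge c k"
proof -
  show "q \<in> Q_plus c" using Q_plus_strip[OF assms(1,2)] assms(3) by simp
  have W_le: "W n (q $ 2) \<le> W m (q $ 2)" if "Y m \<le> q $ 2" "q $ 2 \<le> Y (Suc m)" for m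
  proof -
    have "vec2 (W n (q $ 2)) (q $ 2) \<in> Q_plus c"
      using chord_end_in_Q(1)[OF assms(1,2)] by (rule edge_in_Q)
    then show ?thesis using Q_plus_strip[of m "vec2 (W n (q $ 2)) (q $ 2)"] that by simp
  qed
  show "q \<notin> edge c k"
  proof
    assume e: "q \<in> edge c k"
    then have 0: "side k q = 0" by (rule side_edge)
    show False
    proof (cases k rule: int_sign_cases)
      case (1 m)
      have "W n (q $ 2) \<le> W m (q $ 2)" by (rule W_le) (use edge_height[of q m] e 1 in auto)
      then show False using 0 assms(3) unfolding 1 side_right by simp
    next
      case (2 m)
      have "W n (q $ 2) \<le> W m (q $ 2)" by (rule W_le) (use edge_height[of q m] e 2 in auto)
      then show False using 0 assms(3) unfolding 2 side_left by simp
    qed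
  qed
qed

text \<open>A horizontal ray that enters the polygon at a vertex runs along a chord between the vertices k
  and - k, which has length at least 2. It does not enter at the vertex 0, where the chord degenerates.\<close>

lemma horizontal_ray_inside:
  assumes w: "w $ 2 = 0" "w $ 1 \<noteq> 0" "\<bar>w $ 1\<bar> < 2" and e: "0 < e" "P k + e *\<^sub>R w \<in> Q_plus c"
    and t: "0 < t" "t \<le> 1"
  shows "P k + t *\<^sub>R w \<in> Q_plus c" "P k + t *\<^sub>R w \<notin> edge c j"
proof -
  define n where "n = nat \<bar>k\<bar>"
  have P: "P k $ 2 = Y n" "\<bar>P k $ 1\<bar> = X n" unfolding n_def by (rule P_height, rule P_abs)
  have e1: "\<bar>P k $ 1 + e * w $ 1\<bar> \<le> X n"
    using Q_plus_strip[of n "P k + e *\<^sub>R w"] e(2) P(1) w(1) W_Y(1)[of n] by simp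
  have "0 < \<bar>e * w $ 1\<bar>" using e(1) w(2) by simp
  then have "X n \<noteq> 0" using e1 P(2) by auto
  then obtain m where m: "n = Suc m" by (cases n) auto
  have X1: "1 \<le> X n" using X_ge_nat[of n] m by simp
  have t1: "\<bar>t * w $ 1\<bar> < 2" "0 < \<bar>t * w $ 1\<bar>"
  proof -
    have "t * \<bar>w $ 1\<bar> \<le> 1 * \<bar>w $ 1\<bar>" using t by (intro mult_right_mono) auto
    then show "\<bar>t * w $ 1\<bar> < 2" using w(3) t by (simp add: abs_mult)
  qed (use t w(2) in simp)
  have sgn: "0 < t * w $ 1 \<longleftrightarrow> 0 < e * w $ 1"
    using t(1) e(1) by (simp add: zero_less_mult_iff)
  have "\<bar>P k $ 1 + t * w $ 1\<bar> < X n" using e1 P(2) X1 t1 sgn \<open>0 < \<bar>e * w $ 1\<bar>\<close> by arith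
  then have "\<bar>(P k + t *\<^sub>R w) $ 1\<bar> < W n ((P k + t *\<^sub>R w) $ 2)"
    using P(1) w(1) W_Y(1)[of n] by simp
  then show "P k + t *\<^sub>R w \<in> Q_plus c" "P k + t *\<^sub>R w \<notin> edge c j"
    using inside_strip[of n "P k + t *\<^sub>R w"] P(1) w(1) by simp_all
qed

lemma joined_horizontal:
  assumes "joined v a b" "v $ 2 = 0" "v $ 1 \<noteq> 0"
  shows "2 \<le> \<bar>v $ 1\<bar>"
proof (rule ccontr)
  assume "\<not> ?thesis"
  then have short: "\<bar>v $ 1\<bar> < 2" by simp
  obtain i p e where i: "vertex_class a (i, p)" "0 < e" "\<And>t. 0 \<le> t \<Longrightarrow> t \<le> e \<Longrightarrow> p + t *\<^sub>R v \<in> piece S i"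
    "\<not> (\<forall>t. 0 < t \<longrightarrow> t \<le> 1 \<longrightarrow> interior_point i (p + t *\<^sub>R v))"
    using joined_start[OF assms(1)] by metis
  have e: "p + e *\<^sub>R v \<in> piece S i" using i(2,3) by simp
  have "interior_point i (p + t *\<^sub>R v)" if t: "0 < t" "t \<le> 1" for t
  proof (cases i)
    case True
    then obtain k where "p = P k" using i(1) by (auto simp: vertex_class_def)
    then show ?thesis
      using horizontal_ray_inside[OF assms(2,3) short i(2) _ t, of k] e True by (simp add: interior_point_def)
  next
    case False
    then obtain k where p: "p = - P k" using i(1) by (auto simp: vertex_class_def)
    have "P k + s *\<^sub>R (- v) = - (p + s *\<^sub>R v)" for s using p by simp
    then show ?thesis
      using horizontal_ray_inside[of "- v" e k t] assms(2,3) short i(2) e t False by (simp add: interior_point_def)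
  qed
  then show False using i(4) by blast
qed

subsection \<open>Crossing horizontal cylinders\<close>

text \<open>The part of the upper polygon between the heights Y n and Y (n + 1) and the corresponding
  part of the lower polygon form a horizontal cylinder, in which u is the height above its lower
  boundary.\<close>

definition in_cyl :: "nat \<Rightarrow> real \<Rightarrow> bool \<Rightarrow> real^2 \<Rightarrow> bool" where
  "in_cyl n u i p \<longleftrightarrow> 0 \<le> u \<and> u \<le> ht n \<and> p $ 2 = (if i then Y n + u else u - Y (Suc n))"

lemma E_height: "E (int m) $ 2 = Y m + Y (Suc m)" "E (- int (Suc m)) $ 2 = Y m + Y (Suc m)"
proof -
  have "P (int m + 1) = vec2 (X (Suc m)) (Y (Suc m))" using P_of_nat[of "Suc m"] by (simp add: add.commute)
  then show "E (int m) $ 2 = Y m + Y (Suc m)" by (simp add: P_of_nat)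
  have eq: "- int (Suc m) + 1 = - int m" by simp
  show "E (- int (Suc m)) $ 2 = Y m + Y (Suc m)" unfolding eq P_minus_nat by simp
qed

lemma edge_strip:
  assumes "q \<in> edge c k"
  obtains m where "Y m \<le> q $ 2" "q $ 2 \<le> Y (Suc m)" "E k $ 2 = Y m + Y (Suc m)" "k = int m \<or> k = - int (Suc m)"
proof (cases k rule: int_sign_cases)
  case (1 m)
  show thesis by (rule that[of m]) (use assms edge_height[of q m] E_height(1)[of m] 1 in auto)
next
  case (2 m)
  show thesis by (rule that[of m]) (use assms edge_height[of q m] E_height(2)[of m] 2 in auto)
qed

text \<open>Strictly inside a cylinder, the height u is the same for both representatives of a point of
  a slanted edge.\<close>

lemma in_cyl_pt:
  assumes "in_cyl n u i p" "0 < u" "u < ht n" "p \<in> piece S i" "pt S i p = pt S j q"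
  shows "in_cyl n u j q"
proof -
  have "(\<lambda>(i, p). in_cyl n u i p) (i, p) = (\<lambda>(i, p). in_cyl n u i p) (j, q)"
  proof (rule pt_invariant[OF _ assms(5,4)])
    fix k r assume r: "r \<in> edge c k"
    then obtain m where m: "Y m \<le> r $ 2" "r $ 2 \<le> Y (Suc m)" "E k $ 2 = Y m + Y (Suc m)"
      by (rule edge_strip)
    have "in_cyl n u True r = in_cyl n u False (r - E k)"
    proof
      assume "in_cyl n u True r"
      then have "r $ 2 = Y n + u" by (simp add: in_cyl_def)
      moreover from this have "n = m"
        using Y_interval_unique[of m "r $ 2" n] m assms(2,3) by (simp add: Y_Suc)
      ultimately show "in_cyl n u False (r - E k)" using m(3) assms(2,3) unfolding in_cyl_def by simp
    next
      assume "in_cyl n u False (r - E k)"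
      then have *: "r $ 2 - (Y m + Y (Suc m)) = u - Y (Suc n)" using m(3) by (simp add: in_cyl_def)
      then have "n = m"
        using Y_interval_unique[of m "Y (Suc n) - u" n] m assms(2,3) by (simp add: Y_Suc)
      then show "in_cyl n u True r" using * assms(2,3) by (simp add: in_cyl_def)
    qed
    then show "(\<lambda>(i, p). in_cyl n u i p) (True, r) = (\<lambda>(i, p). in_cyl n u i p) (False, r - E k)" by simp
  qed
  then show ?thesis using assms(1) by simp
qed

lemma vertex_not_in_cyl:
  assumes "vertex_class b (i, p)" "in_cyl n u i p" "0 < u" "u < ht n"
  shows False
proof -
  obtain m where "p $ 2 = (if i then Y m else - Y m)"
    using assms(1) P_height unfolding vertex_class_def by (auto split: if_splits)
  moreover have False if "Y m = Y n + u \<or> Y m = Y (Suc n) - u"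
  proof -
    have "Y n < Y m" "Y m < Y (Suc n)" using that assms(3,4) by (auto simp: Y_Suc simp del: Y_less_iff)
    then show False by simp
  qed
  ultimately show False using assms(2) unfolding in_cyl_def by (auto split: if_splits)
qed

text \<open>The points on the boundaries of the cylinders.\<close>

definition level :: "bool \<Rightarrow> real^2 \<Rightarrow> bool" where
  "level i p \<longleftrightarrow> (\<exists>n. p $ 2 = (if i then Y n else - Y n))"

lemma level_pt:
  assumes "level i p" "p \<in> piece S i" "pt S i p = pt S j q"
  shows "level j q"
proof -
  have "(\<lambda>(i, p). level i p) (i, p) = (\<lambda>(i, p). level i p) (j, q)"
  proof (rule pt_invariant[OF _ assms(3,2)])
    fix k r assume r: "r \<in> edge c k"
    then obtain m where m: "Y m \<le> r $ 2" "r $ 2 \<le> Y (Suc m)" "E k $ 2 = Y m + Y (Suc m)"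
      by (rule edge_strip)
    have end_m: "l = m \<or> l = Suc m" if "Y m \<le> Y l" "Y l \<le> Y (Suc m)" for l using that by auto
    have "level True r = level False (r - E k)"
    proof
      assume "level True r"
      then obtain l where l: "r $ 2 = Y l" by (auto simp: level_def)
      then have "l = m \<or> l = Suc m" using m by (intro end_m) auto
      then have "(r - E k) $ 2 = - Y (if l = m then Suc m else m)" using l m(3) by auto
      then show "level False (r - E k)" unfolding level_def by auto
    next
      assume "level False (r - E k)"
      then obtain l where "(r - E k) $ 2 = - Y l" unfolding level_def by (simp only: if_False) blast
      then have l: "Y l = Y m + Y (Suc m) - r $ 2"
        unfolding vector_minus_component m(3) by linarith
      then have "l = m \<or> l = Suc m" using m by (intro end_m) auto
      then have "r $ 2 = Y (if l = m then Suc m else m)" using l by auto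
      then show "level True r" unfolding level_def by auto
    qed
    then show "(\<lambda>(i, p). level i p) (True, r) = (\<lambda>(i, p). level i p) (False, r - E k)" by simp
  qed
  then show ?thesis using assms(1) by simp
qed

lemma in_cyl_move:
  assumes "in_cyl n u i p" "0 \<le> u + s * v $ 2" "u + s * v $ 2 \<le> ht n"
  shows "in_cyl n (u + s * v $ 2) i (p + s *\<^sub>R v)"
  using assms by (simp add: in_cyl_def)

text \<open>A path that rises from a level point stays inside one cylinder until it has gained the
  height of that cylinder.\<close>

lemma cross_cylinder:
  assumes \<gamma>: "straight \<gamma> v" and v: "0 < v $ 2" and a: "0 \<le> a" "a < 1"
    and start: "\<gamma> a = pt S i p" "p \<in> piece S i" "level i p"
  obtains n i0 p0 where "p0 \<in> piece S i0" "\<gamma> a = pt S i0 p0" "in_cyl n 0 i0 p0"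
    "\<And>t. a < t \<Longrightarrow> t \<le> 1 \<Longrightarrow> t \<le> a + ht n / v $ 2 \<Longrightarrow>
      \<exists>j q. q \<in> piece S j \<and> \<gamma> t = pt S j q \<and> in_cyl n (v $ 2 * (t - a)) j q"
proof -
  obtain j r e where j: "0 < e" "\<And>s. 0 \<le> s \<Longrightarrow> s \<le> e \<Longrightarrow> r + s *\<^sub>R v \<in> piece S j"
      "\<And>s. 0 \<le> s \<Longrightarrow> s \<le> e \<Longrightarrow> \<gamma> (a + s) = pt S j (r + s *\<^sub>R v)"
    using straight_forward[OF \<gamma> a] by blast
  have r: "r \<in> piece S j" "\<gamma> a = pt S j r" using j(2,3)[of 0] j(1) by auto
  have "level j r" using level_pt[OF start(3,2), of j r] start(1) r(2) by simp
  then obtain l where l: "r $ 2 = (if j then Y l else - Y l)" by (auto simp: level_def)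
  obtain n where n: "in_cyl n 0 j r"
  proof (cases j)
    case True
    then show thesis using l that[of l] by (simp add: in_cyl_def)
  next
    case False
    have "- (r + e *\<^sub>R v) \<in> Q_plus c" using j(2)[of e] j(1) False by simp
    then have "0 \<le> Y l - e * v $ 2" using Q_plus_height l False by fastforce
    moreover have "0 < e * v $ 2" using v j(1) by simp
    ultimately have "l \<noteq> 0" using Y.simps(1) by (metis diff_0 neg_0_le_iff_le not_less)
    then obtain n where "l = Suc n" by (cases l) auto
    then show thesis using l that[of n] False by (simp add: in_cyl_def)
  qed
  define T where "T = a + ht n / v $ 2"
  define H where "H t \<longleftrightarrow> (\<exists>j q. q \<in> piece S j \<and> \<gamma> t = pt S j q \<and> in_cyl n (v $ 2 * (t - a)) j q)" for t
  have height: "v $ 2 * (t - a) \<le> ht n \<longleftrightarrow> t \<le> T" "v $ 2 * (t - a) < ht n \<longleftrightarrow> t < T" for t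
    using v by (simp_all add: T_def field_simps)
  have near: "H (a + s)" if s: "0 \<le> s" "s \<le> e" "a + s \<le> T" for s
  proof -
    have "in_cyl n (0 + s * v $ 2) j (r + s *\<^sub>R v)"
      by (rule in_cyl_move[OF n]) (use s v height(1)[of "a + s"] in \<open>auto simp: mult.commute\<close>)
    then have "in_cyl n (v $ 2 * (a + s - a)) j (r + s *\<^sub>R v)" by (simp add: mult.commute)
    then show ?thesis unfolding H_def using j(2,3)[of s] s by blast
  qed
  have below: "H t" if t: "a < t" "t \<le> 1" "t < T" for t
  proof (cases "t - a \<le> e")
    case True
    then show ?thesis using near[of "t - a"] t by simp
  next
    case False
    define b where "b = a + e"
    have b: "a < b" "b \<le> t" "0 < b" using False j(1) a by (auto simp: b_def)
    have "\<exists>j q. q \<in> piece S j \<and> \<gamma> t = pt S j q \<and> in_cyl n (v $ 2 * (t - a)) j q"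
    proof (rule straight_continuation[OF \<gamma> b(3,2) t(2), where C = "\<lambda>t. in_cyl n (v $ 2 * (t - a))"])
      show "\<exists>i p. p \<in> piece S i \<and> \<gamma> b = pt S i p \<and> in_cyl n (v $ 2 * (b - a)) i p"
        using near[of e] b t j(1) unfolding b_def H_def by simp
    next
      fix s i p j q assume s: "b \<le> s" "s \<le> t" and *: "p \<in> piece S i" "in_cyl n (v $ 2 * (s - a)) i p"
        "pt S i p = pt S j q"
      have "0 < v $ 2 * (s - a)" using v s b by simp
      moreover have "v $ 2 * (s - a) < ht n" using height(2)[of s] s t by simp
      ultimately show "in_cyl n (v $ 2 * (s - a)) j q" using in_cyl_pt[OF *(2) _ _ *(1,3)] by blast
    next
      fix s s' i p assume s: "b \<le> s'" "s' \<le> t" and *: "in_cyl n (v $ 2 * (s - a)) i p"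
      have eq: "v $ 2 * (s - a) + (s' - s) * v $ 2 = v $ 2 * (s' - a)" by (simp add: algebra_simps)
      have "0 \<le> v $ 2 * (s' - a)" using v s b by simp
      moreover have "v $ 2 * (s' - a) \<le> ht n" using height(1)[of s'] s t by simp
      ultimately show "in_cyl n (v $ 2 * (s' - a)) i (p + (s' - s) *\<^sub>R v)"
        using in_cyl_move[OF *, of "s' - s" v] unfolding eq by blast
    qed
    then show ?thesis unfolding H_def .
  qed
  have top: "H T" if T1: "T \<le> 1"
  proof -
    have T: "a < T" using v by (simp add: T_def)
    then obtain k q d where k: "0 < d" "\<And>s. 0 \<le> s \<Longrightarrow> s \<le> d \<Longrightarrow> q - s *\<^sub>R v \<in> piece S k"
        "\<And>s. 0 \<le> s \<Longrightarrow> s \<le> d \<Longrightarrow> \<gamma> (T - s) = pt S k (q - s *\<^sub>R v)"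
      using straight_backward[OF \<gamma> _ T1] a by fastforce
    define s where "s = min d ((T - a) / 2)"
    have s: "0 < s" "s \<le> d" "a < T - s" using k(1) T by (auto simp: s_def min_def field_simps)
    obtain j' q' where j': "q' \<in> piece S j'" "\<gamma> (T - s) = pt S j' q'" "in_cyl n (v $ 2 * (T - s - a)) j' q'"
      using below[of "T - s"] s T1 unfolding H_def by auto
    have "0 < v $ 2 * (T - s - a)" using v s by simp
    moreover have "v $ 2 * (T - s - a) < ht n" using height(2)[of "T - s"] s by simp
    moreover have "pt S j' q' = pt S k (q - s *\<^sub>R v)" using j'(2) k(3)[of s] s by simp
    ultimately have "in_cyl n (v $ 2 * (T - s - a)) k (q - s *\<^sub>R v)"
      using in_cyl_pt[OF j'(3) _ _ j'(1)] by blast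
    moreover have eq: "v $ 2 * (T - s - a) + s * v $ 2 = v $ 2 * (T - a)" by (simp add: algebra_simps)
    moreover have "0 \<le> v $ 2 * (T - a)" "v $ 2 * (T - a) \<le> ht n" using v T height(1)[of T] by simp_all
    ultimately have "in_cyl n (v $ 2 * (T - a)) k (q - s *\<^sub>R v + s *\<^sub>R v)"
      using in_cyl_move[of n "v $ 2 * (T - s - a)" k "q - s *\<^sub>R v" s v] unfolding eq by blast
    moreover have "q \<in> piece S k" "\<gamma> T = pt S k q" using k(2,3)[of 0] k(1) by simp_all
    ultimately show ?thesis unfolding H_def by (intro exI[of _ k] exI[of _ q]) simp
  qed
  show thesis
  proof (rule that[OF r n])
    fix t assume t: "a < t" "t \<le> 1" "t \<le> a + ht n / v $ 2"
    then have "t < T \<or> t = T" by (auto simp: T_def)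
    then have "H t" using below top t by auto
    then show "\<exists>j q. q \<in> piece S j \<and> \<gamma> t = pt S j q \<and> in_cyl n (v $ 2 * (t - a)) j q" unfolding H_def .
  qed
qed

inductive_set height_sums :: "real set" where
  single: "ht n \<in> height_sums"
| add: "s \<in> height_sums \<Longrightarrow> ht n + s \<in> height_sums"

lemma height_sums_ge_1: "s \<in> height_sums \<Longrightarrow> 1 \<le> s"
proof (induction rule: height_sums.induct)
  case (single n)
  then show ?case by (rule ht_ge_1)
next
  case (add s n)
  then show ?case using ht_pos[of n] by linarith
qed

text \<open>The height of the n-th cylinder is at least 2 n + 1, so only finitely many cylinders are low
  enough to contribute to a bounded sum.\<close>

lemma finite_height_sums: "finite {s \<in> height_sums. s \<le> real N}"
proof (induction N)
  case 0
  have "{s \<in> height_sums. s \<le> real 0} = {}" using height_sums_ge_1 by force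
  then show ?case by (simp only: finite.emptyI)
next
  case (Suc N)
  let ?F = "{s \<in> height_sums. s \<le> real N}"
  have "{s \<in> height_sums. s \<le> real (Suc N)} \<subseteq> (\<Union>n\<in>{..Suc N}. insert (ht n) ((+) (ht n) ` ?F))"
  proof
    fix s assume s: "s \<in> {s \<in> height_sums. s \<le> real (Suc N)}"
    have small: "n \<in> {..Suc N}" if "ht n \<le> real (Suc N)" for n
    proof -
      have "real n \<le> real (Suc N)" using ht_ge[of n] that by linarith
      then show ?thesis by simp
    qed
    from s have "s \<in> height_sums" by simp
    then show "s \<in> (\<Union>n\<in>{..Suc N}. insert (ht n) ((+) (ht n) ` ?F))"
    proof cases
      case (single n)
      then show ?thesis using s small[of n] by blast
    next
      case (add s' n)
      have "ht n \<le> real (Suc N)" using s add height_sums_ge_1[of s'] by simp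
      moreover have "s' \<in> ?F" using s add ht_ge_1[of n] by simp
      ultimately show ?thesis using add(1) small[of n] by blast
    qed
  qed
  moreover have "finite (\<Union>n\<in>{..Suc N}. insert (ht n) ((+) (ht n) ` ?F))" using Suc by simp
  ultimately show ?case by (rule finite_subset)
qed

text \<open>The path crosses cylinder after cylinder, and it cannot end at a singular point in the middle of
  one. The number N bounds the number of crossings, as every cylinder has height at least 1.\<close>

lemma straight_rise:
  assumes \<gamma>: "straight \<gamma> v" and v: "0 < v $ 2" and "\<gamma> 1 = sing b"
  shows "0 \<le> a \<Longrightarrow> a < 1 \<Longrightarrow> \<gamma> a = pt S i p \<Longrightarrow> p \<in> piece S i \<Longrightarrow> level i p \<Longrightarrow>
    (1 - a) * v $ 2 \<le> real N \<Longrightarrow> (1 - a) * v $ 2 \<in> height_sums"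
proof (induction N arbitrary: a i p)
  case 0
  have "0 < (1 - a) * v $ 2" using 0 v by simp
  then show ?case using 0 by simp
next
  case (Suc N)
  obtain n where n: "\<And>t. a < t \<Longrightarrow> t \<le> 1 \<Longrightarrow> t \<le> a + ht n / v $ 2 \<Longrightarrow>
      \<exists>j q. q \<in> piece S j \<and> \<gamma> t = pt S j q \<and> in_cyl n (v $ 2 * (t - a)) j q"
    using cross_cylinder[OF \<gamma> v Suc.prems(1-5)] by metis
  define T where "T = a + ht n / v $ 2"
  have T: "a < T" "(T - a) * v $ 2 = ht n" using v by (simp_all add: T_def)
  consider "1 < T" | "T = 1" | "T < 1" by linarith
  then show ?case
  proof cases
    case 1
    then obtain j q where j: "\<gamma> 1 = pt S j q" "in_cyl n (v $ 2 * (1 - a)) j q"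
      using n[of 1] Suc.prems unfolding T_def by auto
    have "(1 - a) * v $ 2 < (T - a) * v $ 2" using 1 v by simp
    then have "0 < v $ 2 * (1 - a)" "v $ 2 * (1 - a) < ht n" using v Suc.prems T(2) by (simp_all add: mult.commute)
    moreover have "vertex_class b (j, q)" using pt_eq_sing j(1) assms(3) by metis
    ultimately have False using vertex_not_in_cyl j(2) by blast
    then show ?thesis ..
  next
    case 2
    then show ?thesis using T(2) height_sums.single[of n] by simp
  next
    case 3
    then obtain j q where j: "q \<in> piece S j" "\<gamma> T = pt S j q" "in_cyl n (v $ 2 * (T - a)) j q"
      using n[of T] T(1) unfolding T_def by auto
    have "level j q" using j(3) T(2) unfolding in_cyl_def level_def
      by (auto simp: mult.commute Y_Suc intro: exI[of _ n] exI[of _ "Suc n"])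
    moreover have eq: "(1 - a) * v $ 2 = ht n + (1 - T) * v $ 2" using T(2) by (simp add: algebra_simps)
    moreover from eq have "(1 - T) * v $ 2 \<le> real N" using Suc.prems(6) ht_ge_1[of n] by simp
    ultimately have "(1 - T) * v $ 2 \<in> height_sums"
      using Suc.IH[of T j q] j(1,2) 3 T(1) Suc.prems(1) by simp
    then show ?thesis unfolding eq by (rule height_sums.add)
  qed
qed

lemma joined_rise:
  assumes "joined v a b" "0 < v $ 2"
  shows "v $ 2 \<in> height_sums"
proof -
  obtain \<gamma> where \<gamma>: "straight \<gamma> v" "\<gamma> 0 = sing a" "\<gamma> 1 = sing b" using assms by (auto simp: joined_def)
  define k where "k = (if a then 0 else 1 :: int)"
  have k: "\<gamma> 0 = pt S True (P k)" using \<gamma>(2) by (simp add: sing_def k_def)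
  have "level True (P k)" using P_height by (auto simp: level_def)
  moreover obtain N where "v $ 2 \<le> real N" using real_arch_simple by blast
  ultimately show ?thesis using straight_rise[OF \<gamma>(1) assms(2) \<gamma>(3) _ _ k, of N] by simp
qed

text \<open>A connection that rises by 1 crosses the lowest cylinder only. That cylinder has one
  singular point on each boundary component, and the two are different.\<close>

lemma joined_rise_1:
  assumes "joined v a b" "v $ 2 = 1"
  shows "a \<noteq> b"
proof -
  obtain \<gamma> where \<gamma>: "straight \<gamma> v" "\<gamma> 0 = sing a" "\<gamma> 1 = sing b" using assms by (auto simp: joined_def)
  define k where "k = (if a then 0 else 1 :: int)"
  have k: "\<gamma> 0 = pt S True (P k)" using \<gamma>(2) by (simp add: sing_def k_def)
  have lev: "level True (P k)" using P_height by (auto simp: level_def)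
  have v: "0 < v $ 2" using assms by simp
  obtain n i0 p0 where n: "p0 \<in> piece S i0" "\<gamma> 0 = pt S i0 p0" "in_cyl n 0 i0 p0"
    "\<And>t. 0 < t \<Longrightarrow> t \<le> 1 \<Longrightarrow> t \<le> 0 + ht n / v $ 2 \<Longrightarrow>
      \<exists>j q. q \<in> piece S j \<and> \<gamma> t = pt S j q \<and> in_cyl n (v $ 2 * (t - 0)) j q"
    using cross_cylinder[OF \<gamma>(1) v order_refl zero_less_one k _ lev] by (metis P_in_Q S_piece_simps(1))
  obtain j q where j: "\<gamma> 1 = pt S j q" "in_cyl n 1 j q"
    using n(4)[of 1] assms(2) ht_ge_1[of n] by auto
  have start: "vertex_class a (i0, p0)" using pt_eq_sing n(2) \<gamma>(2) by metis
  have stop: "vertex_class b (j, q)" using pt_eq_sing j(1) \<gamma>(3) by metis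
  have "\<not> 1 < ht n" using vertex_not_in_cyl[OF stop j(2)] by auto
  then have "n = 0" using ht_ge[of n] by simp
  have idx: "Y (nat \<bar>l\<bar>) = 0 \<longleftrightarrow> l = 0" "Y (nat \<bar>l\<bar>) = 1 \<longleftrightarrow> l = 1 \<or> l = - 1" for l
    using Y_eq_iff[of "nat \<bar>l\<bar>" 0] Y_eq_iff[of "nat \<bar>l\<bar>" 1] by (auto simp del: Y_eq_iff) 
  have a
    using start n(3) idx \<open>n = 0\<close> by (auto simp: vertex_class_def in_cyl_def P_height split: if_splits)
  moreover have "\<not> b"
    using stop j(2) idx \<open>n = 0\<close> by (auto simp: vertex_class_def in_cyl_def P_height split: if_splits)
  ultimately show ?thesis by simp
qed

end

section \<open>The generators are realised by affine automorphisms\<close>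

definition mat2 :: "real \<Rightarrow> real \<Rightarrow> real \<Rightarrow> real \<Rightarrow> real^2^2" where
  "mat2 a b c d = vector [vector [a, b], vector [c, d]]"

lemma mat2_mult_vec: "mat2 a b c d *v p = vec2 (a * p $ 1 + b * p $ 2) (c * p $ 1 + d * p $ 2)"
  by (simp add: mat2_def vec2_eq_iff matrix_vector_mult_def sum_2)

lemma mat2_mult: "mat2 a b c d ** mat2 a' b' c' d' =
    mat2 (a * a' + b * c') (a * b' + b * d') (c * a' + d * c') (c * b' + d * d')"
  by (simp add: mat2_def vec_eq_iff forall_2 matrix_matrix_mult_def sum_2)

lemma mat2_1: "mat 1 = mat2 1 0 0 1"
  by (simp add: mat2_def mat_def vec_eq_iff forall_2)

lemma mat2_eq_iff: "mat2 a b c d = mat2 a' b' c' d' \<longleftrightarrow> a = a' \<and> b = b' \<and> c = c' \<and> d = d'"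
  by (auto simp: mat2_def vec_eq_iff forall_2)

lemma mat2_exhaust: "\<exists>a b c d. D = mat2 a b c d"
  by (intro exI[of _ "D $ 1 $ 1"] exI[of _ "D $ 1 $ 2"] exI[of _ "D $ 2 $ 1"] exI[of _ "D $ 2 $ 2"])
    (simp add: mat2_def vec_eq_iff forall_2)

lemma mat2_uminus: "- mat2 a b c d = mat2 (- a) (- b) (- c) (- d)"
  by (simp add: mat2_def vec_eq_iff forall_2)

lemma mat_A_eq: "mat_A = mat2 (- 1) 0 0 1" and mat_B_eq: "mat_B = mat2 (- 1) 2 0 1"
  and mat_C_eq: "mat_C c = mat2 (- c) (c - 1) (- c - 1) c"
  by (simp_all add: mat_A_def mat_B_def mat_C_def mat2_def)

context polygon_param
begin

text \<open>A map G given on the points of the two polygons that respects the gluings and maps short straight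
  segments to straight segments. As it is its own inverse, only one direction has to be
  checked for bijectivity and for germs.\<close>

lemma involution_in_veech_group:
  fixes G :: "bool \<Rightarrow> real^2 \<Rightarrow> (bool \<times> (real^2)) set"
  assumes DD: "D ** D = mat 1"
    and glue: "\<And>k p. p \<in> edge c k \<Longrightarrow> G True p = G False (p - E k)"
    and germ: "\<And>i p v e. 0 < e \<Longrightarrow> (\<And>t. 0 \<le> t \<Longrightarrow> t \<le> e \<Longrightarrow> p + t *\<^sub>R v \<in> piece S i) \<Longrightarrow>
      \<exists>j q d. 0 < d \<and> (\<forall>t. 0 \<le> t \<longrightarrow> t \<le> d \<longrightarrow>
        q + t *\<^sub>R (D *v v) \<in> piece S j \<and> G i (p + t *\<^sub>R v) = pt S j (q + t *\<^sub>R (D *v v)))"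
    and invol: "\<And>i p. p \<in> piece S i \<Longrightarrow> \<exists>j q. q \<in> piece S j \<and> G i p = pt S j q \<and> G j q = pt S i p"
  shows "D \<in> veech_group S"
proof -
  define g where "g x = (let (i, p) = SOME y. y \<in> x in G i p)" for x
  have g: "g (pt S i p) = G i p" if p: "p \<in> piece S i" for i p
  proof -
    have "(SOME y. y \<in> pt S i p) \<in> pt S i p"
      by (rule someI[of _ "(i, p)"]) (use p in \<open>simp add: self_mem_pt\<close>)
    then obtain j q where jq: "(SOME y. y \<in> pt S i p) = (j, q)" "(j, q) \<in> pt S i p" by (metis surj_pair)
    then have "pt S i p = pt S j q" using p by (simp add: pt_eq_iff pt_mem_iff)
    from pt_invariant[OF _ this p, of "\<lambda>(i, p). G i p"] have "G i p = G j q" using glue by simp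
    then show ?thesis by (simp add: g_def jq(1))
  qed
  have gS: "g x \<in> surface S \<and> g (g x) = x" if x: "x \<in> surface S" for x
  proof -
    obtain i p where p: "p \<in> piece S i" "x = pt S i p" using surface_cases[OF x] mem_glue_points by metis
    obtain j q where q: "q \<in> piece S j" "G i p = pt S j q" "G j q = pt S i p" using invol[OF p(1)] by blast
    have "g x = pt S j q" using g[OF p(1)] p(2) q(2) by simp
    then show ?thesis using g[OF q(1)] q(1,3) p(2) pt_in_surface[of j q S] by simp
  qed
  have bij: "bij_betw g (surface S) (surface S)"
    by (rule bij_betw_byWitness[where f' = g]) (use gS in auto)
  have iv: "initial_velocity S (g \<circ> \<gamma>) (D *v v)" if init: "initial_velocity S \<gamma> v" for \<gamma> v
  proof -
    obtain i p e where i: "0 < e" "\<And>t. 0 \<le> t \<Longrightarrow> t \<le> e \<Longrightarrow> p + t *\<^sub>R v \<in> piece S i"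
      "\<And>t. 0 \<le> t \<Longrightarrow> t \<le> e \<Longrightarrow> \<gamma> t = pt S i (p + t *\<^sub>R v)"
      using initial_velocityD[OF init] by blast
    obtain j q d where j: "0 < d" "\<And>t. 0 \<le> t \<Longrightarrow> t \<le> d \<Longrightarrow> q + t *\<^sub>R (D *v v) \<in> piece S j"
      "\<And>t. 0 \<le> t \<Longrightarrow> t \<le> d \<Longrightarrow> G i (p + t *\<^sub>R v) = pt S j (q + t *\<^sub>R (D *v v))"
      using germ[OF i(1,2)] by blast
    show ?thesis
    proof (rule initial_velocity_line[of j S "min d e" q])
      fix t assume t: "0 \<le> t" "t \<le> min d e"
      then show "q + t *\<^sub>R (D *v v) \<in> piece S j" using j(2) by simp
      have "g (\<gamma> t) = G i (p + t *\<^sub>R v)" using t i(2,3)[of t] g by simp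
      then show "(g \<circ> \<gamma>) t = pt S j (q + t *\<^sub>R (D *v v))" using t j(3)[of t] by simp
    qed (use i(1) j(1) in simp_all)
  qed
  have "affine_automorphism S D g"
    unfolding affine_automorphism_def
  proof (intro conjI allI impI bij)
    fix \<gamma> :: "real \<Rightarrow> _" and v assume \<gamma>: "range \<gamma> \<subseteq> surface S"
    show "initial_velocity S \<gamma> v \<longleftrightarrow> initial_velocity S (g \<circ> \<gamma>) (D *v v)"
    proof
      assume "initial_velocity S (g \<circ> \<gamma>) (D *v v)"
      then have "initial_velocity S (g \<circ> (g \<circ> \<gamma>)) (D *v (D *v v))" by (rule iv)
      moreover have "g \<circ> (g \<circ> \<gamma>) = \<gamma>" by (rule ext) (use gS \<gamma> in auto)
      moreover have "D *v (D *v v) = v" using DD by (simp add: matrix_vector_mul_assoc)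
      ultimately show "initial_velocity S \<gamma> v" by simp
    qed (rule iv)
  qed
  moreover have "invertible D" using DD unfolding invertible_def by blast
  ultimately show ?thesis unfolding veech_group_iff by blast
qed

lemma minus_1_in_veech_group: "- mat 1 \<in> veech_group S"
proof (rule involution_in_veech_group[where G = "\<lambda>i p. pt S (\<not> i) (- p)"])
  show "(- mat 1) ** (- mat 1) = (mat 1 :: real^2^2)" unfolding mat2_1 mat2_uminus mat2_mult by simp
next
  fix k p assume p: "p \<in> edge c k"
  show "pt S (\<not> True) (- p) = pt S (\<not> False) (- (p - E k))"
    using pt_edge[OF edge_reflect[OF p]] by simp
next
  fix i p v and e :: real
  assume e: "0 < e" "\<And>t. 0 \<le> t \<Longrightarrow> t \<le> e \<Longrightarrow> p + t *\<^sub>R v \<in> piece S i"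
  have D: "(- mat 1) *v v = - v" unfolding mat2_1 mat2_uminus mat2_mult_vec by (simp add: vec2_eq_iff)
  have eq: "- p + t *\<^sub>R (- v) = - (p + t *\<^sub>R v)" for t by simp
  have "- (p + t *\<^sub>R v) \<in> piece S (\<not> i)" if "0 \<le> t" "t \<le> e" for t
    using e(2)[OF that] unfolding S_piece by (cases i) (simp_all only: minus_minus simp_thms if_True if_False)
  then show "\<exists>j q d. 0 < d \<and> (\<forall>t. 0 \<le> t \<longrightarrow> t \<le> d \<longrightarrow>
        q + t *\<^sub>R ((- mat 1) *v v) \<in> piece S j \<and> pt S (\<not> i) (- (p + t *\<^sub>R v)) = pt S j (q + t *\<^sub>R ((- mat 1) *v v)))"
    unfolding D using e(1) eq by metis
next
  fix i p assume "p \<in> piece S i"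
  then show "\<exists>j q. q \<in> piece S j \<and> pt S (\<not> i) (- p) = pt S j q \<and> pt S (\<not> j) (- q) = pt S i p"
    by (intro exI[of _ "\<not> i"] exI[of _ "- p"]) (cases i; simp)
qed

text \<open>An affine symmetry of the polygon, applied to both polygons, respects the gluings, because it
  carries midpoints of edges to midpoints of edges.\<close>

lemma symmetry_in_veech_group:
  assumes DD: "D ** D = mat 1" and sym: "\<And>k. D *v P k + w = P (s - k)"
  shows "D \<in> veech_group S"
proof -
  define F where "F i p = D *v p + (if i then w else - w)" for i p
  have Dw: "D *v w = - w"
  proof -
    have "D *v (D *v P 0 + w) + w = P 0" using sym[of 0] sym[of s] by simp
    then show ?thesis
      by (simp add: matrix_vector_right_distrib matrix_vector_mul_assoc DD add.assoc eq_neg_iff_add_eq_0)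
  qed
  have FF: "F i (F i p) = p" for i p
    unfolding F_def
    by (cases i) (simp_all add: matrix_vector_right_distrib matrix_vector_mult_diff_distrib
        matrix_vector_mul_assoc DD Dw)
  have lin: "D *v ((1 - t) *\<^sub>R p + t *\<^sub>R q) + w = (1 - t) *\<^sub>R (D *v p + w) + t *\<^sub>R (D *v q + w)" for t p q
    by (simp add: matrix_vector_right_distrib matrix_vector_mult_scaleR algebra_simps)
  have FQ: "D *v q + w \<in> Q_plus c" if "q \<in> Q_plus c" for q
  proof -
    have "convex {q. D *v q + w \<in> Q_plus c}"
      unfolding convex_alt using convex_Q[unfolded convex_alt] by (simp add: lin)
    then have "Q_plus c \<subseteq> {q. D *v q + w \<in> Q_plus c}"
      unfolding Q_plus_def[of c] by (intro hull_minimal) (auto simp: sym simp flip: Q_plus_def)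
    then show ?thesis using that by blast
  qed
  have F_piece: "F i p \<in> piece S i" if "p \<in> piece S i" for i p
  proof (cases i)
    case True
    then show ?thesis using that FQ by (simp add: F_def)
  next
    case False
    have "- F False p = D *v (- p) + w" by (simp add: F_def vec.neg)
    then show ?thesis using that FQ[of "- p"] False by simp
  qed
  show ?thesis
  proof (rule involution_in_veech_group[where G = "\<lambda>i p. pt S i (F i p)", OF DD])
    fix k p assume p: "p \<in> edge c k"
    have s: "s - k - 1 = s - (k + 1)" "s - k - 1 + 1 = s - k" by simp_all
    obtain t where t: "0 \<le> t" "t \<le> 1" "p = (1 - t) *\<^sub>R P k + t *\<^sub>R P (k + 1)"
      using p by (auto simp: edge_def closed_segment_def)
    have "F True p = (1 - t) *\<^sub>R P (s - k) + t *\<^sub>R P (s - (k + 1))"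
      unfolding t(3) F_def by (simp only: if_True lin sym)
    then have "F True p \<in> closed_segment (P (s - k)) (P (s - k - 1))"
      unfolding closed_segment_def s using t(1,2) by blast
    then have "F True p \<in> edge c (s - k - 1)"
      unfolding edge_def s by (simp add: closed_segment_commute s)
    from pt_edge[OF this] have "pt S True (F True p) = pt S False (F True p - E (s - k - 1))" .
    also have "F True p - E (s - k - 1) = F False (p - E k)"
      unfolding s(2) s(1) sym[symmetric] F_def
      by (simp add: matrix_vector_right_distrib matrix_vector_mult_diff_distrib sym[of k, symmetric])
    finally show "pt S True (F True p) = pt S False (F False (p - E k))" .
  next
    fix i p v and e :: real
    assume e: "0 < e" "\<And>t. 0 \<le> t \<Longrightarrow> t \<le> e \<Longrightarrow> p + t *\<^sub>R v \<in> piece S i"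
    have eq: "F i (p + t *\<^sub>R v) = F i p + t *\<^sub>R (D *v v)" for t
      by (simp add: F_def matrix_vector_right_distrib matrix_vector_mult_scaleR)
    have "F i p + t *\<^sub>R (D *v v) \<in> piece S i" if "0 \<le> t" "t \<le> e" for t
      using F_piece[OF e(2)[OF that]] unfolding eq .
    then show "\<exists>j q d. 0 < d \<and> (\<forall>t. 0 \<le> t \<longrightarrow> t \<le> d \<longrightarrow>
        q + t *\<^sub>R (D *v v) \<in> piece S j \<and> pt S i (F i (p + t *\<^sub>R v)) = pt S j (q + t *\<^sub>R (D *v v)))"
      unfolding eq using e(1) by blast
  next
    fix i p assume "p \<in> piece S i"
    then show "\<exists>j q. q \<in> piece S j \<and> pt S i (F i p) = pt S j q \<and> pt S j (F j q) = pt S i p"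
      using F_piece FF by metis
  qed
qed

lemma mat_A_in_veech_group: "mat_A \<in> veech_group S"
proof (rule symmetry_in_veech_group[of _ 0 0])
  show "mat_A ** mat_A = mat 1" unfolding mat_A_eq mat2_mult mat2_1 by simp
  fix k
  show "mat_A *v P k + 0 = P (0 - k)"
    unfolding mat_A_eq mat2_mult_vec
    by (cases k rule: int_cases2) (simp_all add: P_of_nat P_minus_nat vec2_eq_iff)
qed

lemma mat_C_involution: "mat_C c ** mat_C c = mat 1"
  unfolding mat_C_eq mat2_mult mat2_1 mat2_eq_iff by (simp add: algebra_simps)

lemma mat_C_in_veech_group: "mat_C c \<in> veech_group S"
proof (rule symmetry_in_veech_group[of _ "P 1" 1])
  show "mat_C c ** mat_C c = mat 1" by (rule mat_C_involution)
  have P1: "P 1 = vec2 1 1" using P_of_nat[of 1] by simp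
  have T: "T_map c (mat_C c *v T_map c q + P 1) = mat_C c *v q + P 1" for q
    unfolding mat_C_eq mat2_mult_vec P1 by (simp add: T_map_def vec2_eq_iff algebra_simps)
  fix k
  show "mat_C c *v P k + P 1 = P (1 - k)"
  proof (induction k rule: int_induct[of _ 0])
    case base
    then show ?case by (simp add: vertex_0)
  next
    case (step1 k)
    have "T_map c (mat_C c *v P (k + 1) + P 1) = P (1 - k)" using step1 T by (simp add: vertex_step)
    also have "\<dots> = T_map c (P (1 - (k + 1)))" by (simp flip: vertex_step)
    finally show ?case using bij_is_inj[OF bij_T_map] by (metis injD)
  next
    case (step2 k)
    have "T_map c (P (k - 1)) = P k" by (simp flip: vertex_step)
    then have "mat_C c *v P (k - 1) + P 1 = T_map c (P (1 - k))" using T[of "P (k - 1)"] step2 by simp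
    then show ?case by (simp flip: vertex_step add: algebra_simps)
  qed
qed

subsection \<open>The reflection of the horizontal cylinders\<close>

text \<open>Points of the n-th cylinder in terms of the height u and of an angular coordinate with
  period 2 * ht n. The upper polygon occupies the interval of angles between - W and W, the lower
  one the rest.\<close>

definition cyl_pt :: "nat \<Rightarrow> real \<Rightarrow> real \<Rightarrow> (bool \<times> (real^2)) set" where
  "cyl_pt n x u = (let w = W n (Y n + u); y = x - 2 * ht n * of_int \<lfloor>(x + w) / (2 * ht n)\<rfloor> in
     if y \<le> w then pt S True (vec2 y (Y n + u)) else pt S False (vec2 (y - ht n) (u - Y (Suc n))))"

lemma E_eq: "E (int n) = vec2 (ht n) (Y n + Y (Suc n))" "E (- int (Suc n)) = vec2 (- ht n) (Y n + Y (Suc n))"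
proof -
  have "P (int n + 1) = vec2 (X (Suc n)) (Y (Suc n))" using P_of_nat[of "Suc n"] by (simp add: add.commute)
  then show "E (int n) = vec2 (ht n) (Y n + Y (Suc n))" by (simp add: P_of_nat vec2_eq_iff ht_def)
  have eq: "- int (Suc n) + 1 = - int n" by simp
  show "E (- int (Suc n)) = vec2 (- ht n) (Y n + Y (Suc n))"
    unfolding eq P_minus_nat by (simp add: vec2_eq_iff ht_def)
qed

text \<open>At each height u the chords of the two polygons, of lengths twice W, add up to the circumference.\<close>

lemma W_complement: "W n (Y (Suc n) - u) = ht n - W n (Y n + u)"
proof -
  have "ht n * W n (Y (Suc n) - u) = ht n * (ht n - W n (Y n + u))"
    unfolding right_diff_distrib ht_W by (simp add: Y_Suc ht_def algebra_simps)
  then show ?thesis by simp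
qed

context
  fixes n :: nat and u :: real
  assumes u: "0 \<le> u" "u \<le> ht n"
begin

lemma W_range: "0 \<le> W n (Y n + u)" "W n (Y n + u) \<le> ht n"
proof -
  have "X n \<le> W n (Y n + u)" "W n (Y n + u) \<le> X (Suc n)"
    using W_bounds[of n "Y n + u"] u by (simp_all add: Y_Suc)
  then show "0 \<le> W n (Y n + u)" "W n (Y n + u) \<le> ht n"
    using X_nonneg[of n] by (simp_all add: ht_def del: X_nonneg)
qed

lemma right_edge_pt: "pt S True (vec2 (W n (Y n + u)) (Y n + u))
    = pt S False (vec2 (W n (Y n + u) - ht n) (u - Y (Suc n)))"
  and left_edge_pt: "pt S True (vec2 (- W n (Y n + u)) (Y n + u))
    = pt S False (vec2 (ht n - W n (Y n + u)) (u - Y (Suc n)))"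
proof -
  have *: "Y n \<le> Y n + u" "Y n + u \<le> Y (Suc n)" using u by (simp_all add: Y_Suc)
  have "vec2 (W n (Y n + u)) (Y n + u) - E (int n) = vec2 (W n (Y n + u) - ht n) (u - Y (Suc n))"
    unfolding E_eq by (simp add: vec2_eq_iff)
  then show "pt S True (vec2 (W n (Y n + u)) (Y n + u))
    = pt S False (vec2 (W n (Y n + u) - ht n) (u - Y (Suc n)))"
    using pt_edge[OF chord_end_in_Q(1)[OF *]] by simp
  have "vec2 (- W n (Y n + u)) (Y n + u) - E (- int (Suc n)) = vec2 (ht n - W n (Y n + u)) (u - Y (Suc n))"
    unfolding E_eq by (simp add: vec2_eq_iff)
  then show "pt S True (vec2 (- W n (Y n + u)) (Y n + u))
    = pt S False (vec2 (ht n - W n (Y n + u)) (u - Y (Suc n)))"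
    using pt_edge[OF chord_end_in_Q(2)[OF *]] by simp
qed

lemma floor_angle:
  assumes "- W n (Y n + u) \<le> x - 2 * ht n * of_int m" "x - 2 * ht n * of_int m < 2 * ht n - W n (Y n + u)"
  shows "\<lfloor>(x + W n (Y n + u)) / (2 * ht n)\<rfloor> = m"
proof -
  have "of_int m * (2 * ht n) \<le> x + W n (Y n + u)" "x + W n (Y n + u) < (of_int m + 1) * (2 * ht n)"
    using assms by (simp_all add: algebra_simps)
  then show ?thesis by (intro floor_unique) (simp_all add: pos_le_divide_eq pos_divide_less_eq)
qed

text \<open>Both formulas for points of the cylinder stay valid on the closed intervals, because the end
  points belong to glued edges.\<close>

lemma cyl_pt_upper:
  assumes "- W n (Y n + u) \<le> x - 2 * ht n * of_int m" "x - 2 * ht n * of_int m \<le> W n (Y n + u)"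
  shows "cyl_pt n x u = pt S True (vec2 (x - 2 * ht n * of_int m) (Y n + u))"
proof (cases "x - 2 * ht n * of_int m < 2 * ht n - W n (Y n + u)")
  case True
  then show ?thesis using floor_angle[OF assms(1) True] assms(2) by (simp add: cyl_pt_def Let_def)
next
  case False
  then have eq: "W n (Y n + u) = ht n" "x - 2 * ht n * of_int m = ht n"
    using W_range assms by linarith+
  then have x: "x - 2 * ht n * of_int (m + 1) = - ht n" by (simp add: algebra_simps)
  have "\<lfloor>(x + W n (Y n + u)) / (2 * ht n)\<rfloor> = m + 1"
    by (rule floor_angle) (use x eq ht_pos[of n] in simp_all)
  then have "cyl_pt n x u = pt S True (vec2 (- W n (Y n + u)) (Y n + u))"
    using x eq(1) by (simp add: cyl_pt_def Let_def)
  also have "\<dots> = pt S True (vec2 (W n (Y n + u)) (Y n + u))"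
    unfolding left_edge_pt right_edge_pt by (simp add: eq(1))
  finally show ?thesis using eq by simp
qed

lemma cyl_pt_lower:
  assumes "W n (Y n + u) \<le> x - 2 * ht n * of_int m" "x - 2 * ht n * of_int m \<le> 2 * ht n - W n (Y n + u)"
  shows "cyl_pt n x u = pt S False (vec2 (x - 2 * ht n * of_int m - ht n) (u - Y (Suc n)))"
proof (cases "x - 2 * ht n * of_int m < 2 * ht n - W n (Y n + u)")
  case True
  have "\<lfloor>(x + W n (Y n + u)) / (2 * ht n)\<rfloor> = m"
    by (rule floor_angle) (use True assms W_range in linarith)+
  then have *: "cyl_pt n x u = (if x - 2 * ht n * of_int m \<le> W n (Y n + u)
      then pt S True (vec2 (x - 2 * ht n * of_int m) (Y n + u))
      else pt S False (vec2 (x - 2 * ht n * of_int m - ht n) (u - Y (Suc n))))"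
    by (simp add: cyl_pt_def Let_def)
  show ?thesis
  proof (cases "x - 2 * ht n * of_int m \<le> W n (Y n + u)")
    case True
    then have "x - 2 * ht n * of_int m = W n (Y n + u)" using assms by simp
    then show ?thesis unfolding * using right_edge_pt by simp
  qed (simp add: *)
next
  case False
  then have "x - 2 * ht n * of_int m = 2 * ht n - W n (Y n + u)" using assms by simp
  then have x: "x - 2 * ht n * of_int (m + 1) = - W n (Y n + u)"
    "x - 2 * ht n * of_int m - ht n = ht n - W n (Y n + u)" by (simp_all add: algebra_simps)
  have "\<lfloor>(x + W n (Y n + u)) / (2 * ht n)\<rfloor> = m + 1"
    by (rule floor_angle) (use x ht_pos[of n] in simp_all)
  then have "cyl_pt n x u = pt S True (vec2 (- W n (Y n + u)) (Y n + u))"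
    using x(1) W_range(1) by (simp add: cyl_pt_def Let_def)
  then show ?thesis unfolding x(2) left_edge_pt .
qed

lemma upper_in_Q: "\<bar>x\<bar> \<le> W n (Y n + u) \<longleftrightarrow> vec2 x (Y n + u) \<in> piece S True"
  using Q_plus_strip[of n "vec2 x (Y n + u)"] u by (simp add: Y_Suc)

lemma lower_in_Q: "\<bar>x\<bar> \<le> ht n - W n (Y n + u) \<longleftrightarrow> vec2 x (u - Y (Suc n)) \<in> piece S False"
proof -
  have "- vec2 x (u - Y (Suc n)) = vec2 (- x) (Y (Suc n) - u)" by (simp add: vec2_eq_iff)
  then show ?thesis
    using Q_plus_strip[of n "vec2 (- x) (Y (Suc n) - u)"] u W_complement[of n u] by (simp add: Y_Suc)
qed

lemma angle_cases:
  obtains m where "- W n (Y n + u) \<le> x - 2 * ht n * of_int m" "x - 2 * ht n * of_int m \<le> W n (Y n + u)"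
  | m where "W n (Y n + u) \<le> x - 2 * ht n * of_int m" "x - 2 * ht n * of_int m \<le> 2 * ht n - W n (Y n + u)"
proof -
  define m where "m = \<lfloor>(x + W n (Y n + u)) / (2 * ht n)\<rfloor>"
  have "of_int m \<le> (x + W n (Y n + u)) / (2 * ht n)" "(x + W n (Y n + u)) / (2 * ht n) < of_int m + 1"
    unfolding m_def by linarith+
  then have "of_int m * (2 * ht n) \<le> x + W n (Y n + u)" "x + W n (Y n + u) < (of_int m + 1) * (2 * ht n)"
    by (simp_all add: pos_le_divide_eq pos_divide_less_eq)
  then have "- W n (Y n + u) \<le> x - 2 * ht n * of_int m" "x - 2 * ht n * of_int m \<le> 2 * ht n - W n (Y n + u)"
    by (simp_all add: algebra_simps)
  then show thesis using that(1)[of m] that(2)[of m] by linarith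
qed

lemma cyl_pt_periodic: "cyl_pt n (x + 2 * ht n * of_int k) u = cyl_pt n x u"
proof (cases x rule: angle_cases)
  case (1 m)
  then show ?thesis
    using cyl_pt_upper[of x m] cyl_pt_upper[of "x + 2 * ht n * of_int k" "m + k"] by (simp add: algebra_simps)
next
  case (2 m)
  then show ?thesis
    using cyl_pt_lower[of x m] cyl_pt_lower[of "x + 2 * ht n * of_int k" "m + k"] by (simp add: algebra_simps)
qed

end

definition angle :: "nat \<Rightarrow> bool \<Rightarrow> real^2 \<Rightarrow> real" where
  "angle n i p = (if i then p $ 1 else p $ 1 + ht n)"

lemma cyl_pt_angle:
  assumes "in_cyl n u i p" "p \<in> piece S i"
  shows "cyl_pt n (angle n i p) u = pt S i p"
proof -
  have u: "0 \<le> u" "u \<le> ht n" using assms(1) by (simp_all add: in_cyl_def)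
  show ?thesis
  proof (cases i)
    case True
    then have p: "p = vec2 (p $ 1) (Y n + u)" using assms(1) by (simp add: in_cyl_def vec2_eq_iff)
    then have "vec2 (p $ 1) (Y n + u) \<in> piece S True" using assms(2) True by metis
    then have "\<bar>p $ 1\<bar> \<le> W n (Y n + u)" using upper_in_Q[OF u] by blast
    then have "cyl_pt n (p $ 1) u = pt S True (vec2 (p $ 1) (Y n + u))"
      using cyl_pt_upper[OF u, of "p $ 1" 0] by simp
    then show ?thesis using True p by (simp add: angle_def)
  next
    case False
    then have p: "p = vec2 (p $ 1) (u - Y (Suc n))" using assms(1) by (simp add: in_cyl_def vec2_eq_iff)
    then have "vec2 (p $ 1) (u - Y (Suc n)) \<in> piece S False" using assms(2) False by metis
    then have "\<bar>p $ 1\<bar> \<le> ht n - W n (Y n + u)" using lower_in_Q[OF u] by blast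
    then have "cyl_pt n (p $ 1 + ht n) u = pt S False (vec2 (p $ 1) (u - Y (Suc n)))"
      using cyl_pt_lower[OF u, of "p $ 1 + ht n" 0] by simp
    then show ?thesis using False p by (simp add: angle_def)
  qed
qed

lemma cyl_pt_rep:
  assumes u: "0 \<le> u" "u \<le> ht n"
  obtains j q m where "q \<in> piece S j" "in_cyl n u j q" "cyl_pt n x u = pt S j q"
    "angle n j q = x - 2 * ht n * of_int m"
proof (cases x rule: angle_cases[OF u])
  case (1 m)
  then have "\<bar>x - 2 * ht n * of_int m\<bar> \<le> W n (Y n + u)" by linarith
  then show thesis
    using that[of "vec2 (x - 2 * ht n * of_int m) (Y n + u)" True m] cyl_pt_upper[OF u 1]
      upper_in_Q[OF u, of "x - 2 * ht n * of_int m"] u by (simp add: in_cyl_def angle_def)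
next
  case (2 m)
  then have "\<bar>x - 2 * ht n * of_int m - ht n\<bar> \<le> ht n - W n (Y n + u)" by linarith
  then show thesis
    using that[of "vec2 (x - 2 * ht n * of_int m - ht n) (u - Y (Suc n))" False m] cyl_pt_lower[OF u 2]
      lower_in_Q[OF u, of "x - 2 * ht n * of_int m - ht n"] u by (simp add: in_cyl_def angle_def)
qed

text \<open>The reflection of a cylinder in a line of slope 1: it keeps the height u and maps the angle x to
  2 u - x, so its linear part is B.\<close>

definition flip :: "nat \<Rightarrow> real \<Rightarrow> bool \<Rightarrow> real^2 \<Rightarrow> (bool \<times> (real^2)) set" where
  "flip n u i p = cyl_pt n (2 * u - angle n i p) u"

text \<open>On the boundary of a cylinder the reflections become the reflection of the polygons in the
  vertical axis, since 2 u is then a multiple of the circumference. So those of adjacent cylinders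
  fit together.\<close>

lemma flip_boundary:
  assumes cyl: "in_cyl n u i p" and p: "p \<in> piece S i" and "u = 0 \<or> u = ht n"
  shows "flip n u i p = pt S i (vec2 (- p $ 1) (p $ 2))"
proof -
  have u: "0 \<le> u" "u \<le> ht n" using cyl by (simp_all add: in_cyl_def)
  define k :: int where "k = (if u = 0 then 0 else 1)"
  have k: "2 * u = 2 * ht n * of_int k" using assms(3) by (auto simp: k_def)
  show ?thesis
  proof (cases i)
    case True
    then have p2: "p $ 2 = Y n + u" using cyl by (simp add: in_cyl_def)
    then have "p = vec2 (p $ 1) (Y n + u)" by (simp add: vec2_eq_iff)
    then have "\<bar>p $ 1\<bar> \<le> W n (Y n + u)" using upper_in_Q[OF u] p True by metis
    moreover have x: "2 * u - p $ 1 - 2 * ht n * of_int k = - p $ 1" using k by simp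
    ultimately have "cyl_pt n (2 * u - p $ 1) u = pt S True (vec2 (2 * u - p $ 1 - 2 * ht n * of_int k) (Y n + u))"
      by (intro cyl_pt_upper[OF u]) auto
    then show ?thesis unfolding x using True p2 by (simp add: flip_def angle_def)
  next
    case False
    then have p2: "p $ 2 = u - Y (Suc n)" using cyl by (simp add: in_cyl_def)
    then have "p = vec2 (p $ 1) (u - Y (Suc n))" by (simp add: vec2_eq_iff)
    then have "\<bar>p $ 1\<bar> \<le> ht n - W n (Y n + u)" using lower_in_Q[OF u] p False by metis
    moreover have x: "2 * u - (p $ 1 + ht n) - 2 * ht n * of_int (k - 1) = ht n - p $ 1"
      using k by (simp add: algebra_simps)
    ultimately have "cyl_pt n (2 * u - (p $ 1 + ht n)) u
        = pt S False (vec2 (2 * u - (p $ 1 + ht n) - 2 * ht n * of_int (k - 1) - ht n) (u - Y (Suc n)))"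
      by (intro cyl_pt_lower[OF u]) auto
    then show ?thesis unfolding x using False p2 by (simp add: flip_def angle_def)
  qed
qed

lemma in_cyl_cases:
  assumes "in_cyl n u i p" "in_cyl m u' i p"
  shows "n = m \<and> u = u' \<or> (u = 0 \<or> u = ht n) \<and> (u' = 0 \<or> u' = ht m)"
proof -
  define y where "y = (if i then p $ 2 else - p $ 2)"
  have y: "y = (if i then Y n + u else Y (Suc n) - u)" "y = (if i then Y m + u' else Y (Suc m) - u')"
    using assms by (auto simp: in_cyl_def y_def)
  have u: "0 \<le> u" "u \<le> ht n" "0 \<le> u'" "u' \<le> ht m" using assms by (simp_all add: in_cyl_def)
  have ny: "Y n \<le> y" "y \<le> Y (Suc n)" "Y m \<le> y" "y \<le> Y (Suc m)"
    using y u by (auto simp: Y_Suc split: if_splits)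
  have "n = m \<Longrightarrow> u = u'" using y by (auto split: if_splits)
  moreover have "n = m" if "0 < u" "u < ht n"
    using Y_interval_unique[of m y n] ny y(1) that by (auto simp: Y_Suc split: if_splits)
  moreover have "n = m" if "0 < u'" "u' < ht m"
    using Y_interval_unique[of n y m] ny y(2) that by (auto simp: Y_Suc split: if_splits)
  ultimately show ?thesis using u by fastforce
qed

definition cyl_flip :: "bool \<Rightarrow> real^2 \<Rightarrow> (bool \<times> (real^2)) set" where
  "cyl_flip i p = (let (n, u) = SOME (n, u). in_cyl n u i p in flip n u i p)"

lemma cyl_flip_eq:
  assumes "in_cyl n u i p" "p \<in> piece S i"
  shows "cyl_flip i p = flip n u i p"
proof -
  have "case SOME (n, u). in_cyl n u i p of (n, u) \<Rightarrow> in_cyl n u i p"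
    by (rule someI[of _ "(n, u)"]) (use assms in simp)
  then obtain m u' where m: "(SOME (n, u). in_cyl n u i p) = (m, u')" "in_cyl m u' i p" by (auto split: prod.splits)
  have "flip m u' i p = flip n u i p"
    using in_cyl_cases[OF assms(1) m(2)] flip_boundary[OF assms] flip_boundary[OF m(2) assms(2)] by auto
  then show ?thesis by (simp add: cyl_flip_def m(1))
qed

lemma affine_sign:
  obtains d where "0 < d" "\<And>t. 0 \<le> t \<Longrightarrow> t \<le> d \<Longrightarrow> 0 \<le> a + t * b"
  | d where "0 < d" "\<And>t. 0 \<le> t \<Longrightarrow> t \<le> d \<Longrightarrow> a + t * b \<le> (0::real)" "a \<le> 0"
proof -
  define d where "d = \<bar>a\<bar> / (\<bar>b\<bar> + 1)"
  have small: "\<bar>t * b\<bar> \<le> \<bar>a\<bar>" if "0 \<le> t" "t \<le> d" for t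
  proof -
    have "\<bar>t * b\<bar> \<le> d * (\<bar>b\<bar> + 1)" unfolding abs_mult using that by (intro mult_mono) auto
    also have "\<dots> = \<bar>a\<bar>" by (simp add: d_def)
    finally show ?thesis .
  qed
  consider "0 < a" | "a < 0" | "a = 0" "0 \<le> b" | "a = 0" "b < 0" by linarith
  then show thesis
  proof cases
    case 1
    show thesis
    proof (rule that(1)[of d])
      show "0 < d" using 1 by (simp add: d_def)
      show "0 \<le> a + t * b" if "0 \<le> t" "t \<le> d" for t using small[OF that] 1 by linarith
    qed
  next
    case 2
    show thesis
    proof (rule that(2)[of d])
      show "0 < d" using 2 by (simp add: d_def divide_neg_pos)
      show "a + t * b \<le> 0" if "0 \<le> t" "t \<le> d" for t using small[OF that] 2 by linarith
    qed (use 2 in simp)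
  next
    case 3
    then show thesis using that(1)[of 1] by simp
  next
    case 4
    then show thesis using that(2)[of 1] by (simp add: mult_nonneg_nonpos)
  qed
qed

lemma W_affine: "W n (y + t * b) = W n y + t * (b * (X (Suc n) - X n) / ht n)"
  by (simp add: W_def add_divide_distrib diff_divide_distrib algebra_simps)

text \<open>A straight line on a cylinder stays for a short time in one of the two polygons.\<close>

lemma cyl_line:
  assumes e: "0 < e" and u: "\<And>t. 0 \<le> t \<Longrightarrow> t \<le> e \<Longrightarrow> 0 \<le> u + t * b \<and> u + t * b \<le> ht n"
  shows "\<exists>j q d. 0 < d \<and> d \<le> e \<and> (\<forall>t. 0 \<le> t \<longrightarrow> t \<le> d \<longrightarrow>
    q + t *\<^sub>R vec2 a b \<in> piece S j \<and> cyl_pt n (x + t * a) (u + t * b) = pt S j (q + t *\<^sub>R vec2 a b))"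
proof -
  define w where "w t = W n (Y n + (u + t * b))" for t
  define r where "r = b * (X (Suc n) - X n) / ht n"
  have w: "w t = w 0 + t * r" for t using W_affine[of n "Y n + u" t b] by (simp add: w_def r_def algebra_simps)
  have u0: "0 \<le> u" "u \<le> ht n" using u[of 0] e by simp_all
  have w0: "0 \<le> w 0" "w 0 \<le> ht n" using W_range[OF u0] by (simp_all add: w_def)
  have upper: ?thesis if d: "0 < d" and m: "\<And>t. 0 \<le> t \<Longrightarrow> t \<le> d \<Longrightarrow>
      - w t \<le> x + t * a - 2 * ht n * of_int m \<and> x + t * a - 2 * ht n * of_int m \<le> w t" for d m
  proof (intro exI conjI allI impI)
    show "0 < min d e" "min d e \<le> e" using d e by simp_all
    fix t assume "0 \<le> t" "t \<le> min d e"
    then have t: "0 \<le> t" "t \<le> d" "t \<le> e" by simp_all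
    have ut: "0 \<le> u + t * b" "u + t * b \<le> ht n" using u t by simp_all
    have eq: "vec2 (x - 2 * ht n * of_int m) (Y n + u) + t *\<^sub>R vec2 a b
        = vec2 (x + t * a - 2 * ht n * of_int m) (Y n + (u + t * b))" by (simp add: vec2_eq_iff)
    have "\<bar>x + t * a - 2 * ht n * of_int m\<bar> \<le> w t" using m[OF t(1,2)] by linarith
    then show "vec2 (x - 2 * ht n * of_int m) (Y n + u) + t *\<^sub>R vec2 a b \<in> piece S True"
      unfolding eq using upper_in_Q[OF ut] unfolding w_def by blast
    show "cyl_pt n (x + t * a) (u + t * b) = pt S True (vec2 (x - 2 * ht n * of_int m) (Y n + u) + t *\<^sub>R vec2 a b)"
      unfolding eq using m[OF t(1,2)] unfolding w_def by (intro cyl_pt_upper[OF ut]) auto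
  qed
  have lower: ?thesis if d: "0 < d" and m: "\<And>t. 0 \<le> t \<Longrightarrow> t \<le> d \<Longrightarrow>
      w t \<le> x + t * a - 2 * ht n * of_int m \<and> x + t * a - 2 * ht n * of_int m \<le> 2 * ht n - w t" for d m
  proof (intro exI conjI allI impI)
    show "0 < min d e" "min d e \<le> e" using d e by simp_all
    fix t assume "0 \<le> t" "t \<le> min d e"
    then have t: "0 \<le> t" "t \<le> d" "t \<le> e" by simp_all
    have ut: "0 \<le> u + t * b" "u + t * b \<le> ht n" using u t by simp_all
    have eq: "vec2 (x - 2 * ht n * of_int m - ht n) (u - Y (Suc n)) + t *\<^sub>R vec2 a b
        = vec2 (x + t * a - 2 * ht n * of_int m - ht n) (u + t * b - Y (Suc n))" by (simp add: vec2_eq_iff)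
    have "\<bar>x + t * a - 2 * ht n * of_int m - ht n\<bar> \<le> ht n - w t" using m[OF t(1,2)] by linarith
    then show "vec2 (x - 2 * ht n * of_int m - ht n) (u - Y (Suc n)) + t *\<^sub>R vec2 a b \<in> piece S False"
      unfolding eq using lower_in_Q[OF ut] unfolding w_def by blast
    show "cyl_pt n (x + t * a) (u + t * b)
        = pt S False (vec2 (x - 2 * ht n * of_int m - ht n) (u - Y (Suc n)) + t *\<^sub>R vec2 a b)"
      unfolding eq using m[OF t(1,2)] unfolding w_def by (intro cyl_pt_lower[OF ut]) auto
  qed
  define m where "m = \<lfloor>(x + w 0) / (2 * ht n)\<rfloor>"
  define y where "y = x - 2 * ht n * of_int m"
  have "of_int m \<le> (x + w 0) / (2 * ht n)" "(x + w 0) / (2 * ht n) < of_int m + 1"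
    unfolding m_def by linarith+
  then have "of_int m * (2 * ht n) \<le> x + w 0" "x + w 0 < (of_int m + 1) * (2 * ht n)"
    by (simp_all add: pos_le_divide_eq pos_divide_less_eq)
  then have y: "- w 0 \<le> y" "y < 2 * ht n - w 0"
    by (simp_all add: y_def algebra_simps)
  have xt: "x + t * a - 2 * ht n * of_int m = y + t * a"
    "x + t * a - 2 * ht n * of_int (m - 1) = y + 2 * ht n + t * a" for t
    by (simp_all add: y_def algebra_simps)
  \<comment> \<open>The angle is compared with the ends of the interval of the upper polygon and, if it moves
    to the left of that interval, with those of the preceding period. The last comparison in each
    branch is strict at time 0 by the choice of m.\<close>
  show ?thesis
  proof (cases rule: affine_sign[of "y + w 0" "a + r"])
    case (1 d1)
    show ?thesis
    proof (cases rule: affine_sign[of "w 0 - y" "r - a"])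
      case (1 d2)
      show ?thesis
      proof (rule upper[of "min d1 d2" m])
        fix t assume "0 \<le> t" "t \<le> min d1 d2"
        then show "- w t \<le> x + t * a - 2 * ht n * of_int m \<and> x + t * a - 2 * ht n * of_int m \<le> w t"
          unfolding xt w[of t] using \<open>\<And>t. 0 \<le> t \<Longrightarrow> t \<le> d1 \<Longrightarrow> 0 \<le> y + w 0 + t * (a + r)\<close>[of t] 1(2)[of t]
          by (simp add: algebra_simps)
      qed (use 1 \<open>0 < d1\<close> in simp)
    next
      case (2 d2)
      show ?thesis
      proof (cases rule: affine_sign[of "2 * ht n - w 0 - y" "- r - a"])
        case (1 d3)
        show ?thesis
        proof (rule lower[of "min d2 d3" m])
          fix t assume "0 \<le> t" "t \<le> min d2 d3"
          then show "w t \<le> x + t * a - 2 * ht n * of_int m \<and> x + t * a - 2 * ht n * of_int m \<le> 2 * ht n - w t"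
            unfolding xt w[of t] using 2(2)[of t] 1(2)[of t] by (simp add: algebra_simps)
        qed (use 1 2 in simp)
      next
        case (2 d3)
        then show ?thesis using y(2) by simp
      qed
    qed
  next
    case (2 d1)
    show ?thesis
    proof (cases rule: affine_sign[of "y + 2 * ht n - w 0" "a - r"])
      case (1 d2)
      show ?thesis
      proof (rule lower[of "min d1 d2" "m - 1"])
        fix t assume "0 \<le> t" "t \<le> min d1 d2"
        then show "w t \<le> x + t * a - 2 * ht n * of_int (m - 1) \<and>
            x + t * a - 2 * ht n * of_int (m - 1) \<le> 2 * ht n - w t"
          unfolding xt w[of t] using 2(2)[of t] 1(2)[of t] by (simp add: algebra_simps)
      qed (use 1 2 in simp)
    next
      case (2 d2)
      show ?thesis
      proof (cases rule: affine_sign[of "y + 2 * ht n + w 0" "a + r"])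
        case (1 d3)
        show ?thesis
        proof (rule upper[of "min d2 d3" "m - 1"])
          fix t assume "0 \<le> t" "t \<le> min d2 d3"
          then show "- w t \<le> x + t * a - 2 * ht n * of_int (m - 1) \<and>
              x + t * a - 2 * ht n * of_int (m - 1) \<le> w t"
            unfolding xt w[of t] using 2(2)[of t] 1(2)[of t] by (simp add: algebra_simps)
        qed (use 1 2 in simp)
      next
        case (2 d3)
        then show ?thesis using y(1) ht_pos[of n] by simp
      qed
    qed
  qed
qed

lemma Y_interval_right:
  assumes "0 < y"
  obtains n where "Y n < y" "y \<le> Y (Suc n)"
proof -
  obtain n where n: "Y n \<le> y" "y < Y (Suc n)" by (rule Y_interval[OF less_imp_le[OF assms]])
  show thesis
  proof (cases "y = Y n")
    case True
    then obtain m where "n = Suc m" using assms by (cases n) auto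
    then show thesis using that[of m] True by simp
  qed (use n that[of n] in simp)
qed

text \<open>At a level point the cylinder is chosen on the side to which the ray points.\<close>

lemma ray_in_cyl:
  assumes e: "0 < e" "\<And>t. 0 \<le> t \<Longrightarrow> t \<le> e \<Longrightarrow> p + t *\<^sub>R v \<in> piece S i"
  shows "\<exists>n u d. 0 < d \<and> d \<le> e \<and> in_cyl n u i p \<and> (\<forall>t. 0 \<le> t \<longrightarrow> t \<le> d \<longrightarrow>
    0 \<le> u + t * v $ 2 \<and> u + t * v $ 2 \<le> ht n)"
proof -
  define y where "y = (if i then p $ 2 else - p $ 2)"
  define b where "b = (if i then v $ 2 else - v $ 2)"
  have pos: "0 \<le> y + t * b" if "0 \<le> t" "t \<le> e" for t
    using Q_plus_height e(2)[OF that] unfolding S_piece by (cases i) (force simp: y_def b_def)+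
  have "\<exists>n d. 0 < d \<and> d \<le> e \<and> (\<forall>t. 0 \<le> t \<longrightarrow> t \<le> d \<longrightarrow> Y n \<le> y + t * b \<and> y + t * b \<le> Y (Suc n))"
  proof (cases "0 \<le> b")
    case True
    have "0 \<le> y" using pos[of 0] e(1) by simp
    then obtain n where n: "Y n \<le> y" "y < Y (Suc n)" by (rule Y_interval)
    show ?thesis
    proof (cases rule: affine_sign[of "Y (Suc n) - y" "- b"])
      case (1 d)
      have "Y n \<le> y + t * b \<and> y + t * b \<le> Y (Suc n)" if "0 \<le> t" "t \<le> d" for t
        using 1(2)[OF that] n(1) mult_nonneg_nonneg[OF that(1) True] by simp
      then show ?thesis using 1(1) e(1) by (intro exI[of _ n] exI[of _ "min d e"]) simp
    next
      case (2 d)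
      then show ?thesis using n by simp
    qed
  next
    case False
    then have "e * b < 0" using e(1) by (simp add: mult_pos_neg)
    then have "0 < y" using pos[of e] e(1) by simp
    then obtain n where n: "Y n < y" "y \<le> Y (Suc n)" by (rule Y_interval_right)
    show ?thesis
    proof (cases rule: affine_sign[of "y - Y n" "b"])
      case (1 d)
      have "Y n \<le> y + t * b \<and> y + t * b \<le> Y (Suc n)" if "0 \<le> t" "t \<le> d" for t
        using 1(2)[OF that] n(2) mult_nonneg_nonpos[OF that(1), of b] False by simp
      then show ?thesis using 1(1) e(1) by (intro exI[of _ n] exI[of _ "min d e"]) simp
    next
      case (2 d)
      then show ?thesis using n by simp
    qed
  qed
  then obtain n d where d: "0 < d" "d \<le> e"
    "\<And>t. 0 \<le> t \<Longrightarrow> t \<le> d \<Longrightarrow> Y n \<le> y + t * b \<and> y + t * b \<le> Y (Suc n)" by blast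
  define u where "u = (if i then p $ 2 - Y n else p $ 2 + Y (Suc n))"
  have ut: "0 \<le> u + t * v $ 2 \<and> u + t * v $ 2 \<le> ht n" if "0 \<le> t" "t \<le> d" for t
    using d(3)[OF that] by (cases i) (auto simp: u_def y_def b_def Y_Suc)
  moreover have "in_cyl n u i p" using ut[of 0] d(1) by (auto simp: in_cyl_def u_def)
  ultimately show ?thesis using d(1,2) by blast
qed

lemma mat_B_involution: "mat_B ** mat_B = mat 1"
  unfolding mat_B_eq mat2_mult mat2_1 by simp

lemma mat_B_in_veech_group: "mat_B \<in> veech_group S"
proof (rule involution_in_veech_group[where G = cyl_flip, OF mat_B_involution])
  fix k p assume p: "p \<in> edge c k"
  obtain m where m: "Y m \<le> p $ 2" "p $ 2 \<le> Y (Suc m)" "E k $ 2 = Y m + Y (Suc m)" "k = int m \<or> k = - int (Suc m)"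
    using p by (rule edge_strip)
  define u where "u = p $ 2 - Y m"
  have u: "0 \<le> u" "u \<le> ht m" using m(1,2) by (simp_all add: u_def Y_Suc)
  have cyl: "in_cyl m u True p" "in_cyl m u False (p - E k)"
    using u m(3) by (simp_all add: in_cyl_def u_def)
  have pieces: "p \<in> piece S True" "p - E k \<in> piece S False"
    using edge_in_Q[OF p] edge_in_Q[OF edge_reflect[OF p]] by simp_all
  have "flip m u True p = flip m u False (p - E k)"
    using m(4)
  proof
    assume "k = int m"
    then show ?thesis using E_eq(1)[of m] by (simp add: flip_def angle_def)
  next
    assume "k = - int (Suc m)"
    then have "E k = vec2 (- ht m) (Y m + Y (Suc m))" using E_eq(2) by simp
    then have "angle m False (p - E k) = angle m True p + 2 * ht m" by (simp add: angle_def)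
    then have "2 * u - angle m True p = 2 * u - angle m False (p - E k) + 2 * ht m * of_int 1" by simp
    then show ?thesis unfolding flip_def using cyl_pt_periodic[OF u] by metis
  qed
  then show "cyl_flip True p = cyl_flip False (p - E k)"
    using cyl_flip_eq[OF cyl(1) pieces(1)] cyl_flip_eq[OF cyl(2) pieces(2)] by simp
next
  fix i p v and e :: real
  assume e: "0 < e" "\<And>t. 0 \<le> t \<Longrightarrow> t \<le> e \<Longrightarrow> p + t *\<^sub>R v \<in> piece S i"
  obtain n u d where d: "0 < d" "d \<le> e" "in_cyl n u i p" and ut: "\<And>t. 0 \<le> t \<Longrightarrow> t \<le> d \<Longrightarrow>
    0 \<le> u + t * v $ 2 \<and> u + t * v $ 2 \<le> ht n" using ray_in_cyl[OF e] by blast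
  have Bv: "mat_B *v v = vec2 (2 * v $ 2 - v $ 1) (v $ 2)"
    unfolding mat_B_eq mat2_mult_vec by (simp add: vec2_eq_iff)
  obtain j q d' where j: "0 < d'" "d' \<le> d" "\<And>t. 0 \<le> t \<Longrightarrow> t \<le> d' \<Longrightarrow> q + t *\<^sub>R (mat_B *v v) \<in> piece S j \<and>
    cyl_pt n (2 * u - angle n i p + t * (2 * v $ 2 - v $ 1)) (u + t * v $ 2) = pt S j (q + t *\<^sub>R (mat_B *v v))"
    using cyl_line[OF d(1) ut, of "2 * v $ 2 - v $ 1" "2 * u - angle n i p"] unfolding Bv by blast
  have "cyl_flip i (p + t *\<^sub>R v) = pt S j (q + t *\<^sub>R (mat_B *v v))" if t: "0 \<le> t" "t \<le> d'" for t
  proof -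
    have cyl: "in_cyl n (u + t * v $ 2) i (p + t *\<^sub>R v)"
      by (rule in_cyl_move[OF d(3)]) (use ut t j(2) in auto)
    have "p + t *\<^sub>R v \<in> piece S i" using e(2) t j(2) d(2) by simp
    from cyl_flip_eq[OF cyl this]
    have flip: "cyl_flip i (p + t *\<^sub>R v) = flip n (u + t * v $ 2) i (p + t *\<^sub>R v)" .
    have "2 * (u + t * v $ 2) - angle n i (p + t *\<^sub>R v) = 2 * u - angle n i p + t * (2 * v $ 2 - v $ 1)"
      by (simp add: angle_def algebra_simps)
    then show ?thesis unfolding flip flip_def using j(3)[OF t] by metis
  qed
  then show "\<exists>j q d. 0 < d \<and> (\<forall>t. 0 \<le> t \<longrightarrow> t \<le> d \<longrightarrow>
        q + t *\<^sub>R (mat_B *v v) \<in> piece S j \<and> cyl_flip i (p + t *\<^sub>R v) = pt S j (q + t *\<^sub>R (mat_B *v v)))"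
    using j by blast
next
  fix i p assume p: "p \<in> piece S i"
  have "\<And>t. 0 \<le> t \<Longrightarrow> t \<le> 1 \<Longrightarrow> p + t *\<^sub>R 0 \<in> piece S i" using p by simp
  from ray_in_cyl[OF zero_less_one this] obtain n u where cyl: "in_cyl n u i p" by blast
  then have u: "0 \<le> u" "u \<le> ht n" by (simp_all add: in_cyl_def)
  obtain j q m where q: "q \<in> piece S j" "in_cyl n u j q" "cyl_pt n (2 * u - angle n i p) u = pt S j q"
    "angle n j q = 2 * u - angle n i p - 2 * ht n * of_int m"
    using cyl_pt_rep[OF u] by metis
  have "cyl_flip j q = cyl_pt n (angle n i p + 2 * ht n * of_int m) u"
    unfolding cyl_flip_eq[OF q(2,1)] flip_def q(4) by (simp add: algebra_simps)
  also have "\<dots> = pt S i p" using cyl_pt_periodic[OF u] cyl_pt_angle[OF cyl p] by simp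
  finally show "\<exists>j q. q \<in> piece S j \<and> cyl_flip i p = pt S j q \<and> cyl_flip j q = pt S i p"
    using q(1,3) cyl_flip_eq[OF cyl p] unfolding flip_def by metis
qed

end

section \<open>The generated group lies in the Veech group\<close>

lemma veech_group_mult:
  "D \<in> veech_group S \<Longrightarrow> E \<in> veech_group S \<Longrightarrow> D ** E \<in> veech_group S"
  unfolding veech_group_iff using affine_automorphism_comp invertible_mult by blast

lemma veech_group_1: "mat 1 \<in> veech_group S"
  unfolding veech_group_iff using affine_automorphism_id by (auto simp: invertible_def)

lemma veech_group_inverse:
  assumes "D \<in> veech_group S" "D ** E = mat 1" "E ** D = mat 1"
  shows "E \<in> veech_group S"
  using assms affine_automorphism_inverse unfolding veech_group_iff invertible_def by metis

context polygon_param
begin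

abbreviation gens :: "(real^2^2) set" where
  "gens \<equiv> {- mat 1, mat_A, mat_B, mat_C c}"

abbreviation H :: "(real^2^2) set" where
  "H \<equiv> generate GL2 gens"

lemma gens_involutions: "D \<in> gens \<Longrightarrow> D \<noteq> mat 1 \<and> D ** D = mat 1"
proof -
  have "- mat 1 ** - mat 1 = (mat 1 :: real^2^2)" unfolding mat2_1 mat2_uminus mat2_mult by simp
  moreover have "mat_A ** mat_A = mat 1" unfolding mat_A_eq mat2_mult mat2_1 by simp
  moreover have "- mat 1 \<noteq> (mat 1 :: real^2^2)" "mat_A \<noteq> mat 1" "mat_B \<noteq> mat 1" "mat_C c \<noteq> mat 1"
    unfolding mat2_1 mat2_uminus mat_A_eq mat_B_eq mat_C_eq mat2_eq_iff using c_ge_1 by auto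
  ultimately show "D \<in> gens \<Longrightarrow> D \<noteq> mat 1 \<and> D ** D = mat 1"
    using mat_B_involution mat_C_involution by auto
qed

lemma gens_in_GL2: "gens \<subseteq> carrier GL2"
proof
  fix D assume "D \<in> gens"
  then have "D ** D = mat 1" using gens_involutions by blast
  then show "D \<in> carrier GL2" unfolding GL2_def invertible_def by auto
qed

lemma H_1: "mat 1 \<in> H"
  using generate.one[of GL2 gens] by (simp add: GL2_def)

lemma H_gens: "D \<in> gens \<Longrightarrow> D \<in> H"
  by (rule generate.incl)

lemma H_mult: "D \<in> H \<Longrightarrow> F \<in> H \<Longrightarrow> D ** F \<in> H"
  using generate.eng[of D GL2 gens F] by (simp add: GL2_def)

lemma H_inverse:
  assumes "D \<in> H" obtains F where "F \<in> H" "F ** D = mat 1"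
proof -
  have sub: "subgroup H GL2" using group.generate_is_subgroup[OF group_GL2 gens_in_GL2] .
  have "D \<in> carrier GL2" by (rule subgroup.mem_carrier[OF sub assms])
  then have "inv\<^bsub>GL2\<^esub> D \<otimes>\<^bsub>GL2\<^esub> D = \<one>\<^bsub>GL2\<^esub>" by (rule group.l_inv[OF group_GL2])
  moreover have "inv\<^bsub>GL2\<^esub> D \<in> H" using sub assms by (rule subgroup.m_inv_closed)
  ultimately show thesis using that by (simp add: GL2_def)
qed

lemma gens_inv: "D \<in> gens \<Longrightarrow> inv\<^bsub>GL2\<^esub> D = D"
proof -
  assume D: "D \<in> gens"
  then have "D \<otimes>\<^bsub>GL2\<^esub> D = \<one>\<^bsub>GL2\<^esub>" using gens_involutions by (simp add: GL2_def)
  moreover have "D \<in> carrier GL2" using D gens_in_GL2 by blast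
  ultimately show ?thesis using group.inv_equality[OF group_GL2] by blast
qed

lemma H_subset_veech_group: "H \<subseteq> veech_group S"
proof
  have gens: "D \<in> veech_group S" if "D \<in> gens" for D
    using that minus_1_in_veech_group mat_A_in_veech_group mat_B_in_veech_group mat_C_in_veech_group by blast
  fix D assume "D \<in> H"
  then show "D \<in> veech_group S"
  proof induction
    case one
    then show ?case using veech_group_1 by (simp add: GL2_def)
  next
    case (incl D)
    then show ?case by (rule gens)
  next
    case (inv D)
    then show ?case using gens_inv gens by simp
  next
    case (eng D F)
    then show ?case using veech_group_mult by (simp add: GL2_def)
  qed
qed

text \<open>The products of A and B in the two orders are the shears by - 2 and 2.\<close>

lemma shear_in_H: "mat2 1 (2 * of_int n) 0 1 \<in> H"
proof (induction n rule: int_induct[of _ 0])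
  case base
  then show ?case using H_1 by (simp add: mat2_1)
next
  case (step1 n)
  have "mat_B ** mat_A \<in> H" by (intro H_mult H_gens) auto
  then have "mat2 1 2 0 1 \<in> H" unfolding mat_A_eq mat_B_eq mat2_mult by simp
  from H_mult[OF step1(2) this] show ?case unfolding mat2_mult by (simp add: algebra_simps)
next
  case (step2 n)
  have "mat_A ** mat_B \<in> H" by (intro H_mult H_gens) auto
  then have "mat2 1 (- 2) 0 1 \<in> H" unfolding mat_A_eq mat_B_eq mat2_mult by simp
  from H_mult[OF step2(2) this] show ?case unfolding mat2_mult by (simp add: algebra_simps)
qed

lemma signs_in_H: "\<bar>a\<bar> = 1 \<Longrightarrow> \<bar>d\<bar> = 1 \<Longrightarrow> mat2 a 0 0 d \<in> H"
proof -
  assume "\<bar>a\<bar> = 1" "\<bar>d\<bar> = 1"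
  then have "a = 1 \<or> a = - 1" "d = 1 \<or> d = - 1" by linarith+
  moreover have "mat2 1 0 0 1 \<in> H" using H_1 by (simp add: mat2_1)
  moreover have "mat2 (- 1) 0 0 1 \<in> H" using H_gens[of mat_A] by (simp add: mat_A_eq)
  moreover have m: "mat2 (- 1) 0 0 (- 1) \<in> H" using H_gens[of "- mat 1"] by (simp add: mat2_1 mat2_uminus)
  moreover have "mat2 1 0 0 (- 1) \<in> H"
    using H_mult[OF m, of mat_A] H_gens[of mat_A] by (simp add: mat_A_eq mat2_mult)
  ultimately show ?thesis by auto
qed

section \<open>The Veech group lies in the generated group\<close>

definition holonomy :: "real^2 \<Rightarrow> bool" where
  "holonomy v \<longleftrightarrow> (\<exists>a b. joined v a b)"

text \<open>The distinction between loops and other connections is what separates the horizontal from the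
  diagonal direction.\<close>

definition loop_holonomy :: "real^2 \<Rightarrow> bool" where
  "loop_holonomy v \<longleftrightarrow> (\<exists>a. joined v a a)"

lemma loop_holonomy_imp: "loop_holonomy v \<Longrightarrow> holonomy v"
  by (auto simp: loop_holonomy_def holonomy_def)

lemma holonomy_image: "D \<in> veech_group S \<Longrightarrow> holonomy v \<Longrightarrow> holonomy (D *v v)"
  unfolding veech_group_iff holonomy_def using joined_image by metis

lemma loop_holonomy_image:
  assumes "D \<in> veech_group S" "loop_holonomy v" shows "loop_holonomy (D *v v)"
proof -
  obtain g a where "affine_automorphism S D g" "joined v a a"
    using assms by (auto simp: veech_group_iff loop_holonomy_def)
  from joined_image[OF this] show ?thesis unfolding loop_holonomy_def by auto
qed

lemma H_holonomy: "D \<in> H \<Longrightarrow> holonomy v \<Longrightarrow> holonomy (D *v v)"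
  using H_subset_veech_group holonomy_image by blast

lemma loop_2_0: "loop_holonomy (vec2 2 0)"
proof -
  have "P 1 - P (- 1) = vec2 2 0" using P_of_nat[of 1] P_minus_nat[of 1] by (simp add: vec2_eq_iff)
  then have "joined (vec2 2 0) (even (- 1 :: int)) (even (1 :: int))" using joined_chord[of 1 "- 1"] by simp
  then show ?thesis unfolding loop_holonomy_def by auto
qed

lemma holonomy_1_1: "holonomy (vec2 1 1)"
proof -
  have "P 1 - P 0 = vec2 1 1" using P_of_nat[of 1] P_of_nat[of 0] by (simp add: vec2_eq_iff)
  then show ?thesis unfolding holonomy_def using joined_chord[of 1 0] by metis
qed

lemma holonomy_height:
  assumes "holonomy v" "v $ 2 \<noteq> 0"
  shows "\<bar>v $ 2\<bar> \<in> height_sums"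
proof (cases "0 < v $ 2")
  case True
  then show ?thesis using assms joined_rise by (auto simp: holonomy_def)
next
  case False
  have "holonomy (- mat 1 *v v)" by (rule holonomy_image[OF minus_1_in_veech_group assms(1)])
  moreover have "(- mat 1 *v v) $ 2 = - v $ 2" unfolding mat2_1 mat2_uminus mat2_mult_vec by simp
  ultimately show ?thesis
    using False assms(2) joined_rise[of "- mat 1 *v v"] by (auto simp: holonomy_def)
qed

lemma holonomy_height_ge_1: "holonomy v \<Longrightarrow> v $ 2 \<noteq> 0 \<Longrightarrow> 1 \<le> \<bar>v $ 2\<bar>"
  using holonomy_height height_sums_ge_1 by blast

lemma holonomy_horizontal: "holonomy v \<Longrightarrow> v $ 2 = 0 \<Longrightarrow> v $ 1 \<noteq> 0 \<Longrightarrow> 2 \<le> \<bar>v $ 1\<bar>"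
  unfolding holonomy_def using joined_horizontal by blast

lemma holonomy_recession:
  "holonomy v \<Longrightarrow> 0 < v $ 2 \<Longrightarrow> 0 \<le> v $ 1 \<Longrightarrow> (c - 1) * v $ 2 < (c + 1) * v $ 1"
  unfolding holonomy_def using not_joined_recession by blast

lemma loop_height_neq_1:
  assumes "loop_holonomy v" shows "\<bar>v $ 2\<bar> \<noteq> 1"
proof
  assume "\<bar>v $ 2\<bar> = 1"
  then consider "v $ 2 = 1" | "v $ 2 = - 1" by linarith
  then show False
  proof cases
    case 1
    then show ?thesis using assms joined_rise_1 by (auto simp: loop_holonomy_def)
  next
    case 2
    have "loop_holonomy (- mat 1 *v v)" by (rule loop_holonomy_image[OF minus_1_in_veech_group assms])
    moreover have "(- mat 1 *v v) $ 2 = 1" unfolding mat2_1 mat2_uminus mat2_mult_vec using 2 by simp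
    ultimately show ?thesis using joined_rise_1 by (auto simp: loop_holonomy_def)
  qed
qed

lemma mat_C_decreases:
  assumes "(c - 1) * y < (c + 1) * x" "x < y"
  shows "\<bar>(mat_C c *v vec2 x y) $ 2\<bar> < y"
proof -
  have "(c + 1) * x < (c + 1) * y" using assms(2) c_ge_1 by simp
  then show ?thesis using assms(1) unfolding mat_C_eq mat2_mult_vec by (simp add: abs_less_iff algebra_simps)
qed

text \<open>A shear by an even integer brings the first coordinate into the interval from - y to y, and
  changes of signs do the rest.\<close>

lemma normalise_vector:
  assumes "v $ 2 \<noteq> 0"
  shows "\<exists>D\<in>H. 0 \<le> (D *v v) $ 1 \<and> (D *v v) $ 1 \<le> (D *v v) $ 2 \<and> (D *v v) $ 2 = \<bar>v $ 2\<bar>"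
proof -
  define x y where "x = v $ 1" and "y = v $ 2"
  define n where "n = round (x / (2 * y))"
  have "\<bar>of_int n - x / (2 * y)\<bar> \<le> 1 / 2" unfolding n_def by (rule of_int_round_abs_le)
  then have "\<bar>2 * y\<bar> * \<bar>of_int n - x / (2 * y)\<bar> \<le> \<bar>2 * y\<bar> * (1 / 2)" by (rule mult_left_mono) simp
  moreover have "2 * y * (of_int n - x / (2 * y)) = 2 * y * of_int n - x"
    using assms by (simp add: y_def right_diff_distrib)
  ultimately have "\<bar>2 * y * of_int n - x\<bar> \<le> \<bar>2 * y\<bar> * (1 / 2)" by (simp only: abs_mult[symmetric])
  then have small: "\<bar>2 * y * of_int n - x\<bar> \<le> \<bar>y\<bar>" by (simp add: abs_mult)
  define z where "z = x + 2 * of_int (- n) * y"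
  have z: "\<bar>z\<bar> \<le> \<bar>y\<bar>" using small by (simp add: z_def algebra_simps abs_minus_commute)
  define D where "D = mat2 (if 0 \<le> z then 1 else - 1) 0 0 (if 0 \<le> y then 1 else - 1) ** mat2 1 (2 * of_int (- n)) 0 1"
  have "D \<in> H" unfolding D_def by (intro H_mult signs_in_H shear_in_H) auto
  moreover have "(D *v v) $ 1 = \<bar>z\<bar>" "(D *v v) $ 2 = \<bar>y\<bar>"
    unfolding D_def matrix_vector_mul_assoc[symmetric] mat2_mult_vec
    by (simp_all add: z_def x_def y_def algebra_simps)
  ultimately show ?thesis using z by (intro bexI[of _ D]) (auto simp: y_def)
qed

text \<open>A continued fraction algorithm: once the vector lies in the sector between the vertical
  and the diagonal, the matrix C lowers its height, unless the vector is diagonal or lies in a part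
  of the recession cone, where there are no holonomies. The possible heights form a discrete set.\<close>

lemma reduce_holonomy:
  assumes "holonomy v"
  shows "\<exists>D\<in>H. (D *v v) $ 2 = 0 \<or> (D *v v) $ 1 = (D *v v) $ 2"
  using assms
proof (induction "card {s \<in> height_sums. s < \<bar>v $ 2\<bar>}" arbitrary: v rule: less_induct)
  case less
  show ?case
  proof (cases "v $ 2 = 0")
    case True
    then show ?thesis using H_1 by (intro bexI[of _ "mat 1"]) auto
  next
    case False
    obtain D where D: "D \<in> H" "0 \<le> (D *v v) $ 1" "(D *v v) $ 1 \<le> (D *v v) $ 2" "(D *v v) $ 2 = \<bar>v $ 2\<bar>"
      using normalise_vector[OF False] by blast
    define w where "w = D *v v"
    have w: "holonomy w" "0 \<le> w $ 1" "w $ 1 \<le> w $ 2" "w $ 2 = \<bar>v $ 2\<bar>"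
      unfolding w_def using D H_holonomy less.prems by auto
    show ?thesis
    proof (cases "w $ 1 = w $ 2")
      case True
      then show ?thesis using D(1) unfolding w_def by blast
    next
      case neq: False
      define z where "z = mat_C c *v w"
      have "(c - 1) * w $ 2 < (c + 1) * w $ 1"
        by (rule holonomy_recession) (use w False in auto)
      then have "\<bar>(mat_C c *v vec2 (w $ 1) (w $ 2)) $ 2\<bar> < w $ 2"
        by (rule mat_C_decreases) (use w neq in simp)
      moreover have "vec2 (w $ 1) (w $ 2) = w" by (simp add: vec2_eq_iff)
      ultimately have lt: "\<bar>z $ 2\<bar> < \<bar>v $ 2\<bar>" using w(4) by (simp add: z_def)
      have CH: "mat_C c \<in> H" by (intro H_gens) simp
      have z: "holonomy z" unfolding z_def using H_holonomy[OF CH w(1)] .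
      have zv: "z = (mat_C c ** D) *v v" unfolding z_def w_def by (simp add: matrix_vector_mul_assoc)
      have CD: "mat_C c ** D \<in> H" using H_mult[OF CH D(1)] .
      show ?thesis
      proof (cases "z $ 2 = 0")
        case True
        then show ?thesis using CD zv by metis
      next
        case False
        obtain N where "\<bar>v $ 2\<bar> \<le> real N" using real_arch_simple by blast
        then have "{s \<in> height_sums. s < \<bar>v $ 2\<bar>} \<subseteq> {s \<in> height_sums. s \<le> real N}" by auto
        then have fin: "finite {s \<in> height_sums. s < \<bar>v $ 2\<bar>}" using finite_height_sums finite_subset by blast
        have "{s \<in> height_sums. s < \<bar>z $ 2\<bar>} \<subset> {s \<in> height_sums. s < \<bar>v $ 2\<bar>}"
          using lt holonomy_height[OF z False] by (intro psubsetI) auto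
        then have "card {s \<in> height_sums. s < \<bar>z $ 2\<bar>} < card {s \<in> height_sums. s < \<bar>v $ 2\<bar>}"
          by (rule psubset_card_mono[OF fin])
        from less.hyps[OF this z] obtain K where K: "K \<in> H" "(K *v z) $ 2 = 0 \<or> (K *v z) $ 1 = (K *v z) $ 2"
          by blast
        have "K *v z = (K ** (mat_C c ** D)) *v v" unfolding zv by (simp add: matrix_vector_mul_assoc)
        then show ?thesis using K H_mult[OF K(1) CD] by metis
      qed
    qed
  qed
qed

text \<open>A shear in the Veech group that is not an even one could be reduced until C maps a
  connection to a horizontal one which is too short.\<close>

lemma shear_in_veech_group:
  assumes U: "mat2 1 b 0 1 \<in> veech_group S"
  shows "mat2 1 b 0 1 \<in> H"
proof -
  define n where "n = round ((1 + b) / 2)"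
  have "\<bar>of_int n - (1 + b) / 2\<bar> \<le> 1 / 2" unfolding n_def by (rule of_int_round_abs_le)
  then have small: "\<bar>1 + b - 2 * of_int n\<bar> \<le> 1"
    by (simp add: abs_le_iff field_simps)
  define z where "z = 1 + b - 2 * of_int n"
  have hol: "holonomy (vec2 \<bar>z\<bar> 1)"
  proof -
    have "holonomy (mat2 1 b 0 1 *v vec2 1 1)" by (rule holonomy_image[OF U holonomy_1_1])
    then have "holonomy (mat2 1 (2 * of_int (- n)) 0 1 *v (mat2 1 b 0 1 *v vec2 1 1))"
      using H_holonomy[OF shear_in_H] by blast
    then have "holonomy (mat2 (if 0 \<le> z then 1 else - 1) 0 0 1
        *v (mat2 1 (2 * of_int (- n)) 0 1 *v (mat2 1 b 0 1 *v vec2 1 1)))"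
      by (intro H_holonomy[OF signs_in_H]) auto
    then show ?thesis unfolding mat2_mult_vec by (simp add: z_def algebra_simps abs_if split: if_splits)
  qed
  have "\<not> \<bar>z\<bar> < 1"
  proof
    assume z: "\<bar>z\<bar> < 1"
    define w where "w = mat_C c *v vec2 \<bar>z\<bar> 1"
    have w: "holonomy w" unfolding w_def by (intro H_holonomy[OF _ hol] H_gens) simp
    have "(c - 1) * 1 < (c + 1) * \<bar>z\<bar>" using holonomy_recession[OF hol] by simp
    then have "\<bar>w $ 2\<bar> < 1" unfolding w_def using z by (intro mat_C_decreases) auto
    then have w2: "w $ 2 = 0" using holonomy_height_ge_1[OF w] by linarith
    have "(c + 1) * \<bar>z\<bar> = c" using w2 unfolding w_def mat_C_eq mat2_mult_vec by (simp add: algebra_simps)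
    moreover have "w $ 1 = - c * \<bar>z\<bar> + (c - 1)" unfolding w_def mat_C_eq mat2_mult_vec by simp
    moreover have "(c + 1) * (- c * \<bar>z\<bar> + (c - 1)) = - c * ((c + 1) * \<bar>z\<bar>) + (c * c - 1)"
      by (simp add: algebra_simps)
    ultimately have eq: "(c + 1) * w $ 1 = - 1" by simp
    then have "\<bar>c + 1\<bar> * \<bar>w $ 1\<bar> = 1" by (simp flip: abs_mult)
    moreover have "w $ 1 \<noteq> 0" using eq by auto
    then have "2 \<le> \<bar>w $ 1\<bar>" using holonomy_horizontal[OF w w2] by blast
    then have "2 * 2 \<le> \<bar>c + 1\<bar> * \<bar>w $ 1\<bar>" using c_ge_1 by (intro mult_mono) auto
    ultimately show False by simp
  qed
  then have "z = 1 \<or> z = - 1" using small by (auto simp: z_def)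
  then have "b = 2 * of_int n \<or> b = 2 * of_int (n - 1)" by (auto simp: z_def)
  then show ?thesis using shear_in_H by metis
qed

text \<open>The image of the loop (2, 0) would be a diagonal loop. Comparing with the preimage of
  (1, 1), which is horizontal and hence not short, shows that its height is at most 1.\<close>

lemma diagonal_case:
  assumes D: "D \<in> veech_group S" "D *v vec2 2 0 = vec2 x x"
  shows False
proof -
  obtain F where F: "D ** F = mat 1" "F ** D = mat 1" using D(1) by (auto simp: veech_group_iff invertible_def)
  then have "F *v (D *v vec2 2 0) = vec2 2 0" by (simp add: matrix_vector_mul_assoc)
  then have Fx: "F *v vec2 x x = vec2 2 0" unfolding D(2) .
  have x: "x \<noteq> 0"
  proof
    assume "x = 0"
    then have "vec2 x x = 0" by (simp add: vec2_eq_iff)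
    then have "F *v 0 = vec2 2 0" using Fx by metis
    then show False by (simp add: vec2_eq_iff)
  qed
  have "vec2 x x = x *\<^sub>R vec2 1 1" by (simp add: vec2_eq_iff)
  then have eq: "x *\<^sub>R (F *v vec2 1 1) = vec2 2 0" using Fx by (simp add: matrix_vector_mult_scaleR)
  then have "x * (F *v vec2 1 1) $ 1 = 2" "x * (F *v vec2 1 1) $ 2 = 0" by (simp_all add: vec2_eq_iff)
  then have e: "x * (F *v vec2 1 1) $ 1 = 2" "(F *v vec2 1 1) $ 2 = 0" using x by simp_all
  then have "2 \<le> \<bar>(F *v vec2 1 1) $ 1\<bar>"
    using holonomy_horizontal holonomy_image[OF veech_group_inverse[OF D(1) F] holonomy_1_1] by fastforce
  then have "\<bar>x\<bar> * 2 \<le> \<bar>x\<bar> * \<bar>(F *v vec2 1 1) $ 1\<bar>" by (intro mult_left_mono) auto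
  also have "\<dots> = 2" using e(1) by (simp flip: abs_mult)
  finally have "\<bar>x\<bar> \<le> 1" by simp
  moreover have loop: "loop_holonomy (vec2 x x)" using loop_holonomy_image[OF D(1) loop_2_0] unfolding D(2) .
  moreover have "1 \<le> \<bar>x\<bar>" using holonomy_height_ge_1[OF loop_holonomy_imp[OF loop]] x by simp
  ultimately show False using loop_height_neq_1[OF loop] by simp
qed

text \<open>The diagonal entries have absolute value 1, because neither D nor its inverse can shorten the shortest
  horizontal holonomy or lower the least height.\<close>

lemma horizontal_case:
  assumes D: "D \<in> veech_group S" "(D *v vec2 2 0) $ 2 = 0"
  shows "D \<in> H"
proof -
  obtain a b r d where abrd: "D = mat2 a b r d" using mat2_exhaust by blast
  have "r = 0" using D(2) unfolding abrd mat2_mult_vec by simp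
  then have Deq: "D = mat2 a b 0 d" using abrd by simp
  obtain F where F: "D ** F = mat 1" "F ** D = mat 1" using D(1) by (auto simp: veech_group_iff invertible_def)
  obtain a' b' r' d' where Feq: "F = mat2 a' b' r' d'" using mat2_exhaust by blast
  have "d * r' = 0" "d * d' = 1" "a' * a = 1"
    using F unfolding Deq Feq mat2_mult mat2_1 mat2_eq_iff by simp_all
  then have r': "r' = 0" and d: "d * d' = 1" "a * a' = 1" by (auto simp: mult.commute)
  then have nz: "a \<noteq> 0" "a' \<noteq> 0" "d \<noteq> 0" "d' \<noteq> 0" by auto
  have unit: "\<bar>s\<bar> = 1" if "1 \<le> \<bar>s\<bar>" "1 \<le> \<bar>t\<bar>" "s * t = 1" for s t :: real
  proof -
    have "\<bar>s\<bar> * 1 \<le> \<bar>s\<bar> * \<bar>t\<bar>" using that(2) by (intro mult_left_mono) auto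
    also have "\<dots> = 1" using that(3) by (simp flip: abs_mult)
    finally show ?thesis using that(1) by simp
  qed
  have Fv: "F \<in> veech_group S" using veech_group_inverse[OF D(1) F] .
  have a: "\<bar>a\<bar> = 1"
  proof (rule unit[OF _ _ d(2)])
    have "holonomy (vec2 2 0)" using loop_2_0 by (rule loop_holonomy_imp)
    then have "holonomy (D *v vec2 2 0)" "holonomy (F *v vec2 2 0)" using D(1) Fv holonomy_image by blast+
    then show "1 \<le> \<bar>a\<bar>" "1 \<le> \<bar>a'\<bar>"
      unfolding Deq Feq r' mat2_mult_vec using holonomy_horizontal nz by fastforce+
  qed
  have dd: "\<bar>d\<bar> = 1"
  proof (rule unit[OF _ _ d(1)])
    have "holonomy (D *v vec2 1 1)" "holonomy (F *v vec2 1 1)" using D(1) Fv holonomy_image holonomy_1_1 by blast+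
    then show "1 \<le> \<bar>d\<bar>" "1 \<le> \<bar>d'\<bar>"
      unfolding Deq Feq r' mat2_mult_vec using holonomy_height_ge_1 nz by fastforce+
  qed
  have K: "mat2 a 0 0 d \<in> H" using signs_in_H a dd by blast
  have "a = 1 \<or> a = - 1" "d = 1 \<or> d = - 1" using a dd by linarith+
  then have sq: "a * a = 1" "d * d = 1" by auto
  have "mat2 a 0 0 d ** D = mat2 1 (a * b) 0 1" unfolding Deq mat2_mult mat2_eq_iff using sq by simp
  moreover have "mat2 a 0 0 d ** D \<in> veech_group S" using veech_group_mult K H_subset_veech_group D(1) by blast
  ultimately have U: "mat2 1 (a * b) 0 1 \<in> H" using shear_in_veech_group by simp
  have "mat2 a 0 0 d ** mat2 1 (a * b) 0 1 = D" unfolding Deq mat2_mult mat2_eq_iff using sq by (simp flip: mult.assoc)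
  then show ?thesis using H_mult[OF K U] by simp
qed

lemma veech_group_subset_H: "veech_group S \<subseteq> H"
proof
  fix D assume D: "D \<in> veech_group S"
  then have "holonomy (D *v vec2 2 0)" using loop_2_0 loop_holonomy_imp holonomy_image by blast
  then obtain K where K: "K \<in> H" "(K *v (D *v vec2 2 0)) $ 2 = 0 \<or> (K *v (D *v vec2 2 0)) $ 1 = (K *v (D *v vec2 2 0)) $ 2"
    using reduce_holonomy by blast
  have KD: "K ** D \<in> veech_group S" using veech_group_mult K(1) H_subset_veech_group D by blast
  have "((K ** D) *v vec2 2 0) $ 1 \<noteq> ((K ** D) *v vec2 2 0) $ 2"
  proof
    assume "((K ** D) *v vec2 2 0) $ 1 = ((K ** D) *v vec2 2 0) $ 2"
    then have "(K ** D) *v vec2 2 0 = vec2 (((K ** D) *v vec2 2 0) $ 2) (((K ** D) *v vec2 2 0) $ 2)"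
      by (simp add: vec2_eq_iff)
    then show False by (rule diagonal_case[OF KD])
  qed
  then have "((K ** D) *v vec2 2 0) $ 2 = 0" using K(2) by (simp add: matrix_vector_mul_assoc)
  then have KDH: "K ** D \<in> H" by (rule horizontal_case[OF KD])
  obtain L where L: "L \<in> H" "L ** K = mat 1" using H_inverse[OF K(1)] .
  have "L ** (K ** D) = D" unfolding matrix_mul_assoc L(2) by simp
  then show "D \<in> H" using H_mult[OF L(1) KDH] by simp
qed

end

theorem theorem1:
  fixes c :: real
  assumes "c \<ge> 1"
  shows "veech_group (S_surf c) = generate GL2 {- mat 1, mat_A, mat_B, mat_C c} \<and>
    (\<forall>X \<in> {- mat 1, mat_A, mat_B, mat_C c}. X \<noteq> mat 1 \<and> X ** X = mat 1)"
proof -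
  interpret polygon_param c by unfold_locales (rule assms)
  show ?thesis using H_subset_veech_group veech_group_subset_H gens_involutions by blast
qed

end
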